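(* The complete graph $K_8$ (which is $d$-regular with $d=7$) has an edge signing whose signed adjacency matrix $A$ satisfies $$r_A^2=7+2\sqrt6<12=2(d-1),\qquad \rho(A)=4+\sqrt5.$$ Consequently, the constant $$C_{\mathrm{mix}}:=\sup_{\substack{d\ge2\\ G\ \text{finite } d\text{-regular}}}\ \max_{\sigma:\ r_{A_\sigma}^2\le2(d-1)}\frac{\rho(A_\sigma)}{\sqrt{d-1}},$$ where the inner maximum is over edge signings $\sigma$ of $G$ with $r_{A_\sigma}^2\le 2(d-1)$, satisfies $$\frac{4+\sqrt5}{\sqrt6}\le C_{\mathrm{mix}}\le\frac{3+\sqrt5}{2}.$$
   Context: All graphs are finite, simple and undirected, with vertex set identified with $[n]$, $n\ge1$. An edge signing of $G=(V,E)$ is a map $\sigma:E\to\{-1,+1\}$; its signed adjacency matrix $A_\sigma$ is the real symmetric $n\times n$ matrix whose $(i,j)$ entry is $\sigma(\{i,j\})$ if $\{i,j\}\in E$ and $0$ otherwise. $\rho(A)=\|A\|_{\mathrm{op}}$ denotes the spectral radius of a symmetric matrix. For $S\subseteq[n]$, $A[S]$ is the principal submatrix indexed by $S$ (the characteristic polynomial of the empty submatrix is $1$). For Hermitian $n\times n$ matrices $A_1,\dots,A_k$ the normalized mixed determinantal polynomial is $$\chi[A_1,\dots,A_k](x)=k^{-n}\sum_{S_1\sqcup\cdots\sqcup S_k=[n]}\ \prod_{j=1}^k\det(xI-A_j[S_j]),$$ the sum being over ordered partitions of $[n]$ into $k$ possibly empty parts; it is monic of degree $n$ and real-rooted. For a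 real symmetric zero-diagonal matrix $A$, $r_A$ denotes the largest root of $\chi[A,-A]$. It is known (Ravichandran–Srivastava) that for every finite graph of maximum degree at most $d$, $d\ge2$, there is a signing $\sigma$ with $r_{A_\sigma}^2\le2(d-1)$, so the inner maximum is over a nonempty set. *)

theory Defs
  imports
    "HOL-Library.Extended_Real"
    "HOL-Library.FuncSet"
    "HOL-Library.Disjoint_Sets"
    "Jordan_Normal_Form.DL_Submatrix"
    "Jordan_Normal_Form.Char_Poly"
    "Jordan_Normal_Form.Spectral_Radius"
begin

text \<open>
  Vertices are \<open>0, \<dots>, n - 1\<close>, matching the index convention for matrices; edges are
  two-element sets of vertices.
\<close>

definition complete_edges :: "nat \<Rightarrow> nat set set" where
  "complete_edges n = {e. e \<subseteq> {..<n} \<and> card e = 2}"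

definition is_graph :: "nat \<Rightarrow> nat set set \<Rightarrow> bool" where
  "is_graph n E \<longleftrightarrow> n \<ge> 1 \<and> E \<subseteq> complete_edges n"

definition regular_graph :: "nat \<Rightarrow> nat \<Rightarrow> nat set set \<Rightarrow> bool" where
  "regular_graph d n E \<longleftrightarrow> is_graph n E \<and> (\<forall>v<n. card {e \<in> E. v \<in> e} = d)"

definition signings :: "nat set set \<Rightarrow> (nat set \<Rightarrow> real) set" where
  "signings E = (E \<rightarrow>\<^sub>E {-1, 1})"

definition signed_adj :: "nat \<Rightarrow> nat set set \<Rightarrow> (nat set \<Rightarrow> real) \<Rightarrow> real mat" where
  "signed_adj n E \<sigma> = mat n n (\<lambda>(i, j). if {i, j} \<in> E then \<sigma> {i, j} else 0)"

text \<open>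
  The library's spectral radius is the largest modulus of a complex eigenvalue; for a real
  symmetric matrix of positive dimension it is the operator norm.
\<close>

definition rho :: "real mat \<Rightarrow> real" where
  "rho A = spectral_radius (map_mat complex_of_real A)"

definition ordered_partitions :: "nat \<Rightarrow> 'a set \<Rightarrow> (nat \<Rightarrow> 'a set) set" where
  "ordered_partitions k X =
    {S \<in> {..<k} \<rightarrow>\<^sub>E Pow X. disjoint_family_on S {..<k} \<and> (\<Union>j<k. S j) = X}"

text \<open>
  The normalized mixed determinantal polynomial, for \<open>n \<times> n\<close> matrices
  \<open>A\<^sub>1, \<dots>, A\<^sub>k\<close> given as a list of length \<open>k\<close>. The formula makes sense
  over any field; the intended use is for Hermitian (here: real symmetric) matrices. The
  characteristic polynomial of the empty submatrix is \<open>1\<close>, see \<open>char_poly_submatrix_empty\<close>.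
\<close>

definition mixed_det_poly :: "nat \<Rightarrow> 'a::field mat list \<Rightarrow> 'a poly" where
  "mixed_det_poly n As =
    smult (inverse (of_nat (length As) ^ n))
      (\<Sum>S\<in>ordered_partitions (length As) {..<n}.
        \<Prod>j<length As. char_poly (submatrix (As ! j) (S j) (S j)))"

lemma char_poly_submatrix_empty: "char_poly (submatrix A {} {}) = 1"
  by (simp add: char_poly_def char_poly_matrix_def submatrix_def)

definition max_root :: "real mat \<Rightarrow> real" where
  "max_root A = Max {x. poly (mixed_det_poly (dim_row A) [A, - A]) x = 0}"

definition admissible_signings :: "nat \<Rightarrow> nat \<Rightarrow> nat set set \<Rightarrow> (nat set \<Rightarrow> real) set" where
  "admissible_signings d n E =
    {\<sigma> \<in> signings E. (max_root (signed_adj n E \<sigma>))\<^sup>2 \<le> 2 * (real d - 1)}"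

text \<open>
  Suprema are taken in the extended reals, so that boundedness of the set is part of the
  content of an upper bound. The inner supremum is over finitely many signings and
  hence is a maximum as soon as there is an admissible one, see \<open>inner_sup_eq_Max\<close>.
\<close>

definition C_mix :: ereal where
  "C_mix =
    (SUP (d, n, E) \<in> {(d, n, E). d \<ge> 2 \<and> regular_graph d n E}.
      SUP \<sigma> \<in> admissible_signings d n E.
        ereal (rho (signed_adj n E \<sigma>) / sqrt (real d - 1)))"

lemma finite_admissible_signings:
  assumes "is_graph n E"
  shows "finite (admissible_signings d n E)"
proof -
  have "complete_edges n \<subseteq> Pow {..<n}"
    by (auto simp: complete_edges_def)
  with assms have "finite E"
    by (meson finite_Pow_iff finite_lessThan finite_subset is_graph_def)
  then show ?thesis
    by (simp add: admissible_signings_def signings_def finite_PiE)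
qed

lemma inner_sup_eq_Max:
  fixes f :: "(nat set \<Rightarrow> real) \<Rightarrow> real"
  assumes "is_graph n E" and "admissible_signings d n E \<noteq> {}"
  shows "(SUP \<sigma> \<in> admissible_signings d n E. ereal (f \<sigma>)) =
    ereal (MAX \<sigma> \<in> admissible_signings d n E. f \<sigma>)"
proof -
  let ?A = "admissible_signings d n E"
  have fin: "finite ?A"
    using finite_admissible_signings[OF assms(1)] .
  have "(SUP \<sigma> \<in> ?A. ereal (f \<sigma>)) = Max ((\<lambda>\<sigma>. ereal (f \<sigma>)) ` ?A)"
    using fin assms(2) by (simp add: Max_Sup)
  also have "\<dots> = Max (ereal ` (f ` ?A))"
    by (simp add: image_image)
  also have "\<dots> = ereal (Max (f ` ?A))"
    using fin assms(2) by (intro mono_Max_commute[symmetric]) (auto simp: mono_def)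
  finally show ?thesis .
qed

end

theory Submission
  imports Defs
    "HOL-Analysis.Function_Topology"
begin

text \<open>
  Let \<open>A\<close> be a signed adjacency matrix of a \<open>d\<close>-regular graph, \<open>v\<close> a unit eigenvector for its
  largest eigenvalue \<open>\<lambda>\<close>, and \<open>p(u) = 2\<^sup>n \<chi>[A, -A](u / 2)\<close>. Perturbing the first matrix by
  \<open>h v v\<^sup>T\<close> replaces \<open>p\<close> by \<open>p - h q\<close>. This is nonzero for \<open>Im u > 0 \<ge> Im h\<close>, since
  \<open>\<Sum>\<^sub>S det M[S] det N[S\<^sup>c]\<close> does not vanish when \<open>M\<close>, \<open>N\<close> have positive definite imaginary part;
  hence \<open>q / p\<close> is the Stieltjes transform of a probability measure on \<open>[-2 r\<^sub>A, 2 r\<^sub>A]\<close>. On the other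
  hand \<open>p\<close> is the average of \<open>det (u - (A - D A D))\<close> over random sign matrices \<open>D\<close>, which makes the
  first four moments of that measure computable. Integrating \<open>(8(d - 1) - x\<^sup>2)(\<alpha> + \<beta> (x - \<lambda>))\<^sup>2 \<ge> 0\<close>
  bounds \<open>\<lambda>\<close>; the unknown quantities entering the third and fourth moments are controlled by
  \<open>A \<le> \<lambda>\<close> and Cauchy-Schwarz.

  For the lower bound, negate the edges \<open>{0, 1}\<close> and \<open>{0, 2}\<close> of the complete graph on eight vertices.
\<close>

section \<open>Sign averages of determinants\<close>

text \<open>The second moment alone gives \<open>lam^2 + d \<le> 8 * (d - 1)\<close>, hence only the
  constant sqrt 7. For \<open>d \<le> 7\<close> the lower order term makes this sufficient; for
  larger \<open>d\<close> the third and fourth moments are needed. Writing lam^2 = l d and letting d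
  grow, the inequality from affine test functions becomes 1/l <= (7 - l)(8 - l - 1/l), with equality
  when l + 1/l = 7. The larger solution is ((3 + sqrt 5)/2)^2, which is where the constant comes
  from. The obstacle in computing the moments is that p and q are averaged separately: q / p is not
  the average of the Stieltjes transforms of the individual cut matrices, since each of them is
  weighted by its own determinant. From the third order on, the moments therefore contain the
  covariance of this weight with the moments of the single matrices. Expanding at infinity, u = 1/t,
  turns the weights into polynomials 1 + \<open>cut_delta\<close> t^2 + O(t^4), so that the
  correction becomes a finite computation with products of signs.\<close>

type_synonym 'a fmat = "nat \<Rightarrow> nat \<Rightarrow> 'a"

abbreviation fn_mat :: "nat \<Rightarrow> 'a fmat \<Rightarrow> 'a mat" where
  "fn_mat n M \<equiv> mat n n (\<lambda>(i, j). M i j)"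

text \<open>Matrices are kept as functions so that masks and perturbations can be written entrywise;
  values outside the leading n by n block are ignored, which removes carrier conditions.\<close>

definition det_fn :: "nat \<Rightarrow> 'a::comm_ring_1 fmat \<Rightarrow> 'a" where
  "det_fn n M = det (fn_mat n M)"

lemma det_fn_leibniz:
  "det_fn n M = (\<Sum>p | p permutes {..<n}. signof p * (\<Prod>i<n. M i (p i)))"
proof -
  have "fn_mat n M $$ (i, p i) = M i (p i)" if "p permutes {0..<n}" "i \<in> {0..<n}" for p i
    using that permutes_in_image[OF that(1), of i] by simp
  then show ?thesis
    unfolding det_fn_def by (subst det_def'[of _ n]) (auto simp: atLeast0LessThan intro!: sum.cong prod.cong)
qed

lemma det_fn_cong:
  assumes "\<And>i j. i < n \<Longrightarrow> j < n \<Longrightarrow> M i j = N i j"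
  shows "det_fn n M = det_fn n N"
  unfolding det_fn_def by (rule arg_cong[of _ _ det], rule eq_matI) (auto simp: assms)

text \<open>A sign vector is encoded by the set of its negative positions, so averaging over signs
  is summing over \<open>Pow {..<n}\<close> and dividing by \<open>2 ^ n\<close>.\<close>

definition sg :: "nat set \<Rightarrow> nat \<Rightarrow> 'a::comm_ring_1" where
  "sg E i = (if i \<in> E then - 1 else 1)"

lemma sg_mult_self [simp]: "sg E i * sg E i = 1"
  by (simp add: sg_def)

lemma sg_mult_self_left [simp]: "sg E i * (sg E i * x) = x"
  by (simp add: sg_def)

text \<open>Orthogonality of the characters of the group of sign vectors: flipping the sign at a
  point of the symmetric difference of \<open>X\<close> and \<open>Y\<close> negates the
  summand.\<close>

lemma sum_sg_characters:
  fixes I :: "nat set"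
  assumes "finite I" "X \<subseteq> I" "Y \<subseteq> I"
  shows "(\<Sum>E\<in>Pow I. (\<Prod>i\<in>X. sg E i) * (\<Prod>i\<in>Y. sg E i)) =
    (if X = Y then 2 ^ card I else (0::'a::field_char_0))"
proof (cases "X = Y")
  case True
  have "(\<Prod>i\<in>X. sg E i) * (\<Prod>i\<in>X. sg E i) = (1::'a)" for E
    by (simp flip: prod.distrib)
  with True assms show ?thesis by (simp add: card_Pow)
next
  case False
  then obtain j where j: "(j \<in> X) \<noteq> (j \<in> Y)" by blast
  with assms have jI: "j \<in> I" by auto
  define h where "h E = (if j \<in> E then E - {j} else insert j E)" for E :: "nat set"
  have sgh: "sg (h E) i = (if i = j then - 1 else 1) * (sg E i :: 'a)" for E i
    by (cases "j \<in> E"; cases "i = j"; cases "i \<in> E") (simp_all add: h_def sg_def)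
  have pr: "(\<Prod>i\<in>Z. sg (h E) i) = (if j \<in> Z then - 1 else 1) * (\<Prod>i\<in>Z. sg E i :: 'a)"
    if "Z \<subseteq> I" for Z E
  proof -
    have fin: "finite Z" using finite_subset[OF that assms(1)] .
    show ?thesis unfolding sgh prod.distrib prod.delta[OF fin] ..
  qed
  let ?f = "\<lambda>E. (\<Prod>i\<in>X. sg E i) * (\<Prod>i\<in>Y. sg E i) :: 'a"
  have hh: "h (h E) = E" for E
    by (auto simp: h_def)
  have hI: "h E \<in> Pow I" if "E \<in> Pow I" for E
    using that jI by (auto simp: h_def)
  have "sum ?f (Pow I) = sum (\<lambda>E. ?f (h E)) (Pow I)"
    by (rule sum.reindex_bij_witness[of _ h h]) (simp_all only: hh hI)
  also have "\<dots> = sum (\<lambda>E. - ?f E) (Pow I)"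
    by (rule sum.cong) (use j assms in \<open>auto simp: pr\<close>)
  also have "\<dots> = - sum ?f (Pow I)" by (simp add: sum_negf)
  finally show ?thesis using False by simp
qed

definition blk :: "nat set \<Rightarrow> 'a fmat \<Rightarrow> 'a fmat \<Rightarrow> 'a::zero fmat" where
  "blk S M N i j = (if i \<in> S \<and> j \<in> S then M i j else if i \<notin> S \<and> j \<notin> S then N i j else 0)"

text \<open>Padding by the identity turns the principal minor on \<open>S\<close> into a determinant
  of fixed size \<open>n\<close> (\<open>det_submatrix_msk\<close>), so that minors of different
  sizes can be multiplied and varied uniformly.\<close>

definition msk :: "nat set \<Rightarrow> 'a fmat \<Rightarrow> 'a::zero_neq_one fmat" where
  "msk S M i j = (if i \<in> S \<and> j \<in> S then M i j else if i = j then 1 else 0)"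

text \<open>A Leibniz term survives only if the permutation moves no index between \<open>S\<close>
  and its complement; by finiteness this amounts to invariance of the complement.\<close>

lemma prod_blk:
  fixes M N :: "'a::comm_ring_1 fmat"
  assumes p: "p permutes {..<n}" and S: "S \<subseteq> {..<n}"
  shows "(\<Prod>i<n. blk S M N i (p i)) =
    (if p ` ({..<n} - S) = {..<n} - S then (\<Prod>i\<in>S. M i (p i)) * (\<Prod>i\<in>{..<n} - S. N i (p i)) else 0)"
proof (cases "p ` ({..<n} - S) = {..<n} - S")
  case True
  have 1: "p i \<in> {..<n} - S" if "i < n" "i \<notin> S" for i
    using that True by blast
  have 2: "p i \<in> S" if "i \<in> S" for i
  proof (rule ccontr)
    assume "p i \<notin> S"
    moreover have "p i < n" using that S permutes_in_image[OF p, of i] by auto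
    ultimately have "p i \<in> p ` ({..<n} - S)" using True by auto
    then show False using permutes_inj[OF p] that by (auto dest: injD)
  qed
  have "(\<Prod>i<n. blk S M N i (p i)) =
    (\<Prod>i\<in>{..<n} - S. blk S M N i (p i)) * (\<Prod>i\<in>S. blk S M N i (p i))"
    using S by (intro prod.subset_diff) auto
  moreover have "(\<Prod>i\<in>{..<n} - S. blk S M N i (p i)) = (\<Prod>i\<in>{..<n} - S. N i (p i))"
    using 1 by (intro prod.cong) (auto simp: blk_def)
  moreover have "(\<Prod>i\<in>S. blk S M N i (p i)) = (\<Prod>i\<in>S. M i (p i))"
    using 2 by (intro prod.cong) (auto simp: blk_def)
  ultimately show ?thesis using True by (simp add: mult.commute)
next
  case False
  have "\<exists>i<n. (i \<in> S) \<noteq> (p i \<in> S)"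
  proof (rule ccontr)
    assume "\<not> ?thesis"
    then have "p i \<in> {..<n} - S" if "i \<in> {..<n} - S" for i
      using that by (metis Diff_iff lessThan_iff p permutes_in_image)
    then have "p ` ({..<n} - S) \<subseteq> {..<n} - S" by blast
    then have "p ` ({..<n} - S) = {..<n} - S"
      using endo_inj_surj[OF _ _ permutes_inj_on[OF p], of "{..<n} - S"] by simp
    with False show False ..
  qed
  then obtain i where "i < n" "(i \<in> S) \<noteq> (p i \<in> S)" by blast
  then have "blk S M N i (p i) = 0" by (auto simp: blk_def)
  with \<open>i < n\<close> have "(\<Prod>i<n. blk S M N i (p i)) = 0" by (intro prod_zero) auto
  with False show ?thesis by simp
qed

text \<open>In a Leibniz term, taking the \<open>N\<close> summand in the rows outside
  \<open>S\<close> produces the characters of that row set and of its image under \<open>p\<close>.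
  Averaging keeps the term only if the two sets agree, which is the condition in
  \<open>prod_blk\<close>.\<close>

lemma sum_sg_det_fn:
  fixes M N :: "'a::field_char_0 fmat"
  shows "(\<Sum>E\<in>Pow {..<n}. det_fn n (\<lambda>i j. M i j + sg E i * sg E j * N i j)) =
    2 ^ n * (\<Sum>S\<in>Pow {..<n}. det_fn n (blk S M N))"
proof -
  let ?I = "{..<n}"
  have eq: "(\<Sum>E\<in>Pow ?I. \<Prod>i<n. M i (p i) + sg E i * sg E (p i) * N i (p i)) =
    2 ^ n * (\<Sum>S\<in>Pow ?I. \<Prod>i<n. blk S M N i (p i))" if p: "p permutes ?I" for p
  proof -
    have "(\<Sum>E\<in>Pow ?I. \<Prod>i<n. M i (p i) + sg E i * sg E (p i) * N i (p i)) =
      (\<Sum>E\<in>Pow ?I. \<Sum>S\<in>Pow ?I. (\<Prod>i\<in>S. M i (p i)) * (\<Prod>i\<in>?I - S. sg E i * sg E (p i) * N i (p i)))"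
      by (simp add: prod_add)
    also have "\<dots> = (\<Sum>S\<in>Pow ?I. \<Sum>E\<in>Pow ?I.
        ((\<Prod>i\<in>S. M i (p i)) * (\<Prod>i\<in>?I - S. N i (p i))) *
        ((\<Prod>i\<in>?I - S. sg E i) * (\<Prod>i\<in>p ` (?I - S). sg E i)))"
      by (subst sum.swap)
         (auto intro!: sum.cong simp: prod.distrib prod.reindex[OF permutes_inj_on[OF p]] o_def mult_ac)
    also have "\<dots> = (\<Sum>S\<in>Pow ?I. ((\<Prod>i\<in>S. M i (p i)) * (\<Prod>i\<in>?I - S. N i (p i))) *
        (if ?I - S = p ` (?I - S) then 2 ^ n else 0))"
    proof (rule sum.cong[OF refl])
      fix S assume "S \<in> Pow ?I"
      have "p ` (?I - S) \<subseteq> ?I" using permutes_image[OF p] by auto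
      from sum_sg_characters[OF _ _ this, of "?I - S", where ?'a = 'a]
      show "(\<Sum>E\<in>Pow ?I. ((\<Prod>i\<in>S. M i (p i)) * (\<Prod>i\<in>?I - S. N i (p i))) *
        ((\<Prod>i\<in>?I - S. sg E i) * (\<Prod>i\<in>p ` (?I - S). sg E i))) =
        ((\<Prod>i\<in>S. M i (p i)) * (\<Prod>i\<in>?I - S. N i (p i))) *
        (if ?I - S = p ` (?I - S) then 2 ^ n else 0)"
        by (simp flip: sum_distrib_left)
    qed
    also have "\<dots> = 2 ^ n * (\<Sum>S\<in>Pow ?I. \<Prod>i<n. blk S M N i (p i))"
      unfolding sum_distrib_left
      by (rule sum.cong) (auto simp: prod_blk[OF p])
    finally show ?thesis .
  qed
  have "(\<Sum>E\<in>Pow ?I. det_fn n (\<lambda>i j. M i j + sg E i * sg E j * N i j)) =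
    (\<Sum>p | p permutes ?I. signof p * (\<Sum>E\<in>Pow ?I. \<Prod>i<n. M i (p i) + sg E i * sg E (p i) * N i (p i)))"
    unfolding det_fn_leibniz by (subst sum.swap) (simp add: sum_distrib_left)
  also have "\<dots> = (\<Sum>p | p permutes ?I. signof p * (2 ^ n * (\<Sum>S\<in>Pow ?I. \<Prod>i<n. blk S M N i (p i))))"
    by (rule sum.cong) (auto simp: eq)
  also have "\<dots> = 2 ^ n * (\<Sum>S\<in>Pow ?I. det_fn n (blk S M N))"
    unfolding det_fn_leibniz sum_distrib_left by (subst sum.swap) (simp add: mult_ac)
  finally show ?thesis .
qed

lemma det_fn_mult:
  "det_fn n M * det_fn n N = det_fn n (\<lambda>i j. \<Sum>k<n. M i k * N k j)"
proof -
  have "fn_mat n M * fn_mat n N = mat n n (\<lambda>(i, j). \<Sum>k<n. M i k * N k j)"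
    by (rule eq_matI) (auto simp: scalar_prod_def atLeast0LessThan)
  then show ?thesis
    unfolding det_fn_def by (metis det_mult mat_carrier)
qed

text \<open>Each masked matrix acts as the identity on the block of the other one, so their product
  is the block matrix itself.\<close>

lemma det_fn_blk:
  fixes M N :: "'a::comm_ring_1 fmat"
  assumes "S \<subseteq> {..<n}"
  shows "det_fn n (blk S M N) = det_fn n (msk S M) * det_fn n (msk ({..<n} - S) N)"
  unfolding det_fn_mult
proof (rule det_fn_cong)
  fix i j assume ij: "i < n" "j < n"
  have "(\<Sum>k<n. msk S M i k * msk ({..<n} - S) N k j) =
    (\<Sum>k<n. if k = (if i \<in> S then j else i) then blk S M N i j else 0)"
  proof (rule sum.cong[OF refl])
    fix k assume "k \<in> {..<n}"
    then show "msk S M i k * msk ({..<n} - S) N k j =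
      (if k = (if i \<in> S then j else i) then blk S M N i j else 0)"
      using ij by (auto simp: msk_def blk_def)
  qed
  also have "\<dots> = blk S M N i j" using ij by (subst sum.delta) auto
  finally show "blk S M N i j = (\<Sum>k<n. msk S M i k * msk ({..<n} - S) N k j)" ..
qed

lemma det_fn_permute:
  fixes M :: "'a::comm_ring_1 fmat"
  assumes p: "p permutes {..<n}"
  shows "det_fn n (\<lambda>i j. M (p i) (p j)) = det_fn n M"
proof -
  have less: "p i < n" if "i < n" for i using that permutes_in_image[OF p, of i] by simp
  have p': "p permutes {0..<n}" using p by (simp add: atLeast0LessThan)
  have rows: "det_fn n (\<lambda>i j. A (p i) j) = signof p * det_fn n A" for A :: "'a fmat"
  proof -
    have "mat n n (\<lambda>(i, j). A (p i) j) = mat n n (\<lambda>(i, j). fn_mat n A $$ (p i, j))"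
      by (rule eq_matI) (auto simp: less)
    then show ?thesis
      unfolding det_fn_def using det_permute_rows[OF mat_carrier p', of "\<lambda>(i, j). A i j"] by simp
  qed
  have tr: "det_fn n (\<lambda>i j. A j i) = det_fn n A" for A :: "'a fmat"
  proof -
    have "mat n n (\<lambda>(i, j). A j i) = transpose_mat (fn_mat n A)"
      by (rule eq_matI) auto
    then show ?thesis unfolding det_fn_def by (metis det_transpose mat_carrier)
  qed
  have "det_fn n (\<lambda>i j. M (p i) (p j)) = signof p * det_fn n (\<lambda>i j. M i (p j))"
    by (rule rows)
  also have "det_fn n (\<lambda>i j. M i (p j)) = det_fn n (\<lambda>i j. M j (p i))"
    by (rule tr)
  also have "\<dots> = signof p * det_fn n (\<lambda>i j. M j i)" by (rule rows)
  also have "det_fn n (\<lambda>i j. M j i) = det_fn n M" by (rule tr)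
  finally show ?thesis by (simp add: sign_def)
qed

lemma det_submatrix_msk:
  fixes M :: "'a::idom fmat"
  assumes S: "S \<subseteq> {..<n}"
  shows "det (mat (card S) (card S) (\<lambda>(i, j). M (pick S i) (pick S j))) = det_fn n (msk S M)"
proof -
  define k where "k = card S"
  define T where "T = {..<n} - S"
  have fin: "finite S" "finite T" using S finite_subset T_def by auto
  have kn: "k \<le> n" unfolding k_def using card_mono[OF _ S] by simp
  have cT: "card T = n - k" unfolding T_def k_def using S by (simp add: card_Diff_subset fin)
  \<comment> \<open>Lists \<open>S\<close> in increasing order and then its complement; in this
    order the masked matrix is block diagonal with an identity block.\<close>
  define p where "p i = (if i < k then pick S i else if i < n then pick T (i - k) else i)" for i
  have pS: "p i \<in> S" if "i < k" for i
    using that by (simp add: p_def k_def pick_in_set_le)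
  have pT: "p i \<in> T" if "k \<le> i" "i < n" for i
    using that cT by (simp add: p_def pick_in_set_le)
  have pick_eq: "i = j" if "i < card X" "j < card X" "pick X i = pick X j" for i j X
    using that pick_mono_le[of j X i] pick_mono_le[of i X j] by (cases i j rule: linorder_cases) auto
  have pSk: "p i \<in> S \<longleftrightarrow> i < k" if "i < n" for i
    using pS[of i] pT[of i] that unfolding T_def by (cases "i < k") auto
  have inj: "inj_on p {..<n}"
  proof (rule inj_onI)
    fix i j assume ij: "i \<in> {..<n}" "j \<in> {..<n}" "p i = p j"
    have "i < k \<longleftrightarrow> j < k"
      using pSk[of i] pSk[of j] ij by simp
    then show "i = j"
      using ij pick_eq[of i S j] pick_eq[of "i - k" T "j - k"] cT
      by (cases "i < k") (auto simp: p_def k_def diff_less_mono not_less eq_diff_iff)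
  qed
  have perm: "p permutes {..<n}"
  proof (rule bij_imp_permutes)
    have "p ` {..<n} \<subseteq> {..<n}"
      using pS pT S unfolding T_def by (auto simp: not_less) (metis DiffE lessThan_iff not_less subsetD)
    then show "bij_betw p {..<n} {..<n}"
      using inj by (simp add: bij_betw_def endo_inj_surj)
  next
    fix x assume "x \<notin> {..<n}" then show "p x = x" using kn by (auto simp: p_def)
  qed
  let ?B = "mat k k (\<lambda>(i, j). M (pick S i) (pick S j))"
  have "mat n n (\<lambda>(i, j). msk S M (p i) (p j)) =
    four_block_mat ?B (0\<^sub>m k (n - k)) (0\<^sub>m (n - k) k) (1\<^sub>m (n - k))"
  proof (rule eq_matI)
    fix i j assume "i < dim_row (four_block_mat ?B (0\<^sub>m k (n - k)) (0\<^sub>m (n - k) k) (1\<^sub>m (n - k)))"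
      "j < dim_col (four_block_mat ?B (0\<^sub>m k (n - k)) (0\<^sub>m (n - k) k) (1\<^sub>m (n - k)))"
    then have ij: "i < n" "j < n" using kn by auto
    have ne: "p i = p j \<longleftrightarrow> i = j" using inj ij by (auto dest: inj_onD)
    have "four_block_mat ?B (0\<^sub>m k (n - k)) (0\<^sub>m (n - k) k) (1\<^sub>m (n - k)) $$ (i, j) =
      (if i < k \<and> j < k then M (pick S i) (pick S j) else if i = j then 1 else 0)"
      using ij kn by (subst index_mat_four_block) (auto simp: eq_diff_iff)
    also have "\<dots> = msk S M (p i) (p j)"
      unfolding msk_def pSk[OF ij(1)] pSk[OF ij(2)] ne by (simp add: p_def)
    finally show "mat n n (\<lambda>(i, j). msk S M (p i) (p j)) $$ (i, j) =
      four_block_mat ?B (0\<^sub>m k (n - k)) (0\<^sub>m (n - k) k) (1\<^sub>m (n - k)) $$ (i, j)"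
      using ij by simp
  qed (use kn in auto)
  then have "det_fn n (\<lambda>i j. msk S M (p i) (p j)) = det ?B * det (1\<^sub>m (n - k))"
    unfolding det_fn_def
    by (simp only:) (rule det_four_block_mat_lower_left_zero, auto)
  then show ?thesis by (simp add: det_fn_permute[OF perm, of "msk S M"] k_def)
qed

section \<open>Stability\<close>

definition im_pos :: "nat \<Rightarrow> complex fmat \<Rightarrow> bool" where
  "im_pos n M \<longleftrightarrow> (\<forall>x. (\<exists>i<n. x i \<noteq> 0) \<longrightarrow> Im (\<Sum>i<n. \<Sum>j<n. cnj (x i) * M i j * x j) > 0)"

lemma vec_nonzeroD:
  assumes "v \<in> carrier_vec n" "v \<noteq> 0\<^sub>v n"
  shows "\<exists>i<n. v $ i \<noteq> 0"
proof (rule ccontr)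
  assume "\<not> ?thesis"
  then have "v = 0\<^sub>v n" using assms(1) by (intro eq_vecI) auto
  with assms(2) show False ..
qed

lemma det_fn_eq_0D:
  fixes M :: "'a::idom fmat"
  assumes "det_fn n M = 0"
  obtains x where "\<exists>i<n. x i \<noteq> 0" "\<And>i. i < n \<Longrightarrow> (\<Sum>j<n. M i j * x j) = 0"
proof -
  let ?A = "fn_mat n M"
  from assms obtain v where v: "v \<in> carrier_vec n" "v \<noteq> 0\<^sub>v n" "?A *\<^sub>v v = 0\<^sub>v n"
    using det_0_iff_vec_prod_zero[of ?A n] unfolding det_fn_def by auto
  have "\<exists>i<n. v $ i \<noteq> 0" by (rule vec_nonzeroD[OF v(1,2)])
  moreover have "(\<Sum>j<n. M i j * v $ j) = 0" if "i < n" for i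
  proof -
    have "(?A *\<^sub>v v) $ i = 0" using v(3) that by simp
    then show ?thesis using that v(1) by (simp add: scalar_prod_def atLeast0LessThan)
  qed
  ultimately show ?thesis by (rule that)
qed

text \<open>A kernel vector of the masked matrix vanishes outside \<open>W\<close>, hence would be a
  nonzero vector on which the form of \<open>M\<close> itself is 0.\<close>

lemma det_fn_msk_nonzero:
  assumes M: "im_pos n M" and W: "W \<subseteq> {..<n}"
  shows "det_fn n (msk W M) \<noteq> 0"
proof
  assume "det_fn n (msk W M) = 0"
  then obtain x where x: "\<exists>i<n. x i \<noteq> 0" "\<And>i. i < n \<Longrightarrow> (\<Sum>j<n. msk W M i j * x j) = 0"
    by (rule det_fn_eq_0D) blast
  have x0: "x i = 0" if "i < n" "i \<notin> W" for i
  proof -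
    have "(\<Sum>j<n. msk W M i j * x j) = (\<Sum>j<n. if j = i then x i else 0)"
      using that by (intro sum.cong) (auto simp: msk_def)
    also have "\<dots> = x i" using that by simp
    finally show ?thesis using x(2)[OF that(1)] by simp
  qed
  have "(\<Sum>j<n. cnj (x i) * M i j * x j) = 0" if i: "i < n" for i
  proof (cases "i \<in> W")
    case True
    have "(\<Sum>j<n. cnj (x i) * M i j * x j) = cnj (x i) * (\<Sum>j<n. msk W M i j * x j)"
      unfolding sum_distrib_left
    proof (rule sum.cong[OF refl])
      fix j assume "j \<in> {..<n}"
      then show "cnj (x i) * M i j * x j = cnj (x i) * (msk W M i j * x j)"
        using True x0[of j] by (cases "j \<in> W") (auto simp: msk_def)
    qed
    then show ?thesis using x(2)[OF i] by simp
  next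
    case False then show ?thesis using x0[OF i] by simp
  qed
  then have "(\<Sum>i<n. \<Sum>j<n. cnj (x i) * M i j * x j) = 0" by simp
  moreover have "Im (\<Sum>i<n. \<Sum>j<n. cnj (x i) * M i j * x j) > 0"
    using M x(1) unfolding im_pos_def by blast
  ultimately show False by simp
qed

definition add_diag :: "nat \<Rightarrow> 'a \<Rightarrow> 'a::monoid_add fmat \<Rightarrow> 'a fmat" where
  "add_diag i y M a b = M a b + (if a = i \<and> b = i then y else 0)"

text \<open>Multilinearity: differentiating in the diagonal entry \<open>i\<close> deletes
  \<open>i\<close> from the mask. This is what links minors of neighbouring sizes in the induction
  below.\<close>

lemma det_fn_msk_add_diag:
  fixes M :: "'a::comm_ring_1 fmat"
  assumes i: "i \<in> W" and W: "W \<subseteq> {..<n}"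
  shows "det_fn n (msk W (add_diag i y M)) = det_fn n (msk W M) + y * det_fn n (msk (W - {i}) M)"
proof -
  have "(\<Prod>k<n. msk W (add_diag i y M) k (p k)) =
    (\<Prod>k<n. msk W M k (p k)) + y * (\<Prod>k<n. msk (W - {i}) M k (p k))" if p: "p permutes {..<n}" for p
  proof -
    have fin: "finite {..<n}" and iI: "i \<in> {..<n}" using assms by auto
    have inj: "p k = p l \<longleftrightarrow> k = l" for k l
      using permutes_inj[OF p] by (auto dest: injD)
    have 1: "(\<Prod>k\<in>{..<n} - {i}. msk W (add_diag i y M) k (p k)) = (\<Prod>k\<in>{..<n} - {i}. msk W M k (p k))"
      by (rule prod.cong) (simp_all add: msk_def add_diag_def)
    show ?thesis
    proof (cases "p i = i")
      case True
      have pk: "p k \<noteq> i" if "k \<noteq> i" for k using inj[of k i] True that by simp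
      have 2: "(\<Prod>k\<in>{..<n} - {i}. msk (W - {i}) M k (p k)) = (\<Prod>k\<in>{..<n} - {i}. msk W M k (p k))"
      proof (rule prod.cong[OF refl])
        fix k assume "k \<in> {..<n} - {i}"
        then show "msk (W - {i}) M k (p k) = msk W M k (p k)" using pk[of k] by (simp add: msk_def)
      qed
      show ?thesis
        unfolding prod.remove[OF fin iI] 1 2 using True i
        by (simp add: msk_def add_diag_def algebra_simps)
    next
      case False
      then show ?thesis
        unfolding prod.remove[OF fin iI] 1 using i
        by (simp add: msk_def add_diag_def)
    qed
  qed
  then show ?thesis
    unfolding det_fn_leibniz by (simp add: sum.distrib sum_distrib_left algebra_simps)
qed

lemma im_pos_add_diag:
  assumes M: "im_pos n M" and y: "Im y \<ge> 0"
  shows "im_pos n (add_diag i y M)"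
  unfolding im_pos_def
proof (intro allI impI)
  fix x :: "nat \<Rightarrow> complex" assume x: "\<exists>i<n. x i \<noteq> 0"
  have inner: "(\<Sum>b<n. cnj (x a) * add_diag i y M a b * x b) =
      (\<Sum>b<n. cnj (x a) * M a b * x b) + (if a = i \<and> i < n then y * (cnj (x i) * x i) else 0)" for a
  proof -
    have "(\<Sum>b<n. cnj (x a) * add_diag i y M a b * x b) =
      (\<Sum>b<n. cnj (x a) * M a b * x b + (if b = i then (if a = i then y * (cnj (x i) * x i) else 0) else 0))"
      by (rule sum.cong) (auto simp: add_diag_def algebra_simps)
    then show ?thesis by (auto simp: sum.distrib)
  qed
  have "(\<Sum>a<n. \<Sum>b<n. cnj (x a) * add_diag i y M a b * x b) =
    (\<Sum>a<n. \<Sum>b<n. cnj (x a) * M a b * x b) + (if i < n then y * (cnj (x i) * x i) else 0)"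
    unfolding inner sum.distrib by (cases "i < n") simp_all
  moreover have "Im (if i < n then y * (cnj (x i) * x i) else 0) \<ge> 0"
    using y by (simp add: mult.commute[of "cnj _"] complex_mult_cnj)
  moreover have "Im (\<Sum>a<n. \<Sum>b<n. cnj (x a) * M a b * x b) > 0"
    using M x unfolding im_pos_def by blast
  ultimately show "0 < Im (\<Sum>a<n. \<Sum>b<n. cnj (x a) * add_diag i y M a b * x b)"
    by simp
qed

text \<open>The zeros \<open>- a / b\<close> and \<open>- a / c\<close> of the two affine functions
  both lie in the open lower half plane, whereas \<open>c = - b\<close> would make them opposite to
  each other.\<close>

lemma add_nonzero_of_lower_half_plane_ratios:
  fixes a b c :: complex
  assumes "b \<noteq> 0" "c \<noteq> 0" "a \<noteq> 0"
    and b: "\<And>y. Im y \<ge> 0 \<Longrightarrow> a + y * b \<noteq> 0" and c: "\<And>y. Im y \<ge> 0 \<Longrightarrow> a + y * c \<noteq> 0"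
  shows "b + c \<noteq> 0"
proof
  assume "b + c = 0"
  then have cb: "c = - b" by (simp add: eq_neg_iff_add_eq_0 add.commute)
  have "Im (- a / b) < 0" using b[of "- a / b"] \<open>b \<noteq> 0\<close> by force
  moreover have "Im (- a / c) < 0" using c[of "- a / c"] \<open>c \<noteq> 0\<close> by force
  ultimately show False unfolding cb by simp
qed

text \<open>The generalization to two ambient index sets \<open>V\<close>, \<open>W\<close> makes both derivatives in the
  induction step instances of the induction hypothesis.\<close>

lemma sum_msk_nonzero:
  assumes "finite J" "J \<subseteq> V" "J \<subseteq> W" "V \<subseteq> {..<n}" "W \<subseteq> {..<n}" "im_pos n M" "im_pos n N"
  shows "(\<Sum>S\<in>Pow J. det_fn n (msk (V - (J - S)) M) * det_fn n (msk (W - S) N)) \<noteq> 0"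
  using assms
proof (induction J arbitrary: V W M N rule: finite_induct)
  case empty
  then show ?case by (simp add: det_fn_msk_nonzero)
next
  case (insert i J)
  let ?F = "\<lambda>V W M N. \<Sum>S\<in>Pow J. det_fn n (msk (V - (J - S)) M) * det_fn n (msk (W - S) N)"
  have JV: "J \<subseteq> V" "J \<subseteq> W" "J \<subseteq> V - {i}" "J \<subseteq> W - {i}" using insert by auto
  have Vi: "V - {i} \<subseteq> {..<n}" "W - {i} \<subseteq> {..<n}" using insert by auto
  have a: "?F V W M N \<noteq> 0" by (rule insert.IH) (use insert JV in auto)
  have b: "?F (V - {i}) W M N \<noteq> 0" by (rule insert.IH) (use insert JV Vi in auto)
  have c: "?F V (W - {i}) M N \<noteq> 0" by (rule insert.IH) (use insert JV Vi in auto)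
  have comm: "V - (J - S) - {i} = V - {i} - (J - S)" "W - S - {i} = W - {i} - S" for S V W by auto
  have b': "?F V W M N + y * ?F (V - {i}) W M N \<noteq> 0" if "Im y \<ge> 0" for y
  proof -
    have "det_fn n (msk (V - (J - S)) (add_diag i y M)) =
      det_fn n (msk (V - (J - S)) M) + y * det_fn n (msk (V - {i} - (J - S)) M)" for S
      by (subst det_fn_msk_add_diag) (use insert in \<open>auto simp: comm\<close>)
    then have "?F V W (add_diag i y M) N = ?F V W M N + y * ?F (V - {i}) W M N"
      by (simp add: sum.distrib sum_distrib_left algebra_simps)
    moreover have "?F V W (add_diag i y M) N \<noteq> 0"
      by (rule insert.IH) (use insert JV that im_pos_add_diag in auto)
    ultimately show ?thesis by simp
  qed
  have c': "?F V W M N + y * ?F V (W - {i}) M N \<noteq> 0" if "Im y \<ge> 0" for y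
  proof -
    have "det_fn n (msk (W - S) (add_diag i y N)) =
      det_fn n (msk (W - S) N) + y * det_fn n (msk (W - {i} - S) N)" if "S \<in> Pow J" for S
      by (subst det_fn_msk_add_diag) (use insert that in \<open>auto simp: comm\<close>)
    then have "?F V W M (add_diag i y N) = (\<Sum>S\<in>Pow J. det_fn n (msk (V - (J - S)) M) *
        (det_fn n (msk (W - S) N) + y * det_fn n (msk (W - {i} - S) N)))"
      by (intro sum.cong) simp_all
    then have "?F V W M (add_diag i y N) = ?F V W M N + y * ?F V (W - {i}) M N"
      by (simp add: sum.distrib sum_distrib_left algebra_simps)
    moreover have "?F V W M (add_diag i y N) \<noteq> 0"
      by (rule insert.IH) (use insert JV that im_pos_add_diag in auto)
    ultimately show ?thesis by simp
  qed
  have "?F (V - {i}) W M N + ?F V (W - {i}) M N \<noteq> 0"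
    using b c a b' c' by (rule add_nonzero_of_lower_half_plane_ratios)
  \<comment> \<open>Split by membership of \<open>i\<close> in \<open>S\<close>: if \<open>i\<close>
    is not in \<open>S\<close> it is deleted from the mask of \<open>M\<close>, otherwise from the
    mask of \<open>N\<close>.\<close>
  also have "?F (V - {i}) W M N + ?F V (W - {i}) M N =
    (\<Sum>S\<in>Pow (insert i J). det_fn n (msk (V - (insert i J - S)) M) * det_fn n (msk (W - S) N))"
  proof -
    have "(\<Sum>S\<in>Pow (insert i J). det_fn n (msk (V - (insert i J - S)) M) * det_fn n (msk (W - S) N)) =
      (\<Sum>S\<in>Pow J. det_fn n (msk (V - (insert i J - S)) M) * det_fn n (msk (W - S) N)) +
      (\<Sum>S\<in>insert i ` Pow J. det_fn n (msk (V - (insert i J - S)) M) * det_fn n (msk (W - S) N))"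
      unfolding Pow_insert by (rule sum.union_disjoint) (use insert.hyps in auto)
    also have "(\<Sum>S\<in>insert i ` Pow J. det_fn n (msk (V - (insert i J - S)) M) * det_fn n (msk (W - S) N)) =
      ?F V (W - {i}) M N"
    proof (subst sum.reindex)
      show "inj_on (insert i) (Pow J)" using insert.hyps by (auto intro!: inj_onI)
      show "sum ((\<lambda>S. det_fn n (msk (V - (insert i J - S)) M) * det_fn n (msk (W - S) N)) \<circ> insert i) (Pow J)
        = ?F V (W - {i}) M N"
      proof (rule sum.cong[OF refl])
        fix S
        have e: "insert i J - insert i S = J - S" "W - insert i S = W - {i} - S"
          using insert.hyps by auto
        show "((\<lambda>S. det_fn n (msk (V - (insert i J - S)) M) * det_fn n (msk (W - S) N)) \<circ> insert i) S
          = det_fn n (msk (V - (J - S)) M) * det_fn n (msk (W - {i} - S) N)"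
          by (simp only: o_def e(1)) (simp only: e(2))
      qed
    qed
    also have "(\<Sum>S\<in>Pow J. det_fn n (msk (V - (insert i J - S)) M) * det_fn n (msk (W - S) N)) =
      ?F (V - {i}) W M N"
    proof (rule sum.cong[OF refl])
      fix S assume "S \<in> Pow J"
      then have "V - (insert i J - S) = V - {i} - (J - S)" using insert.hyps by auto
      then show "det_fn n (msk (V - (insert i J - S)) M) * det_fn n (msk (W - S) N) =
        det_fn n (msk (V - {i} - (J - S)) M) * det_fn n (msk (W - S) N)" by simp
    qed
    finally show ?thesis ..
  qed
  finally show ?case .
qed

corollary sum_blk_nonzero:
  assumes "im_pos n M" "im_pos n N"
  shows "(\<Sum>S\<in>Pow {..<n}. det_fn n (blk S M N)) \<noteq> 0"
proof -
  have "(\<Sum>S\<in>Pow {..<n}. det_fn n (blk S M N)) =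
    (\<Sum>S\<in>Pow {..<n}. det_fn n (msk ({..<n} - ({..<n} - S)) M) * det_fn n (msk ({..<n} - S) N))"
    by (rule sum.cong) (auto simp: det_fn_blk double_diff)
  with sum_msk_nonzero[OF _ _ _ _ _ assms, of "{..<n}" "{..<n}" "{..<n}"] show ?thesis by simp
qed

text \<open>Sylvester's identity: \<open>?X\<close> factors into block triangular matrices in two
  ways, and the two factorizations yield the two sides.\<close>

lemma det_one_minus_mult_commute:
  fixes P Q :: "'a::idom mat"
  assumes P: "P \<in> carrier_mat n m" and Q: "Q \<in> carrier_mat m n"
  shows "det (1\<^sub>m n - P * Q) = det (1\<^sub>m m - Q * P)"
proof -
  let ?X = "four_block_mat (1\<^sub>m n) P Q (1\<^sub>m m)"
  have "det ?X = det (four_block_mat (1\<^sub>m n) (0\<^sub>m n m) Q (1\<^sub>m m) * four_block_mat (1\<^sub>m n) P (0\<^sub>m m n) (1\<^sub>m m - Q * P))"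
    by (subst mult_four_block_mat[where ?nr1.0 = n and ?nr2.0 = m and ?n1.0 = n and ?n2.0 = m and ?nc1.0 = n and ?nc2.0 = m])
       (use P Q in \<open>auto intro!: arg_cong[of _ _ det] arg_cong4[of _ _ _ _ _ _ _ _ four_block_mat] eq_matI\<close>)
  also have "\<dots> = det (four_block_mat (1\<^sub>m n) (0\<^sub>m n m) Q (1\<^sub>m m)) *
      det (four_block_mat (1\<^sub>m n) P (0\<^sub>m m n) (1\<^sub>m m - Q * P))"
    by (rule det_mult[of _ "n + m"]) (use P Q in auto)
  also have "det (four_block_mat (1\<^sub>m n) (0\<^sub>m n m) Q (1\<^sub>m m)) = 1"
    by (subst det_four_block_mat_upper_right_zero[of _ n _ m]) (use P Q in auto)
  also have "det (four_block_mat (1\<^sub>m n) P (0\<^sub>m m n) (1\<^sub>m m - Q * P)) = det (1\<^sub>m m - Q * P)"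
    by (subst det_four_block_mat_lower_left_zero[of _ n _ m]) (use P Q in auto)
  finally have 1: "det ?X = det (1\<^sub>m m - Q * P)" by simp
  have "det ?X = det (four_block_mat (1\<^sub>m n) P (0\<^sub>m m n) (1\<^sub>m m) * four_block_mat (1\<^sub>m n - P * Q) (0\<^sub>m n m) Q (1\<^sub>m m))"
    by (subst mult_four_block_mat[where ?nr1.0 = n and ?nr2.0 = m and ?n1.0 = n and ?n2.0 = m and ?nc1.0 = n and ?nc2.0 = m])
       (use P Q in \<open>auto intro!: arg_cong[of _ _ det] arg_cong4[of _ _ _ _ _ _ _ _ four_block_mat] eq_matI\<close>)
  also have "\<dots> = det (four_block_mat (1\<^sub>m n) P (0\<^sub>m m n) (1\<^sub>m m)) *
      det (four_block_mat (1\<^sub>m n - P * Q) (0\<^sub>m n m) Q (1\<^sub>m m))"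
    by (rule det_mult[of _ "n + m"]) (use P Q in auto)
  also have "det (four_block_mat (1\<^sub>m n) P (0\<^sub>m m n) (1\<^sub>m m)) = 1"
    by (subst det_four_block_mat_lower_left_zero[of _ n _ m]) (use P Q in auto)
  also have "det (four_block_mat (1\<^sub>m n - P * Q) (0\<^sub>m n m) Q (1\<^sub>m m)) = det (1\<^sub>m n - P * Q)"
    by (subst det_four_block_mat_upper_right_zero[of _ n _ m]) (use P Q in auto)
  finally have 2: "det ?X = det (1\<^sub>m n - P * Q)" by simp
  from 1 2 show ?thesis by simp
qed

text \<open>The matrix determinant lemma, with a solution \<open>y\<close> of M y = u in place of
  the inverse: M - u w^T = M (1 - y w^T), and Sylvester's identity evaluates the second
  factor.\<close>

lemma det_fn_rank_one_update:
  fixes M :: "'a::idom fmat"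
  assumes y: "\<And>i. i < n \<Longrightarrow> (\<Sum>j<n. M i j * y j) = u i"
  shows "det_fn n (\<lambda>i j. M i j - u i * w j) = det_fn n M * (1 - (\<Sum>i<n. w i * y i))"
proof -
  let ?P = "mat n 1 (\<lambda>(i, j). y i)" and ?Q = "mat 1 n (\<lambda>(i, j). w j)"
  let ?D = "\<lambda>i j. (if i = j then 1 else 0) - y i * w j"
  have "det_fn n (\<lambda>i j. M i j - u i * w j) = det_fn n (\<lambda>i j. \<Sum>k<n. M i k * ?D k j)"
  proof (rule det_fn_cong)
    fix i j assume ij: "i < n" "j < n"
    have "(\<Sum>k<n. M i k * ?D k j) = (\<Sum>k<n. (if k = j then M i j else 0)) - (\<Sum>k<n. M i k * y k) * w j"
      unfolding sum_distrib_right sum_subtractf[symmetric]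
      by (rule sum.cong) (auto simp: algebra_simps)
    then show "M i j - u i * w j = (\<Sum>k<n. M i k * ?D k j)" using ij y[of i] by simp
  qed
  also have "\<dots> = det_fn n M * det_fn n ?D" by (rule det_fn_mult[symmetric])
  also have "det_fn n ?D = det (1\<^sub>m n - ?P * ?Q)"
    unfolding det_fn_def by (intro arg_cong[of _ _ det] eq_matI) (auto simp: scalar_prod_def)
  also have "\<dots> = det (1\<^sub>m 1 - ?Q * ?P)" by (rule det_one_minus_mult_commute) auto
  also have "\<dots> = 1 - (\<Sum>i<n. w i * y i)"
    by (subst det_single) (auto simp: scalar_prod_def atLeast0LessThan)
  finally show ?thesis .
qed

section \<open>Mixed determinantal polynomials as averages over cuts\<close>

lemma poly_char_poly_fn:
  fixes M :: "'a::field fmat"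
  shows "poly (char_poly (fn_mat n M)) x = det_fn n (\<lambda>i j. (if i = j then x else 0) - M i j)"
  unfolding char_poly_matrix[OF mat_carrier] det_fn_def
  by (intro arg_cong[of _ _ det] eq_matI) (auto simp: char_matrix_def)

lemma sum_ordered_partitions_2:
  fixes X :: "'b set"
  shows "(\<Sum>S\<in>ordered_partitions 2 X. g (S 0) (S 1)) = (\<Sum>S\<in>Pow X. g S (X - S))"
proof (rule sum.reindex_bij_witness[of _ "\<lambda>S j. if j = 0 then S else if j = 1 then X - S else undefined" "\<lambda>S. S 0"])
  fix S :: "nat \<Rightarrow> 'b set" assume S: "S \<in> ordered_partitions 2 X"
  have two: "{..<2} = {0, 1::nat}" by auto
  from S have disj: "S 0 \<inter> S 1 = {}" and un: "S 0 \<union> S 1 = X" and PiE: "S \<in> {..<2} \<rightarrow>\<^sub>E Pow X"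
    by (simp_all add: ordered_partitions_def two disjoint_family_on_def)
  from disj un have S1: "S 1 = X - S 0" by blast
  \<comment> \<open>Partitions are extensional functions, so their values from index 2 on are
    forced; only then does \<open>S 0\<close> determine all of \<open>S\<close>.\<close>
  have ext: "S j = undefined" if "j \<ge> 2" for j
    using PiE_arb[OF PiE, of j] that by simp
  show "(\<lambda>j. if j = 0 then S 0 else if j = 1 then X - S 0 else undefined) = S"
  proof
    fix j show "(if j = 0 then S 0 else if j = 1 then X - S 0 else undefined) = S j"
      using S1 ext[of j] by (cases "j = 0"; cases "j = 1") auto
  qed
  show "S 0 \<in> Pow X" using un by blast
  show "g (S 0) (X - S 0) = g (S 0) (S 1)" using S1 by simp
next
  fix S assume "S \<in> Pow X"
  moreover have two: "{..<2} = {0, 1::nat}" by auto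
  ultimately show "(\<lambda>j. if j = 0 then S else if j = 1 then X - S else undefined) \<in> ordered_partitions 2 X"
    by (auto simp: ordered_partitions_def two disjoint_family_on_def PiE_def extensional_def Pi_def)
qed auto

definition diag_fn :: "'a \<Rightarrow> 'a::zero fmat" where
  "diag_fn x i j = (if i = j then x else 0)"

lemma poly_char_poly_submatrix:
  fixes M :: "'a::field fmat"
  assumes S: "S \<subseteq> {..<n}"
  shows "poly (char_poly (submatrix (fn_mat n M) S S)) x = det_fn n (msk S (\<lambda>i j. diag_fn x i j - M i j))"
proof -
  have fin: "finite S" using S finite_subset by auto
  have "{i. i < n \<and> i \<in> S} = S" using S by auto
  moreover have "pick S i < n" if "i < card S" for i
    using pick_in_set_le[OF that] S by auto
  ultimately have sub: "submatrix (fn_mat n M) S S =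
    mat (card S) (card S) (\<lambda>(i, j). M (pick S i) (pick S j))"
    by (intro eq_matI) (auto simp: submatrix_def)
  have inj: "pick S i = pick S j \<longleftrightarrow> i = j" if "i < card S" "j < card S" for i j
    using that pick_mono_le[of j S i] pick_mono_le[of i S j] by (cases i j rule: linorder_cases) auto
  have "det_fn (card S) (\<lambda>i j. (if i = j then x else 0) - M (pick S i) (pick S j)) =
    det (mat (card S) (card S) (\<lambda>(i, j). diag_fn x (pick S i) (pick S j) - M (pick S i) (pick S j)))"
    unfolding det_fn_def by (intro arg_cong[of _ _ det] eq_matI) (auto simp: inj diag_fn_def)
  also have "\<dots> = det_fn n (msk S (\<lambda>i j. diag_fn x i j - M i j))"
    by (rule det_submatrix_msk[OF S])
  finally show ?thesis unfolding sub poly_char_poly_fn .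
qed

text \<open>Averaged over random signs \<open>D = diag(sg E)\<close>, the block diagonal matrices
  \<open>A[S] \<oplus> -A[S\<^sup>c]\<close> defining \<open>\<chi>[A, -A]\<close> and the cut matrices \<open>(A - D A D) / 2\<close> have the
  same characteristic polynomial; the latter are far easier to expand.\<close>

definition cut_fn :: "'a fmat \<Rightarrow> nat set \<Rightarrow> 'a::comm_ring_1 fmat" where
  "cut_fn a E i j = a i j - sg E i * sg E j * a i j"

lemma poly_mixed_det_poly:
  fixes a :: "real fmat"
  shows "poly (mixed_det_poly n [fn_mat n a, - fn_mat n a]) x =
    (\<Sum>S\<in>Pow {..<n}. det_fn n (blk S (\<lambda>i j. diag_fn x i j - a i j) (\<lambda>i j. diag_fn x i j + a i j))) / 2 ^ n"
proof -
  let ?A = "fn_mat n a"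
  have neg: "- ?A = mat n n (\<lambda>(i, j). - a i j)" by (rule eq_matI) auto
  have "{..<length [?A, - ?A]} = {0, 1::nat}" by auto
  then have "poly (mixed_det_poly n [?A, - ?A]) x =
    (\<Sum>S\<in>ordered_partitions 2 {..<n}. poly (char_poly (submatrix ?A (S 0) (S 0))) x *
      poly (char_poly (submatrix (- ?A) (S 1) (S 1))) x) / 2 ^ n"
    by (simp add: mixed_det_poly_def poly_sum numeral_2_eq_2 divide_inverse mult.commute)
  also have "(\<Sum>S\<in>ordered_partitions 2 {..<n}. poly (char_poly (submatrix ?A (S 0) (S 0))) x *
      poly (char_poly (submatrix (- ?A) (S 1) (S 1))) x) =
    (\<Sum>S\<in>Pow {..<n}. poly (char_poly (submatrix ?A S S)) x *
      poly (char_poly (submatrix (- ?A) ({..<n} - S) ({..<n} - S))) x)"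
    by (rule sum_ordered_partitions_2)
  also have "\<dots> = (\<Sum>S\<in>Pow {..<n}. det_fn n (blk S (\<lambda>i j. diag_fn x i j - a i j) (\<lambda>i j. diag_fn x i j + a i j)))"
    unfolding neg by (rule sum.cong) (auto simp: poly_char_poly_submatrix det_fn_blk)
  finally show ?thesis .
qed

text \<open>Split the scalar part into two halves. Conjugation by signs fixes the half that joins
  \<open>+ a\<close>, so \<open>sum_sg_det_fn\<close> applies, and a perturbation \<open>h\<close>
  ends up in the first block only.\<close>

lemma sum_det_cut_fn:
  fixes a :: "'a::field_char_0 fmat"
  shows "(\<Sum>E\<in>Pow {..<n}. det_fn n (\<lambda>i j. diag_fn u i j - cut_fn a E i j - h i j)) =
    2 ^ n * (\<Sum>S\<in>Pow {..<n}. det_fn n (blk S (\<lambda>i j. diag_fn (u / 2) i j - a i j - h i j) (\<lambda>i j. diag_fn (u / 2) i j + a i j)))"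
  unfolding sum_sg_det_fn[symmetric]
  by (intro sum.cong refl det_fn_cong) (auto simp: cut_fn_def diag_fn_def algebra_simps)

section \<open>Partial fractions of Nevanlinna quotients\<close>

abbreviation cpoly :: "real poly \<Rightarrow> complex poly" where
  "cpoly \<equiv> map_poly complex_of_real"

lemma poly_cpoly_of_real [simp]: "poly (cpoly p) (complex_of_real x) = of_real (poly p x)"
  by (induction p) (auto simp: map_poly_pCons)

lemma cpoly_mult: "cpoly (p * q) = cpoly p * cpoly q"
  by (rule poly_eqI) (simp add: coeff_map_poly coeff_mult)

lemma cpoly_linear_power: "poly (cpoly ([:- a, 1:] ^ j)) z = (z - of_real a) ^ j"
  by (induction j) (simp_all add: cpoly_mult map_poly_pCons del: mult_pCons_left)

lemma cnj_poly_cpoly: "cnj (poly (cpoly p) z) = poly (cpoly p) (cnj z)"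
  by (induction p) (auto simp: map_poly_pCons)

lemma prod_linear_dvd:
  fixes p :: "'a::field poly"
  assumes "finite R" "\<And>a. a \<in> R \<Longrightarrow> poly p a = 0"
  shows "(\<Prod>a\<in>R. [:- a, 1:]) dvd p"
  using assms
proof (induction R rule: finite_induct)
  case (insert a R)
  then obtain h where h: "p = (\<Prod>a\<in>R. [:- a, 1:]) * h" by (auto simp: dvd_def)
  have "poly (\<Prod>a\<in>R. [:- a, 1:]) a \<noteq> 0"
    using insert.hyps by (auto simp: poly_prod prod_zero_iff)
  moreover have "poly p a = 0" using insert.prems by simp
  ultimately have "poly h a = 0" unfolding h by simp
  then obtain k where "h = [:- a, 1:] * k" by (auto simp: poly_eq_0_iff_dvd dvd_def)
  then have "p = (\<Prod>a\<in>insert a R. [:- a, 1:]) * k" unfolding h using insert.hyps by (simp add: mult_ac del: mult_pCons_left mult_pCons_right)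
  then show ?case by simp
qed simp

text \<open>Approach the pole along the ray a + s w with s > 0. Multiplying the quotient by s^j
  keeps the sign of the imaginary part, and the limit is the leading Laurent coefficient over
  w^j.\<close>

lemma pole_sign:
  fixes p q p1 :: "real poly"
  assumes im: "\<And>z. Im z > 0 \<Longrightarrow> Im (poly (cpoly q) z / poly (cpoly p) z) \<le> 0"
    and p: "p = [:- a, 1:] ^ j * p1" and p1: "poly p1 a \<noteq> 0" and w: "Im w > 0"
  shows "poly q a / poly p1 a * Im (1 / w ^ j) \<le> 0"
proof -
  define f where "f s = poly (cpoly q) (of_real a + of_real s * w) /
    (w ^ j * poly (cpoly p1) (of_real a + of_real s * w))" for s
  have w0: "w \<noteq> 0" using w by auto
  have "Im (f s) \<le> 0" if s: "s > 0" for s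
  proof -
    let ?z = "of_real a + of_real s * w"
    have "Im ?z > 0" using s w by simp
    from im[OF this] have "Im (poly (cpoly q) ?z / poly (cpoly p) ?z) \<le> 0" .
    moreover have "poly (cpoly p) ?z = of_real (s ^ j) * (w ^ j * poly (cpoly p1) ?z)"
      unfolding p cpoly_mult poly_mult cpoly_linear_power by (simp add: power_mult_distrib mult_ac)
    ultimately have "Im (poly (cpoly q) ?z / (of_real (s ^ j) * (w ^ j * poly (cpoly p1) ?z))) \<le> 0"
      by simp
    also have "poly (cpoly q) ?z / (of_real (s ^ j) * (w ^ j * poly (cpoly p1) ?z)) = f s / of_real (s ^ j)"
      by (simp add: f_def)
    also have "Im \<dots> = Im (f s) / s ^ j" by (rule Im_divide_of_real)
    finally show ?thesis using zero_less_power[OF s, of j] by (simp add: divide_le_0_iff not_le)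
  qed
  then have ev: "\<forall>\<^sub>F s in at_right 0. Im (f s) \<le> 0"
    by (auto simp: eventually_at_right_field intro: exI[of _ 1])
  have "isCont f 0"
    unfolding f_def using p1 w0 by (intro continuous_intros) auto
  then have "(f \<longlongrightarrow> f 0) (at 0)" by (simp add: isCont_def)
  then have "(f \<longlongrightarrow> f 0) (at_right 0)" by (rule tendsto_within_subset) simp
  then have "((\<lambda>s. Im (f s)) \<longlongrightarrow> Im (f 0)) (at_right 0)" by (rule tendsto_Im)
  from tendsto_upperbound[OF this ev] have "Im (f 0) \<le> 0" by simp
  also have "f 0 = of_real (poly q a / poly p1 a) * (1 / w ^ j)" by (simp add: f_def)
  finally show ?thesis
    by (simp only: times_complex.sel Re_complex_of_real Im_complex_of_real mult_zero_left add_0_right)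
qed

text \<open>As w runs through the upper half plane, w^j reaches both i and -i once j is at least 2;
  the two opposite signs would force the leading coefficient to vanish.\<close>

lemma simple_pole:
  fixes p q p1 :: "real poly"
  assumes im: "\<And>z. Im z > 0 \<Longrightarrow> Im (poly (cpoly q) z / poly (cpoly p) z) \<le> 0"
    and p: "p = [:- a, 1:] ^ j * p1" and p1: "poly p1 a \<noteq> 0" and q: "poly q a \<noteq> 0" and j: "j > 0"
  shows "j = 1" "poly q a / poly p1 a \<ge> 0"
proof -
  let ?c = "poly q a / poly p1 a"
  have ps: "?c * Im (1 / w ^ j) \<le> 0" if "Im w > 0" for w
    using pole_sign[OF im p p1 that] .
  show j1: "j = 1"
  proof (rule ccontr)
    assume "j \<noteq> 1"
    with j have j2: "real j \<ge> 2" by simp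
    have pw: "cis (t / real j) ^ j = cis t" for t
      using j by (simp add: DeMoivre)
    have "Im (cis (pi / 2 / real j)) > 0"
      using j2 by (simp, intro sin_gt_zero) (auto simp: field_simps)
    from ps[OF this] have c: "?c \<ge> 0" unfolding pw by simp
    \<comment> \<open>This point still lies in the upper half plane because j >= 2; its j-th power
      is -i.\<close>
    have "Im (cis (3 / 2 * pi / real j)) > 0"
    proof -
      have "3 / 2 * pi / real j < pi" using j2 by (simp add: field_simps)
      then show ?thesis using j2 by (simp, intro sin_gt_zero) auto
    qed
    moreover have "cis (3 / 2 * pi) = - \<i>"
      unfolding complex_eq_iff cis.sel sin_3over2_pi cos_3over2_pi by simp
    ultimately have "?c \<le> 0" using ps[of "cis (3 / 2 * pi / real j)"] unfolding pw by simp
    with c show False using p1 q by auto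
  qed
  show "?c \<ge> 0" using ps[of \<i>] by (simp add: j1)
qed

text \<open>Common real roots are cancelled by induction. Without them every real root of
  \<open>p\<close> is a simple pole with nonnegative residue and no other roots remain, so Lagrange
  interpolation recovers \<open>q\<close>.\<close>

lemma nevanlinna_partial_fractions:
  fixes p q :: "real poly"
  assumes "degree q < degree p"
    and "\<And>z. Im z > 0 \<Longrightarrow> poly (cpoly p) z \<noteq> 0"
    and "\<And>z. Im z > 0 \<Longrightarrow> Im (poly (cpoly q) z / poly (cpoly p) z) \<le> 0"
  shows "\<exists>R w. finite R \<and> (\<forall>a\<in>R. poly p a = 0 \<and> w a \<ge> 0) \<and>
    (\<forall>x. poly p x \<noteq> 0 \<longrightarrow> poly q x = poly p x * (\<Sum>a\<in>R. w a / (x - a)))"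
  using assms
proof (induction "degree p" arbitrary: p q rule: less_induct)
  case (less p q)
  note nz = less.prems(2) and im = less.prems(3)
  have p0: "p \<noteq> 0" using less.prems(1) by auto
  consider "q = 0" | a where "q \<noteq> 0" "poly p a = 0" "poly q a = 0"
    | "q \<noteq> 0" "\<And>a. poly p a = 0 \<Longrightarrow> poly q a \<noteq> 0" by blast
  then show ?case
  proof cases
    case 1 then show ?thesis by (intro exI[of _ "{}"]) auto
  next
    case (2 a)
    then obtain p' q' where p': "p = [:- a, 1:] * p'" and q': "q = [:- a, 1:] * q'"
      by (auto simp: poly_eq_0_iff_dvd dvd_def)
    have ne: "p' \<noteq> 0" "q' \<noteq> 0" using p0 2(1) p' q' by auto
    then have deg: "degree p = Suc (degree p')" "degree q = Suc (degree q')"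
      unfolding p' q' by (subst degree_mult_eq; simp)+
    have lin: "poly (cpoly [:- a, 1:]) z = z - of_real a" for z
      using cpoly_linear_power[of a 1 z] by simp
    have "\<exists>R w. finite R \<and> (\<forall>a\<in>R. poly p' a = 0 \<and> w a \<ge> 0) \<and>
      (\<forall>x. poly p' x \<noteq> 0 \<longrightarrow> poly q' x = poly p' x * (\<Sum>a\<in>R. w a / (x - a)))"
    proof (rule less.hyps)
      show "degree p' < degree p" "degree q' < degree p'" using deg less.prems(1) by auto
    next
      fix z assume z: "Im z > 0"
      then have za: "z - of_real a \<noteq> 0" by auto
      show "poly (cpoly p') z \<noteq> 0" using nz[OF z] unfolding p' cpoly_mult by auto
      show "Im (poly (cpoly q') z / poly (cpoly p') z) \<le> 0"
        using im[OF z] za unfolding p' q' cpoly_mult poly_mult lin by simp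
    qed
    then obtain R w where "finite R" "\<forall>a\<in>R. poly p' a = 0 \<and> w a \<ge> 0"
      "\<forall>x. poly p' x \<noteq> 0 \<longrightarrow> poly q' x = poly p' x * (\<Sum>a\<in>R. w a / (x - a))" by blast
    then show ?thesis
      by (intro exI[of _ R] exI[of _ w]) (auto simp: p' q' algebra_simps)
  next
    case 3
    define R where "R = {a. poly p a = 0}"
    have fin: "finite R" unfolding R_def using p0 by (rule poly_roots_finite)
    let ?G = "\<lambda>S. \<Prod>a\<in>S. [:- a, 1:] :: real poly"
    obtain h where h: "p = ?G R * h"
      using prod_linear_dvd[OF fin, of p] by (auto simp: R_def dvd_def)
    have h0: "h \<noteq> 0" using p0 h by auto
    have simple: "poly h a \<noteq> 0" "poly q a / poly (?G (R - {a}) * h) a \<ge> 0" if a: "a \<in> R" for a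
    proof -
      from order_decomp[OF p0, of a] obtain p1 where
        p1: "p = [:- a, 1:] ^ order a p * p1" "\<not> [:- a, 1:] dvd p1" by blast
      have p1a: "poly p1 a \<noteq> 0" using p1(2) by (simp add: poly_eq_0_iff_dvd)
      have pa: "poly p a = 0" using a by (simp add: R_def)
      have qa: "poly q a \<noteq> 0" using 3(2)[OF pa] .
      have "order a p > 0" using pa p0 by (simp add: order_gt_0_iff)
      note sp = simple_pole[OF im p1(1) p1a qa this]
      have "[:- a, 1:] * p1 = [:- a, 1:] * (?G (R - {a}) * h)"
        using p1(1) h prod.remove[OF fin a, of "\<lambda>a. [:- a, 1:] :: real poly"] sp(1)
        by (simp add: mult.assoc del: mult_pCons_left)
      then have eq: "p1 = ?G (R - {a}) * h"
        by (subst (asm) mult_cancel_left) auto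
      show "poly h a \<noteq> 0" using p1a unfolding eq by auto
      show "poly q a / poly (?G (R - {a}) * h) a \<ge> 0" using sp(2) unfolding eq .
    qed
    \<comment> \<open>The cofactor is constant: roots in the upper half plane are excluded by
      hypothesis, those in the lower one by conjugation, and real ones by simplicity of the
      poles.\<close>
    have "\<not> poly (cpoly h) z = 0" for z
    proof
      assume z: "poly (cpoly h) z = 0"
      then have pz: "poly (cpoly p) z = 0" unfolding h cpoly_mult by simp
      consider "Im z > 0" | "Im (cnj z) > 0" | "Im z = 0" by fastforce
      then show False
      proof cases
        case 1 then show False using nz pz by blast
      next
        case 2
        then show False using nz[OF 2] cnj_poly_cpoly[of p z] pz by simp
      next
        case 3
        then have "z = of_real (Re z)" by (simp add: complex_eq_iff)
        then obtain x where zr: "z = of_real x" ..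
        have hx: "poly h x = 0" using z unfolding zr by simp
        then have "poly p x = 0" by (subst h) simp
        then have "x \<in> R" by (simp add: R_def)
        from simple(1)[OF this] hx show False by contradiction
      qed
    qed
    then have "degree (cpoly h) = 0"
      using fundamental_theorem_of_algebra constant_degree by blast
    then have "degree h = 0" by simp
    then obtain c where c: "h = [:c:]" by (auto elim: degree_eq_zeroE)
    with h0 have c0: "c \<noteq> 0" by auto
    define w where "w a = poly q a / poly (?G (R - {a}) * h) a" for a
    have G0: "poly (?G (R - {a})) a \<noteq> 0" if "a \<in> R" for a
      using fin by (auto simp: poly_prod prod_zero_iff)
    define r where "r = (\<Sum>a\<in>R. smult (w a * c) (?G (R - {a})))"
    have deg_G: "degree (?G S) = card S" if "finite S" for S
      using that by (subst degree_prod_eq_sum_degree) auto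
    have degp: "degree p = card R"
      unfolding h c using c0 deg_G[OF fin] by simp
    \<comment> \<open>Both polynomials have degree below \<open>card R\<close> and take the same
      values on \<open>R\<close>.\<close>
    have "q - r = 0"
    proof (rule ccontr)
      assume qr: "q - r \<noteq> 0"
      have "poly (q - r) b = 0" if b: "b \<in> R" for b
      proof -
        have "poly r b = (\<Sum>a\<in>R. if a = b then poly q b else 0)"
          unfolding r_def poly_sum
        proof (rule sum.cong[OF refl])
          fix a assume a: "a \<in> R"
          show "poly (smult (w a * c) (?G (R - {a}))) b = (if a = b then poly q b else 0)"
          proof (cases "a = b")
            case True
            then show ?thesis using G0[OF a] c0 by (simp add: w_def c)
          next
            case False
            then have "poly (?G (R - {a})) b = 0"
              using b fin by (auto simp: poly_prod prod_zero_iff)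
            with False show ?thesis by simp
          qed
        qed
        then show ?thesis using b fin by simp
      qed
      then have "R \<subseteq> {x. poly (q - r) x = 0}" by auto
      then have "card R \<le> degree (q - r)"
        using poly_roots_degree[OF qr] card_mono[OF poly_roots_finite[OF qr]] by (meson order.trans)
      moreover have "degree (q - r) < card R"
      proof (rule degree_diff_less)
        show "degree q < card R" using less.prems(1) degp by simp
        have "degree (smult (w a * c) (?G (R - {a}))) \<le> card R - 1" if "a \<in> R" for a
        proof -
          have "degree (?G (R - {a})) = card R - 1"
            using deg_G[OF finite_Diff[OF fin]] fin that by (simp only: card_Diff_singleton)
          then show ?thesis using degree_smult_le[of "w a * c" "?G (R - {a})"] by argo
        qed
        then have "degree r \<le> card R - 1" unfolding r_def by (intro degree_sum_le fin)
        then show "degree r < card R" using less.prems(1) degp by simp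
      qed
      ultimately show False by simp
    qed
    then have qr: "q = r" by simp
    show ?thesis
    proof (intro exI[of _ R] exI[of _ w] conjI allI impI ballI)
      show "finite R" by (rule fin)
      fix a assume a: "a \<in> R"
      show "poly p a = 0" using a by (simp add: R_def)
      show "w a \<ge> 0" unfolding w_def by (rule simple(2)[OF a])
    next
      fix x assume x: "poly p x \<noteq> 0"
      have "poly p x * (w a / (x - a)) = poly (smult (w a * c) (?G (R - {a}))) x" if a: "a \<in> R" for a
      proof -
        have "x - a \<noteq> 0" using x a by (auto simp: R_def)
        moreover have "poly p x = (x - a) * poly (?G (R - {a})) x * c"
          unfolding h c prod.remove[OF fin a] by (simp add: algebra_simps)
        ultimately show ?thesis by simp
      qed
      then show "poly q x = poly p x * (\<Sum>a\<in>R. w a / (x - a))"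
        unfolding qr r_def poly_sum sum_distrib_left by simp
    qed
  qed
qed

section \<open>Rank one perturbations of the averaged characteristic polynomial\<close>

lemma det_fn_nonzero_solvable:
  fixes M :: "'a::field fmat"
  assumes "det_fn n M \<noteq> 0"
  obtains y where "\<And>i. i < n \<Longrightarrow> (\<Sum>j<n. M i j * y j) = u i"
proof -
  let ?A = "fn_mat n M"
  have A: "?A \<in> carrier_mat n n" by simp
  from det_non_zero_imp_unit[OF A assms[unfolded det_fn_def], of undefined]
  obtain B where B: "B \<in> carrier_mat n n" "?A * B = 1\<^sub>m n"
    by (auto simp: Units_def ring_mat_def)
  define y where "y j = (B *\<^sub>v vec n u) $ j" for j
  have Bu: "B *\<^sub>v vec n u \<in> carrier_vec n" using B(1) by auto
  have "?A *\<^sub>v (B *\<^sub>v vec n u) = vec n u"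
    using assoc_mult_mat_vec[OF A B(1), of "vec n u"] B(2) by simp
  then have "(?A *\<^sub>v (B *\<^sub>v vec n u)) $ i = u i" if "i < n" for i using that by simp
  then have "(\<Sum>j<n. M i j * y j) = u i" if "i < n" for i
    using that Bu B(1) by (simp add: scalar_prod_def atLeast0LessThan y_def)
  then show ?thesis by (rule that)
qed

text \<open>By the determinant lemma the dependence on \<open>h\<close> is affine; reading the slope
  off at h = 1 keeps the inverse of \<open>M\<close> out of the formula, so that it can be
  averaged.\<close>

lemma det_fn_rank_one_affine:
  fixes M :: "'a::field fmat"
  assumes "det_fn n M \<noteq> 0"
  shows "det_fn n (\<lambda>i j. M i j - h * (u i * w j)) =
    det_fn n M - h * (det_fn n M - det_fn n (\<lambda>i j. M i j - u i * w j))"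
proof -
  from det_fn_nonzero_solvable[OF assms, of u] obtain y where
    y: "\<And>i. i < n \<Longrightarrow> (\<Sum>j<n. M i j * y j) = u i" by blast
  have "(\<Sum>j<n. M i j * (h * y j)) = h * u i" if "i < n" for i
    unfolding y[OF that, symmetric] sum_distrib_left by (rule sum.cong) (auto simp: mult_ac)
  from det_fn_rank_one_update[of n M "\<lambda>j. h * y j" "\<lambda>i. h * u i" w, OF this]
  have "det_fn n (\<lambda>i j. M i j - h * (u i * w j)) = det_fn n M * (1 - (\<Sum>i<n. w i * (h * y i)))"
    by (simp add: mult_ac)
  moreover have "(\<Sum>i<n. w i * (h * y i)) = h * (\<Sum>i<n. w i * y i)"
    unfolding sum_distrib_left by (simp add: mult_ac)
  moreover note det_fn_rank_one_update[of n M y u w, OF y]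
  ultimately show ?thesis by (simp only:) (simp add: algebra_simps)
qed

text \<open>In the imaginary part of the form, the real symmetric \<open>m\<close> contributes
  nothing, the scalar contributes Im z |x|^2, and the rank one term -Im h |v . x|^2, which is
  nonnegative.\<close>

lemma im_pos_resolvent:
  fixes m :: "real fmat" and v :: "nat \<Rightarrow> real"
  assumes sym: "\<And>i j. i < n \<Longrightarrow> j < n \<Longrightarrow> m i j = m j i" and z: "Im z > 0" and h: "Im h \<le> 0"
  shows "im_pos n (\<lambda>i j. diag_fn z i j - of_real (m i j) - h * (of_real (v i) * of_real (v j)))"
  unfolding im_pos_def
proof (intro allI impI)
  fix x :: "nat \<Rightarrow> complex" assume x: "\<exists>i<n. x i \<noteq> 0"
  let ?S = "\<Sum>i<n. \<Sum>j<n. cnj (x i) * of_real (m i j) * x j"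
  let ?V = "\<Sum>j<n. of_real (v j) * x j"
  have "cnj ?S = (\<Sum>i<n. \<Sum>j<n. cnj (x j) * of_real (m i j) * x i)"
    by (simp add: mult_ac)
  also have "\<dots> = (\<Sum>j<n. \<Sum>i<n. cnj (x j) * of_real (m i j) * x i)" by (rule sum.swap)
  also have "\<dots> = ?S" by (intro sum.cong refl) (auto simp: sym)
  finally have "Im (cnj ?S) = Im ?S" by (rule arg_cong)
  then have S: "Im ?S = 0" by (simp only: cnj.sel)
  have D: "(\<Sum>j<n. cnj (x i) * diag_fn z i j * x j) = z * (cnj (x i) * x i)" if "i < n" for i
  proof -
    have "(\<Sum>j<n. cnj (x i) * diag_fn z i j * x j) = (\<Sum>j<n. if j = i then z * (cnj (x i) * x i) else 0)"
      by (rule sum.cong) (auto simp: diag_fn_def)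
    then show ?thesis using that by simp
  qed
  have V: "(\<Sum>i<n. \<Sum>j<n. cnj (x i) * (h * (of_real (v i) * of_real (v j))) * x j) = h * (cnj ?V * ?V)"
    unfolding cnj_sum sum_product by (simp add: sum_distrib_left mult_ac)
  have "(\<Sum>i<n. \<Sum>j<n. cnj (x i) * (diag_fn z i j - of_real (m i j) - h * (of_real (v i) * of_real (v j))) * x j)
    = (\<Sum>i<n. \<Sum>j<n. cnj (x i) * diag_fn z i j * x j) - ?S
      - (\<Sum>i<n. \<Sum>j<n. cnj (x i) * (h * (of_real (v i) * of_real (v j))) * x j)"
    by (simp add: algebra_simps sum_subtractf)
  also have "(\<Sum>i<n. \<Sum>j<n. cnj (x i) * diag_fn z i j * x j) = z * of_real (\<Sum>i<n. (cmod (x i))\<^sup>2)"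
  proof -
    have "cnj (x i) * x i = of_real ((cmod (x i))\<^sup>2)" for i
      by (simp only: mult.commute[of "cnj _"] complex_norm_square[symmetric])
    then have "(\<Sum>i<n. \<Sum>j<n. cnj (x i) * diag_fn z i j * x j) = (\<Sum>i<n. z * of_real ((cmod (x i))\<^sup>2))"
      by (intro sum.cong refl) (simp only: D lessThan_iff)
    then show ?thesis by (simp only: of_real_sum sum_distrib_left)
  qed
  also have "(\<Sum>i<n. \<Sum>j<n. cnj (x i) * (h * (of_real (v i) * of_real (v j))) * x j) = h * of_real ((cmod ?V)\<^sup>2)"
    unfolding V by (simp only: mult.commute[of "cnj _"] complex_norm_square[symmetric])
  finally have "Im (\<Sum>i<n. \<Sum>j<n. cnj (x i) * (diag_fn z i j - of_real (m i j) - h * (of_real (v i) * of_real (v j))) * x j)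
    = Im z * (\<Sum>i<n. (cmod (x i))\<^sup>2) - Im h * (cmod ?V)\<^sup>2" (is "?L = _") using S by simp
  moreover have "Im z * (\<Sum>i<n. (cmod (x i))\<^sup>2) > 0"
  proof (rule mult_pos_pos[OF z])
    show "(\<Sum>i<n. (cmod (x i))\<^sup>2) > 0"
    proof -
      from x obtain i where "i < n" "x i \<noteq> 0" by blast
      then show ?thesis by (intro sum_pos2[of _ i]) auto
    qed
  qed
  moreover have "Im h * (cmod ?V)\<^sup>2 \<le> 0" using h by (simp add: mult_nonpos_nonneg)
  ultimately show "0 < ?L" by linarith
qed

lemma im_pos_diag_minus:
  assumes "\<And>i j. i < n \<Longrightarrow> j < n \<Longrightarrow> m i j = m j i" "Im z > 0"
  shows "im_pos n (\<lambda>i j. diag_fn z i j - complex_of_real (m i j))"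
  using im_pos_resolvent[where h = 0 and v = "\<lambda>_. 0", OF assms] by simp

lemma det_fn_nonzero_of_im_pos:
  assumes "im_pos n M"
  shows "det_fn n M \<noteq> 0"
proof -
  have "det_fn n (msk {..<n} M) = det_fn n M"
    by (rule det_fn_cong) (auto simp: msk_def)
  with det_fn_msk_nonzero[OF assms, of "{..<n}"] show ?thesis by simp
qed

text \<open>For \<open>h = 0\<close> this is \<open>2 ^ n\<close> times chi[A, -A] at u / 2
  (\<open>poly_cut_poly_mixed\<close>); the normalization makes it monic.\<close>

definition cut_poly :: "nat \<Rightarrow> real fmat \<Rightarrow> real fmat \<Rightarrow> real poly" where
  "cut_poly n a h = smult (1 / 2 ^ n) (\<Sum>E\<in>Pow {..<n}. char_poly (mat n n (\<lambda>(i, j). cut_fn a E i j + h i j)))"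

abbreviation cut_charpoly :: "nat \<Rightarrow> real fmat \<Rightarrow> real poly" where
  "cut_charpoly n a \<equiv> cut_poly n a (\<lambda>_ _. 0)"

lemma poly_cut_poly:
  "poly (cut_poly n a h) u =
    (\<Sum>E\<in>Pow {..<n}. det_fn n (\<lambda>i j. diag_fn u i j - cut_fn a E i j - h i j)) / 2 ^ n"
proof -
  have "poly (char_poly (mat n n (\<lambda>(i, j). cut_fn a E i j + h i j))) u =
    det_fn n (\<lambda>i j. diag_fn u i j - cut_fn a E i j - h i j)" for E
    unfolding poly_char_poly_fn by (rule det_fn_cong) (simp add: diag_fn_def)
  then show ?thesis by (simp add: cut_poly_def poly_sum)
qed

lemma poly_cpoly_char_poly:
  "poly (cpoly (char_poly (fn_mat n M))) z = det_fn n (\<lambda>i j. diag_fn z i j - of_real (M i j))"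
proof -
  have "cpoly (char_poly (fn_mat n M)) = char_poly (map_mat of_real (fn_mat n M))"
    by (rule of_real_hom.char_poly_hom[symmetric]) (rule mat_carrier)
  also have "map_mat of_real (fn_mat n M) = mat n n (\<lambda>(i, j). complex_of_real (M i j))"
    by (rule eq_matI) auto
  finally show ?thesis by (simp only: poly_char_poly_fn diag_fn_def)
qed

lemma cpoly_sum: "cpoly (sum f X) = (\<Sum>x\<in>X. cpoly (f x))"
  by (rule poly_eqI) (simp add: coeff_map_poly coeff_sum)

lemma cpoly_smult: "cpoly (smult c p) = smult (of_real c) (cpoly p)"
  by (rule poly_eqI) (simp add: coeff_map_poly)

lemma poly_cpoly_cut_poly:
  "poly (cpoly (cut_poly n a h)) z =
    (\<Sum>E\<in>Pow {..<n}. det_fn n (\<lambda>i j. diag_fn z i j - of_real (cut_fn a E i j) - of_real (h i j))) / 2 ^ n"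
proof -
  have "poly (cpoly (char_poly (mat n n (\<lambda>(i, j). cut_fn a E i j + h i j)))) z =
    det_fn n (\<lambda>i j. diag_fn z i j - of_real (cut_fn a E i j) - of_real (h i j))" for E
    unfolding poly_cpoly_char_poly by (rule det_fn_cong) simp
  then show ?thesis by (simp add: cut_poly_def cpoly_sum cpoly_smult poly_sum)
qed

lemma monic_cut_poly: "degree (cut_poly n a h) = n" "coeff (cut_poly n a h) n = 1"
proof -
  have cp: "degree (char_poly (mat n n (\<lambda>(i, j). cut_fn a E i j + h i j))) = n"
    "coeff (char_poly (mat n n (\<lambda>(i, j). cut_fn a E i j + h i j))) n = 1" for E
    using degree_monic_char_poly[of "mat n n (\<lambda>(i, j). cut_fn a E i j + h i j)" n] by auto
  show c: "coeff (cut_poly n a h) n = 1"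
    by (simp add: cut_poly_def coeff_sum cp(2) card_Pow)
  have "degree (cut_poly n a h) \<le> n"
    unfolding cut_poly_def
    by (rule order.trans[OF degree_smult_le], rule degree_sum_le) (auto simp: cp(1))
  moreover have "n \<le> degree (cut_poly n a h)" by (rule le_degree) (simp add: c)
  ultimately show "degree (cut_poly n a h) = n" by simp
qed

lemma cut_fn_sym: "a i j = a j i \<Longrightarrow> cut_fn a E i j = cut_fn a E j i"
  by (simp add: cut_fn_def mult.commute[of "sg E i"])

text \<open>\<open>q\<close> is minus the derivative of the averaged polynomial under \<open>A \<mapsto> A + h v v\<^sup>T\<close> in the
  block \<open>A[S]\<close>; each determinant is affine in \<open>h\<close>.\<close>

lemma cut_poly_stable:
  fixes a :: "real fmat" and v :: "nat \<Rightarrow> real"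
  assumes sym: "\<And>i j. i < n \<Longrightarrow> j < n \<Longrightarrow> a i j = a j i" and z: "Im z > 0" and h: "Im h \<le> 0"
  defines "q \<equiv> cut_charpoly n a - cut_poly n a (\<lambda>i j. v i * v j)"
  shows "poly (cpoly (cut_charpoly n a)) z - h * poly (cpoly q) z \<noteq> 0"
proof -
  let ?M = "\<lambda>E i j. diag_fn z i j - of_real (cut_fn a E i j) :: complex"
  let ?V = "\<lambda>i j. of_real (v i) * of_real (v j) :: complex"
  let ?a = "\<lambda>i j. complex_of_real (a i j)"
  have ne: "det_fn n (?M E) \<noteq> 0" for E
    by (rule det_fn_nonzero_of_im_pos, rule im_pos_diag_minus) (auto simp: z intro: cut_fn_sym sym)
  have q: "poly (cpoly q) z = (\<Sum>E\<in>Pow {..<n}. det_fn n (?M E) - det_fn n (\<lambda>i j. ?M E i j - ?V i j)) / 2 ^ n"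
  proof -
    have "cpoly q = cpoly (cut_charpoly n a) - cpoly (cut_poly n a (\<lambda>i j. v i * v j))"
      unfolding q_def by (rule poly_eqI) (simp add: coeff_map_poly)
    then show ?thesis
      by (simp add: poly_cpoly_cut_poly sum_subtractf diff_divide_distrib)
  qed
  have "poly (cpoly (cut_charpoly n a)) z - h * poly (cpoly q) z =
    (\<Sum>E\<in>Pow {..<n}. det_fn n (?M E) - h * (det_fn n (?M E) - det_fn n (\<lambda>i j. ?M E i j - ?V i j))) / 2 ^ n"
    unfolding q by (simp add: poly_cpoly_cut_poly sum_subtractf diff_divide_distrib right_diff_distrib flip: sum_distrib_left)
  also have "\<dots> = (\<Sum>E\<in>Pow {..<n}. det_fn n (\<lambda>i j. ?M E i j - h * ?V i j)) / 2 ^ n"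
    by (simp only: det_fn_rank_one_affine[OF ne])
  also have "(\<Sum>E\<in>Pow {..<n}. det_fn n (\<lambda>i j. ?M E i j - h * ?V i j)) =
    (\<Sum>E\<in>Pow {..<n}. det_fn n (\<lambda>i j. diag_fn z i j - cut_fn ?a E i j - h * ?V i j))"
    by (intro sum.cong refl det_fn_cong) (simp add: cut_fn_def sg_def)
  also have "\<dots> = 2 ^ n * (\<Sum>S\<in>Pow {..<n}. det_fn n (blk S (\<lambda>i j. diag_fn (z / 2) i j - ?a i j - h * ?V i j)
      (\<lambda>i j. diag_fn (z / 2) i j + ?a i j)))"
    by (rule sum_det_cut_fn)
  finally have eq: "poly (cpoly (cut_charpoly n a)) z - h * poly (cpoly q) z =
    (\<Sum>S\<in>Pow {..<n}. det_fn n (blk S (\<lambda>i j. diag_fn (z / 2) i j - ?a i j - h * ?V i j)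
      (\<lambda>i j. diag_fn (z / 2) i j + ?a i j)))" by simp
  have z2: "Im (z / 2) > 0" using z by simp
  have "im_pos n (\<lambda>i j. diag_fn (z / 2) i j - ?a i j - h * ?V i j)"
    by (rule im_pos_resolvent[OF sym z2 h])
  moreover have "im_pos n (\<lambda>i j. diag_fn (z / 2) i j + ?a i j)"
    using im_pos_diag_minus[of n "\<lambda>i j. - a i j", OF _ z2] sym by simp
  ultimately show ?thesis unfolding eq by (rule sum_blk_nonzero)
qed

text \<open>If q / p had positive imaginary part at some z in the upper half plane, then h = p / q
  would lie in the lower half plane and annihilate p - h q, against \<open>cut_poly_stable\<close>.
  The degree of \<open>q\<close> drops because it is a difference of monic polynomials.\<close>

lemma cut_poly_measure:
  fixes a :: "real fmat" and v :: "nat \<Rightarrow> real"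
  assumes sym: "\<And>i j. i < n \<Longrightarrow> j < n \<Longrightarrow> a i j = a j i" and n: "n > 0"
  defines "p \<equiv> cut_charpoly n a"
  defines "q \<equiv> p - cut_poly n a (\<lambda>i j. v i * v j)"
  shows "\<exists>R w. finite R \<and> (\<forall>b\<in>R. poly p b = 0 \<and> w b \<ge> 0) \<and>
    (\<forall>x. poly p x \<noteq> 0 \<longrightarrow> poly q x = poly p x * (\<Sum>b\<in>R. w b / (x - b)))"
proof (rule nevanlinna_partial_fractions)
  have "degree q \<le> n" unfolding q_def p_def by (rule degree_diff_le) (simp_all add: monic_cut_poly)
  moreover have "coeff q n = 0" unfolding q_def p_def by (simp add: monic_cut_poly)
  ultimately have "degree q < n" using n
    by (metis eq_zero_or_degree_less degree_0)
  then show "degree q < degree p" by (simp add: p_def monic_cut_poly)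
next
  fix z assume z: "Im z > 0"
  have st: "poly (cpoly p) z - h * poly (cpoly q) z \<noteq> 0" if "Im h \<le> 0" for h
    using cut_poly_stable[where v = v and n = n and a = a, OF sym z that] unfolding q_def p_def by simp
  show pz: "poly (cpoly p) z \<noteq> 0" using st[of 0] by simp
  let ?r = "poly (cpoly q) z / poly (cpoly p) z"
  show "Im ?r \<le> 0"
  proof (rule ccontr)
    assume "\<not> ?thesis"
    then have r: "Im ?r > 0" by simp
    then have q0: "poly (cpoly q) z \<noteq> 0" by auto
    have "Im (1 / r) = - Im r / ((Re r)\<^sup>2 + (Im r)\<^sup>2)" for r :: complex by (simp add: Im_divide)
    then have "Im (1 / ?r) = - Im ?r / ((Re ?r)\<^sup>2 + (Im ?r)\<^sup>2)" .
    also have "\<dots> \<le> 0" using r by (simp only: divide_nonpos_nonneg sum_power2_ge_zero neg_le_0_iff_le less_imp_le)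
    finally have "poly (cpoly p) z - 1 / ?r * poly (cpoly q) z \<noteq> 0" by (rule st)
    with q0 pz show False by simp
  qed
qed

section \<open>Moments\<close>

text \<open>The limit at 0 kills the constant coefficient, and dividing by t lowers the order. This
  converts asymptotic expansions with bounded remainders into exact coefficient equations.\<close>

lemma coeff_0_of_poly_bigo:
  fixes Q :: "real poly"
  assumes "\<forall>\<^sub>F t in at_right 0. \<bar>poly Q t\<bar> \<le> C * t ^ m" "k < m"
  shows "coeff Q k = 0"
  using assms
proof (induction m arbitrary: Q k)
  case (Suc m)
  obtain c Q' where Q: "Q = pCons c Q'" by (cases Q)
  have "((\<lambda>t. \<bar>poly Q t\<bar>) \<longlongrightarrow> \<bar>poly Q 0\<bar>) (at_right 0)"
    by (intro tendsto_intros)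
  moreover have "((\<lambda>t. C * t ^ Suc m) \<longlongrightarrow> C * 0 ^ Suc m) (at_right 0)"
    by (intro tendsto_intros)
  ultimately have "\<bar>poly Q 0\<bar> \<le> C * 0 ^ Suc m"
    using Suc.prems(1) by (intro tendsto_le[of "at_right (0::real)"]) auto
  then have c: "c = 0" by (simp add: Q)
  have "\<forall>\<^sub>F t in at_right 0. \<bar>poly Q' t\<bar> \<le> C * t ^ m"
    using Suc.prems(1) eventually_at_right_less
  proof eventually_elim
    case (elim t)
    then have "t * \<bar>poly Q' t\<bar> \<le> t * (C * t ^ m)"
      by (simp add: Q c abs_mult mult_ac)
    with elim show ?case by simp
  qed
  then have IH: "coeff Q' j = 0" if "j < m" for j using Suc.IH that by blast
  show ?case using Suc.prems(2) c IH by (cases k) (auto simp: Q)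
qed simp

text \<open>The reversed characteristic polynomial det(1 - t X), built over the polynomial ring so
  that its coefficients are accessible.\<close>

definition rev_det :: "nat \<Rightarrow> real fmat \<Rightarrow> real poly" where
  "rev_det n X = det_fn n (\<lambda>i j. [:if i = j then 1 else 0, - X i j:])"

lemma poly_signof_mult: "poly (signof p * q) t = signof p * poly q t"
  by (cases p rule: sign_cases) simp_all

lemma poly_rev_det: "poly (rev_det n X) t = det_fn n (\<lambda>i j. diag_fn 1 i j - t * X i j)"
  unfolding rev_det_def det_fn_leibniz poly_sum poly_signof_mult poly_prod
  by (intro sum.cong refl arg_cong2[of _ _ _ _ "(*)"] prod.cong) (auto simp: diag_fn_def)

lemma prod_one_minus_mod:
  fixes x :: "'i \<Rightarrow> real"
  assumes "finite A"
  shows "[:0, 0, 1:] dvd (\<Prod>i\<in>A. [:1, - x i:]) - [:1, - (\<Sum>i\<in>A. x i):]"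
  using assms
proof (induction A rule: finite_induct)
  case (insert a A)
  let ?P = "\<Prod>i\<in>A. [:1, - x i:]" and ?L = "[:1, - (\<Sum>i\<in>A. x i):]"
  have "[:1, - x a:] * ?P - [:1, - (x a + (\<Sum>i\<in>A. x i)):] =
    [:1, - x a:] * (?P - ?L) + ([:1, - x a:] * ?L - [:1, - (x a + (\<Sum>i\<in>A. x i)):])"
    by (simp only: algebra_simps)
  also have "[:1, - x a:] * ?L - [:1, - (x a + (\<Sum>i\<in>A. x i)):] = [:0, 0, 1:] * [:x a * (\<Sum>i\<in>A. x i):]"
    by simp
  finally have "[:1, - x a:] * ?P - [:1, - (x a + (\<Sum>i\<in>A. x i)):] =
    [:1, - x a:] * (?P - ?L) + [:0, 0, 1:] * [:x a * (\<Sum>i\<in>A. x i):]" .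
  moreover have "[:0, 0, 1:] dvd [:1, - x a:] * (?P - ?L) + [:0, 0, 1:] * [:x a * (\<Sum>i\<in>A. x i):]"
    by (intro dvd_add dvd_mult insert.IH dvd_triv_left)
  ultimately show ?case by (simp only: prod.insert[OF insert.hyps] sum.insert[OF insert.hyps])
qed (simp add: one_pCons)

text \<open>A nonidentity permutation moves at least two points, so its term is divisible by t^2;
  the identity contributes the product of the diagonal entries.\<close>

lemma rev_det_mod: "[:0, 0, 1:] dvd rev_det n X - [:1, - (\<Sum>i<n. X i i):]"
proof -
  let ?f = "\<lambda>i j. [:if i = j then 1 else 0, - X i j:]"
  have nonid: "[:0, 0, 1:] dvd signof p * (\<Prod>i<n. ?f i (p i))" if p: "p permutes {..<n}" and "p \<noteq> id" for p
  proof -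
    from that(2) obtain i where i: "p i \<noteq> i" by (metis eq_id_iff)
    with p have "i \<in> {..<n}" by (meson permutes_not_in)
    have pi: "p i \<in> {..<n} - {i}" using permutes_in_image[OF p] \<open>i \<in> {..<n}\<close> i by simp
    have ppi: "p (p i) \<noteq> p i" using permutes_inj[OF p] i by (auto dest: injD)
    have lin: "[:0, 1:] dvd ?f k (p k)" if "p k \<noteq> k" for k
    proof
      show "?f k (p k) = [:0, 1:] * [:- X k (p k):]" using that by simp
    qed
    have "(\<Prod>i<n. ?f i (p i)) = (?f i (p i) * ?f (p i) (p (p i))) * (\<Prod>k\<in>{..<n} - {i} - {p i}. ?f k (p k))"
      by (subst prod.remove[OF _ \<open>i \<in> {..<n}\<close>], simp, subst prod.remove[OF _ pi], simp, simp only: mult.assoc)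
    moreover have "[:0, 0, 1:] = [:0, 1:] * [:0, 1::real:]" by simp
    ultimately show ?thesis using mult_dvd_mono[OF lin[OF i] lin[OF ppi]]
      by (simp del: mult_pCons_left mult_pCons_right)
  qed
  have "rev_det n X = signof id * (\<Prod>i<n. ?f i (id i)) + (\<Sum>p\<in>{p. p permutes {..<n}} - {id}. signof p * (\<Prod>i<n. ?f i (p i)))"
    unfolding rev_det_def det_fn_leibniz
    by (rule sum.remove) (auto simp: finite_permutations permutes_id)
  then have "rev_det n X - [:1, - (\<Sum>i<n. X i i):] = ((\<Prod>i<n. [:1, - X i i:]) - [:1, - (\<Sum>i<n. X i i):]) +
    (\<Sum>p\<in>{p. p permutes {..<n}} - {id}. signof p * (\<Prod>i<n. ?f i (p i)))" by simp
  moreover have "[:0, 0, 1:] dvd \<dots>"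
    by (intro dvd_add prod_one_minus_mod dvd_sum) (use nonid in auto)
  ultimately show ?thesis by (simp only:)
qed

lemma rev_det_low:
  obtains r where "\<And>t. poly (rev_det n X) t = 1 - t * (\<Sum>i<n. X i i) + t\<^sup>2 * poly r t"
proof -
  from rev_det_mod obtain r where "rev_det n X - [:1, - (\<Sum>i<n. X i i):] = [:0, 0, 1:] * r"
    unfolding dvd_def by blast
  then have "rev_det n X = [:1, - (\<Sum>i<n. X i i):] + [:0, 0, 1:] * r" by (simp add: algebra_simps)
  then have "poly (rev_det n X) t = 1 - t * (\<Sum>i<n. X i i) + t\<^sup>2 * poly r t" for t
    by (simp add: power2_eq_square algebra_simps)
  then show ?thesis by (rule that)
qed

lemma det_fn_sg_conj:
  fixes M :: "'a::comm_ring_1 fmat"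
  shows "det_fn n (\<lambda>i j. sg E i * sg E j * M i j) = det_fn n M"
  unfolding det_fn_leibniz
proof (intro sum.cong refl arg_cong2[of _ _ _ _ "(*)"])
  fix p assume "p \<in> {p. p permutes {..<n}}"
  then have p: "p permutes {..<n}" by simp
  have "(\<Prod>i<n. sg E (p i)) = (\<Prod>i<n. sg E i :: 'a)" using prod.permute[OF p, of "sg E :: nat \<Rightarrow> 'a"] by (simp add: o_def)
  then have "(\<Prod>i<n. sg E i * sg E (p i)) = (\<Prod>i<n. sg E i * sg E i :: 'a)" by (simp only: prod.distrib)
  then show "(\<Prod>i<n. sg E i * sg E (p i) * M i (p i)) = (\<Prod>i<n. M i (p i))" by (simp add: prod.distrib)
qed

text \<open>Conjugation by D negates A - D A D, so the spectrum of a cut matrix is symmetric about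
  0.\<close>

lemma rev_det_cut_even: "poly (rev_det n (cut_fn a E)) (- t) = poly (rev_det n (cut_fn a E)) t"
proof -
  have "poly (rev_det n (cut_fn a E)) (- t) = det_fn n (\<lambda>i j. sg E i * sg E j * (diag_fn 1 i j - t * cut_fn a E i j))"
    unfolding poly_rev_det
    by (rule det_fn_cong) (auto simp: sg_def cut_fn_def diag_fn_def)
  then show ?thesis by (simp only: det_fn_sg_conj poly_rev_det)
qed

text \<open>(1 - t K)(1 + t K) = 1 - t^2 K^2. With evenness, this reduces the t^2 coefficient to a
  trace.\<close>

lemma rev_det_mult_neg:
  "poly (rev_det n K) t * poly (rev_det n K) (- t) = poly (rev_det n (\<lambda>i j. \<Sum>k<n. K i k * K k j)) (t\<^sup>2)"
  unfolding poly_rev_det det_fn_mult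
proof (rule det_fn_cong)
  fix i j assume ij: "i < n" "j < n"
  have "(diag_fn 1 i k - t * K i k) * (diag_fn 1 k j - - t * K k j) =
    (if k = i then diag_fn 1 i j + t * K i j else 0) - (if k = j then t * K i j else 0) - t\<^sup>2 * (K i k * K k j)" for k
    by (auto simp: diag_fn_def algebra_simps power2_eq_square)
  then show "(\<Sum>k<n. (diag_fn 1 i k - t * K i k) * (diag_fn 1 k j - - t * K k j)) =
    diag_fn 1 i j - t\<^sup>2 * (\<Sum>k<n. K i k * K k j)"
    using ij by (simp add: sum.distrib sum_subtractf sum_distrib_left)
qed

text \<open>The second elementary symmetric function of the eigenvalues of the cut matrix; its
  diagonal is 0, so only -tr(K^2)/2 is left.\<close>

definition cut_delta :: "nat \<Rightarrow> real fmat \<Rightarrow> nat set \<Rightarrow> real" where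
  "cut_delta n a E = - (\<Sum>i<n. \<Sum>j<n. cut_fn a E i j * cut_fn a E j i) / 2"

lemma rev_det_cut_expand:
  obtains q where "rev_det n (cut_fn a E) = pCons 1 (pCons 0 (pCons (cut_delta n a E) (pCons 0 q)))"
proof -
  let ?P = "rev_det n (cut_fn a E)"
  obtain c0 c1 c2 c3 q where P: "?P = pCons c0 (pCons c1 (pCons c2 (pCons c3 q)))"
    by (metis pCons_cases)
  have "pcompose ?P [:0, -1:] = ?P"
    by (rule poly_ext) (simp add: poly_pcompose rev_det_cut_even)
  then have cf: "(-1) ^ k * coeff ?P k = coeff ?P k" for k
    by (metis coeff_pcompose_linear)
  from cf[of 1] have c1: "c1 = 0" by (simp add: P)
  from cf[of 3] have c3: "c3 = 0" by (simp add: P numeral_3_eq_3)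
  have c0: "c0 = 1"
  proof -
    obtain r where "\<And>t. poly ?P t = 1 - t * (\<Sum>i<n. cut_fn a E i i) + t\<^sup>2 * poly r t"
      using rev_det_low by blast
    from this[of 0] show ?thesis by (simp add: P)
  qed
  let ?T = "\<Sum>i<n. \<Sum>k<n. cut_fn a E i k * cut_fn a E k i"
  obtain r where r: "\<And>t. poly (rev_det n (\<lambda>i j. \<Sum>k<n. cut_fn a E i k * cut_fn a E k j)) t =
      1 - t * ?T + t\<^sup>2 * poly r t"
    using rev_det_low[where X = "\<lambda>i j. \<Sum>k<n. cut_fn a E i k * cut_fn a E k j"] by blast
  let ?g = "\<lambda>t. 2 * poly q t + t ^ 4 * (poly q t)\<^sup>2 + 2 * c2 * t\<^sup>2 * poly q t + c2\<^sup>2 - poly r (t\<^sup>2)"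
  \<comment> \<open>From P(t)^2 = P(t) P(-t) = 1 - t^2 tr(K^2) + O(t^4). The left side does not
    depend on t, so letting t tend to 0 shows that it vanishes.\<close>
  have eq: "2 * c2 + ?T = - (t\<^sup>2 * ?g t)" if "t \<noteq> 0" for t
  proof -
    have key: "s * (2 * c2 + T) = s * (- (s * (2 * q + s\<^sup>2 * q\<^sup>2 + 2 * c2 * s * q + c2\<^sup>2 - r)))"
      if "P\<^sup>2 = 1 - s * T + s\<^sup>2 * r" "P = 1 + c2 * s + s\<^sup>2 * q" for P T q r s
      using that(1) unfolding that(2) by (simp add: power2_eq_square algebra_simps)
    have "(poly ?P t)\<^sup>2 = 1 - t\<^sup>2 * ?T + (t\<^sup>2)\<^sup>2 * poly r (t\<^sup>2)"
      using rev_det_mult_neg[of n "cut_fn a E" t] unfolding rev_det_cut_even r by (simp add: power2_eq_square)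
    moreover have "poly ?P t = 1 + c2 * t\<^sup>2 + (t\<^sup>2)\<^sup>2 * poly q t"
      by (simp add: P c0 c1 c3 power2_eq_square algebra_simps)
    ultimately have "t\<^sup>2 * (2 * c2 + ?T) =
      t\<^sup>2 * (- (t\<^sup>2 * (2 * poly q t + (t\<^sup>2)\<^sup>2 * (poly q t)\<^sup>2 + 2 * c2 * t\<^sup>2 * poly q t + c2\<^sup>2 - poly r (t\<^sup>2))))"
      by (rule key)
    then have "t\<^sup>2 * (2 * c2 + ?T) = t\<^sup>2 * (- (t\<^sup>2 * ?g t))" by simp
    then show ?thesis by (subst (asm) mult_left_cancel) (use that in auto)
  qed
  have "((\<lambda>t. - (t\<^sup>2 * ?g t)) \<longlongrightarrow> - (0\<^sup>2 * ?g 0)) (at 0)"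
    by (intro tendsto_intros)
  moreover have "((\<lambda>t. - (t\<^sup>2 * ?g t)) \<longlongrightarrow> 2 * c2 + ?T) (at 0)"
    by (rule tendsto_eventually) (auto simp: eventually_at_filter eq)
  ultimately have "2 * c2 + ?T = - (0\<^sup>2 * ?g 0)" by (intro tendsto_unique[OF _ _ \<open>(_ \<longlongrightarrow> - (0\<^sup>2 * _)) _\<close>]) auto
  then have "c2 = cut_delta n a E" by (simp add: cut_delta_def)
  then show ?thesis using P c0 c1 c3 that by simp
qed

section \<open>Neumann series of the resolvent near infinity\<close>

lemma resolvent_row:
  fixes K :: "real fmat"
  assumes i: "i < n" and y: "(\<Sum>j<n. (diag_fn 1 i j - t * K i j) * y j) = u"
  shows "y i = u + t * (\<Sum>j<n. K i j * y j)"
proof -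
  have "(\<Sum>j<n. (diag_fn 1 i j - t * K i j) * y j) = (\<Sum>j<n. (if j = i then y j else 0) - t * (K i j * y j))"
    by (rule sum.cong) (auto simp: diag_fn_def left_diff_distrib)
  also have "\<dots> = y i - t * (\<Sum>j<n. K i j * y j)"
    using i by (simp add: sum_subtractf sum_distrib_left)
  finally show ?thesis using y by simp
qed

text \<open>From y = u + t K y, the l1 norm of y is at most that of u plus half of itself. The bound
  is uniform in t, as the remainder terms below require.\<close>

lemma resolvent_bounded:
  fixes K :: "real fmat"
  assumes y: "\<And>i. i < n \<Longrightarrow> (\<Sum>j<n. (diag_fn 1 i j - t * K i j) * y j) = u i"
    and t: "0 \<le> t" "t * (\<Sum>i<n. \<Sum>j<n. \<bar>K i j\<bar>) \<le> 1 / 2"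
  shows "(\<Sum>i<n. \<bar>y i\<bar>) \<le> 2 * (\<Sum>i<n. \<bar>u i\<bar>)"
proof -
  let ?s = "\<Sum>i<n. \<bar>y i\<bar>"
  have yi: "y i = u i + t * (\<Sum>j<n. K i j * y j)" if "i < n" for i
    using resolvent_row[where y = y and K = K, OF that y[OF that]] .
  have "\<bar>y i\<bar> \<le> \<bar>u i\<bar> + t * (\<Sum>j<n. \<bar>K i j\<bar> * ?s)" if "i < n" for i
  proof -
    have "\<bar>\<Sum>j<n. K i j * y j\<bar> \<le> (\<Sum>j<n. \<bar>K i j\<bar> * ?s)"
    proof (rule order.trans[OF sum_abs], rule sum_mono)
      fix j assume "j \<in> {..<n}"
      then have "\<bar>y j\<bar> \<le> ?s" by (intro member_le_sum) auto
      then show "\<bar>K i j * y j\<bar> \<le> \<bar>K i j\<bar> * ?s" by (simp add: abs_mult mult_left_mono)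
    qed
    from mult_left_mono[OF this t(1)] show ?thesis
      using yi[OF that] t(1) abs_triangle_ineq[of "u i" "t * (\<Sum>j<n. K i j * y j)"]
      by (simp add: abs_mult)
  qed
  then have "?s \<le> (\<Sum>i<n. \<bar>u i\<bar> + t * (\<Sum>j<n. \<bar>K i j\<bar> * ?s))" by (intro sum_mono) auto
  also have "\<dots> = (\<Sum>i<n. \<bar>u i\<bar>) + t * (\<Sum>i<n. \<Sum>j<n. \<bar>K i j\<bar>) * ?s"
    by (simp add: sum.distrib sum_distrib_left sum_distrib_right mult_ac)
  also have "\<dots> \<le> (\<Sum>i<n. \<bar>u i\<bar>) + 1 / 2 * ?s"
    by (intro add_left_mono mult_right_mono t sum_nonneg) auto
  finally show ?thesis by simp
qed

primrec mat_pow_vec :: "nat \<Rightarrow> real fmat \<Rightarrow> (nat \<Rightarrow> real) \<Rightarrow> real fmat" where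
  "mat_pow_vec n K v 0 = v"
| "mat_pow_vec n K v (Suc k) = (\<lambda>i. \<Sum>j<n. K i j * mat_pow_vec n K v k j)"

text \<open>Substitute y = v + t K y repeatedly, moving each K by symmetry onto the known vector;
  the unknown \<open>y\<close> survives only in the remainder.\<close>

lemma neumann_expansion:
  fixes K :: "real fmat"
  assumes sym: "\<And>i j. i < n \<Longrightarrow> j < n \<Longrightarrow> K i j = K j i"
    and y: "\<And>i. i < n \<Longrightarrow> (\<Sum>j<n. (diag_fn 1 i j - t * K i j) * y j) = v i"
  shows "(\<Sum>i<n. v i * y i) = (\<Sum>k<m. t ^ k * (\<Sum>i<n. v i * mat_pow_vec n K v k i))
    + t ^ m * (\<Sum>i<n. mat_pow_vec n K v m i * y i)"
proof (induction m)
  case (Suc m)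
  let ?z = "mat_pow_vec n K v m"
  have yi: "y i = v i + t * (\<Sum>j<n. K i j * y j)" if "i < n" for i
    using resolvent_row[where y = y and K = K, OF that y[OF that]] .
  have "(\<Sum>i<n. ?z i * y i) = (\<Sum>i<n. ?z i * v i + t * (\<Sum>j<n. ?z i * (K i j * y j)))"
  proof (rule sum.cong[OF refl])
    fix i assume "i \<in> {..<n}"
    then have "?z i * y i = ?z i * (v i + t * (\<Sum>j<n. K i j * y j))"
      by (intro arg_cong[OF yi]) simp
    also have "\<dots> = ?z i * v i + t * (\<Sum>j<n. ?z i * (K i j * y j))"
      by (simp add: algebra_simps sum_distrib_left)
    finally show "?z i * y i = ?z i * v i + t * (\<Sum>j<n. ?z i * (K i j * y j))" .
  qed
  also have "\<dots> = (\<Sum>i<n. v i * ?z i) + t * (\<Sum>i<n. \<Sum>j<n. ?z i * (K i j * y j))"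
    by (simp add: sum.distrib sum_distrib_left mult.commute)
  also have "(\<Sum>i<n. \<Sum>j<n. ?z i * (K i j * y j)) = (\<Sum>j<n. \<Sum>i<n. ?z i * (K i j * y j))"
    by (rule sum.swap)
  also have "\<dots> = (\<Sum>j<n. mat_pow_vec n K v (Suc m) j * y j)"
    by (rule sum.cong) (auto simp: sum_distrib_left sum_distrib_right sym mult_ac intro!: sum.cong)
  finally show ?case using Suc by (simp add: algebra_simps)
qed simp

lemma det_fn_scale: "det_fn n (\<lambda>i j. t * M i j) = t ^ n * det_fn n M"
  unfolding det_fn_leibniz sum_distrib_left by (simp add: prod.distrib mult_ac)

lemma resolvent_exists:
  fixes K :: "real fmat"
  assumes t: "0 \<le> t" "t * (\<Sum>i<n. \<Sum>j<n. \<bar>K i j\<bar>) \<le> 1 / 2"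
  obtains y where "\<And>i. i < n \<Longrightarrow> (\<Sum>j<n. (diag_fn 1 i j - t * K i j) * y j) = v i"
proof -
  have "det_fn n (\<lambda>i j. diag_fn 1 i j - t * K i j) \<noteq> 0"
  proof
    assume "det_fn n (\<lambda>i j. diag_fn 1 i j - t * K i j) = 0"
    then obtain x where x: "\<exists>i<n. x i \<noteq> 0" "\<And>i. i < n \<Longrightarrow> (\<Sum>j<n. (diag_fn 1 i j - t * K i j) * x j) = 0"
      by (rule det_fn_eq_0D) blast
    from resolvent_bounded[of n t K x "\<lambda>_. 0", OF x(2) t] have "(\<Sum>i<n. \<bar>x i\<bar>) \<le> 0" by simp
    then have "(\<Sum>i<n. \<bar>x i\<bar>) = 0" by (intro antisym sum_nonneg) auto
    then have "\<forall>i<n. x i = 0" by (simp add: sum_nonneg_eq_0_iff)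
    with x(1) show False by blast
  qed
  then show ?thesis by (rule det_fn_nonzero_solvable) (rule that)
qed

text \<open>The contribution of one cut matrix to \<open>q\<close>. Wherever u - K is invertible, it
  is det(u - K) times the Stieltjes transform v^T (u - K)^(-1) v.\<close>

definition rank_one_gap :: "nat \<Rightarrow> real fmat \<Rightarrow> (nat \<Rightarrow> real) \<Rightarrow> real \<Rightarrow> real" where
  "rank_one_gap n K v u =
    det_fn n (\<lambda>i j. diag_fn u i j - K i j) - det_fn n (\<lambda>i j. diag_fn u i j - K i j - v i * v j)"

text \<open>The resolvent expansion at u = 1/t. The remainder is not claimed to be polynomial in t,
  hence the pointwise \<open>e\<close> with a bound \<open>C\<close> common to all small t.\<close>

lemma reversed_resolvent_expansion:
  fixes K :: "real fmat"
  assumes sym: "\<And>i j. i < n \<Longrightarrow> j < n \<Longrightarrow> K i j = K j i"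
  shows "\<exists>C. \<forall>\<^sub>F t in at_right 0. \<exists>e. \<bar>e\<bar> \<le> C \<and>
    t ^ n * rank_one_gap n K v (1 / t)
      = t * poly (rev_det n K) t * ((\<Sum>k<m. t ^ k * (\<Sum>i<n. v i * mat_pow_vec n K v k i)) + t ^ m * e)"
proof -
  let ?c = "\<Sum>i<n. \<Sum>j<n. \<bar>K i j\<bar>" and ?z = "mat_pow_vec n K v m"
  let ?C = "(\<Sum>i<n. \<bar>?z i\<bar>) * (2 * (\<Sum>i<n. \<bar>v i\<bar>))"
  have "((\<lambda>t. t * ?c) \<longlongrightarrow> 0 * ?c) (at_right 0)" by (intro tendsto_intros)
  then have small: "\<forall>\<^sub>F t in at_right 0. t * ?c < 1 / 2" by (rule order_tendstoD(2)) simp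
  have "\<forall>\<^sub>F t in at_right 0. \<exists>e. \<bar>e\<bar> \<le> ?C \<and>
    t ^ n * rank_one_gap n K v (1 / t)
      = t * poly (rev_det n K) t * ((\<Sum>k<m. t ^ k * (\<Sum>i<n. v i * mat_pow_vec n K v k i)) + t ^ m * e)"
    using small eventually_at_right_less
  proof eventually_elim
    case (elim t)
    then have t: "0 \<le> t" "t * ?c \<le> 1 / 2" "t > 0" by auto
    obtain y where y: "\<And>i. i < n \<Longrightarrow> (\<Sum>j<n. (diag_fn 1 i j - t * K i j) * y j) = v i"
      using resolvent_exists[OF t(1,2)] by blast
    let ?e = "\<Sum>i<n. ?z i * y i"
    have "\<bar>?e\<bar> \<le> (\<Sum>i<n. \<bar>?z i\<bar> * (\<Sum>j<n. \<bar>y j\<bar>))"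
    proof (rule order.trans[OF sum_abs], rule sum_mono)
      fix j assume "j \<in> {..<n}"
      then have "\<bar>y j\<bar> \<le> (\<Sum>j<n. \<bar>y j\<bar>)" by (intro member_le_sum) auto
      then show "\<bar>?z j * y j\<bar> \<le> \<bar>?z j\<bar> * (\<Sum>j<n. \<bar>y j\<bar>)" by (simp add: abs_mult mult_left_mono)
    qed
    also have "\<dots> = (\<Sum>i<n. \<bar>?z i\<bar>) * (\<Sum>j<n. \<bar>y j\<bar>)" by (simp add: sum_distrib_right)
    also have "\<dots> \<le> ?C"
      by (intro mult_left_mono resolvent_bounded[OF y t(1,2)] sum_nonneg) auto
    finally have e: "\<bar>?e\<bar> \<le> ?C" .
    have "t ^ n * det_fn n (\<lambda>i j. diag_fn (1 / t) i j - K i j) = poly (rev_det n K) t"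
      unfolding det_fn_scale[symmetric] poly_rev_det
      by (rule det_fn_cong) (use t(3) in \<open>auto simp: diag_fn_def algebra_simps\<close>)
    moreover have "t ^ n * det_fn n (\<lambda>i j. diag_fn (1 / t) i j - K i j - v i * v j) =
      det_fn n (\<lambda>i j. diag_fn 1 i j - t * K i j - v i * (t * v j))"
      unfolding det_fn_scale[symmetric]
      by (rule det_fn_cong) (use t(3) in \<open>auto simp: diag_fn_def algebra_simps\<close>)
    moreover have "det_fn n (\<lambda>i j. diag_fn 1 i j - t * K i j - v i * (t * v j)) =
      poly (rev_det n K) t * (1 - (\<Sum>i<n. (t * v i) * y i))"
      unfolding poly_rev_det by (rule det_fn_rank_one_update) (rule y)
    moreover have "(\<Sum>i<n. (t * v i) * y i) = t * (\<Sum>i<n. v i * y i)"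
      by (simp add: sum_distrib_left mult_ac)
    moreover have "(\<Sum>i<n. v i * y i) = (\<Sum>k<m. t ^ k * (\<Sum>i<n. v i * mat_pow_vec n K v k i)) + t ^ m * ?e"
      by (rule neumann_expansion[OF sym y])
    ultimately have "t ^ n * rank_one_gap n K v (1 / t)
      = t * poly (rev_det n K) t * ((\<Sum>k<m. t ^ k * (\<Sum>i<n. v i * mat_pow_vec n K v k i)) + t ^ m * ?e)"
      by (simp add: rank_one_gap_def algebra_simps)
    with e show ?case by blast
  qed
  then show ?thesis by blast
qed

lemma geometric_split:
  fixes t b :: real
  assumes "t * b \<noteq> 1"
  shows "1 / (1 - t * b) = (\<Sum>k<m. t ^ k * b ^ k) + t ^ m * (b ^ m / (1 - t * b))"
proof -
  have "(1 - t * b) * (\<Sum>k<m. (t * b) ^ k) = 1 - (t * b) ^ m"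
    using one_diff_power_eq[of "t * b" m] by simp
  with assms show ?thesis by (simp add: field_simps power_mult_distrib)
qed

text \<open>Evaluating q = p * sum w/(x - b) at x = 1/t gives sum_E P_E(t) sum_k t^k (M k - mom k E)
  = O(t^5), with P_E the reversed characteristic polynomial. Since P_E = 1 +
  \<open>cut_delta\<close> t^2 + O(t^4), the coefficients through t^4 are the listed
  equations.\<close>

lemma cut_moments:
  fixes a :: "real fmat" and v :: "nat \<Rightarrow> real"
  assumes sym: "\<And>i j. i < n \<Longrightarrow> j < n \<Longrightarrow> a i j = a j i" and n: "n > 0"
    and v: "(\<Sum>i<n. v i * v i) = 1"
  defines "mom \<equiv> \<lambda>k E. \<Sum>i<n. v i * mat_pow_vec n (cut_fn a E) v k i"
  obtains R w and M :: "nat \<Rightarrow> real" where "finite R" "\<And>b. b \<in> R \<Longrightarrow> poly (cut_charpoly n a) b = 0"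
    "\<And>b. b \<in> R \<Longrightarrow> w b \<ge> 0" "M = (\<lambda>k. \<Sum>b\<in>R. w b * b ^ k)"
    "M 0 = 1"
    "(\<Sum>E\<in>Pow {..<n}. M 1 - mom 1 E) = 0"
    "(\<Sum>E\<in>Pow {..<n}. M 2 - mom 2 E) = 0"
    "(\<Sum>E\<in>Pow {..<n}. M 3 - mom 3 E + cut_delta n a E * (M 1 - mom 1 E)) = 0"
    "(\<Sum>E\<in>Pow {..<n}. M 4 - mom 4 E + cut_delta n a E * (M 2 - mom 2 E)) = 0"
proof -
  let ?I = "Pow {..<n}" and ?K = "cut_fn a" and ?m = "5 :: nat"
  define p where "p = cut_charpoly n a"
  define q where "q = p - cut_poly n a (\<lambda>i j. v i * v j)"
  define P where "P E = rev_det n (?K E)" for E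
  from cut_poly_measure[where v = v and a = a and n = n, OF sym n]
  obtain R w where R: "finite R" "\<And>b. b \<in> R \<Longrightarrow> poly p b = 0 \<and> w b \<ge> 0"
    and pq: "\<And>x. poly p x \<noteq> 0 \<Longrightarrow> poly q x = poly p x * (\<Sum>b\<in>R. w b / (x - b))"
    unfolding p_def[symmetric] q_def[symmetric] by blast
  define M where "M k = (\<Sum>b\<in>R. w b * b ^ k)" for k
  have Ksym: "?K E i j = ?K E j i" if "i < n" "j < n" for E i j
    using sym[OF that] by (rule cut_fn_sym)
  have "\<forall>E. \<exists>C. \<forall>\<^sub>F t in at_right 0. \<exists>e. \<bar>e\<bar> \<le> C \<and>
    t ^ n * rank_one_gap n (?K E) v (1 / t)
      = t * poly (P E) t * ((\<Sum>k<?m. t ^ k * mom k E) + t ^ ?m * e)"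
    unfolding mom_def P_def by (intro allI reversed_resolvent_expansion Ksym)
  from choice[OF this] obtain C where C: "\<And>E. \<forall>\<^sub>F t in at_right 0. \<exists>e. \<bar>e\<bar> \<le> C E \<and>
    t ^ n * rank_one_gap n (?K E) v (1 / t)
      = t * poly (P E) t * ((\<Sum>k<?m. t ^ k * mom k E) + t ^ ?m * e)" by (elim exE) blast
  have ev1: "\<forall>\<^sub>F t in at_right 0. \<forall>E\<in>?I. \<exists>e. \<bar>e\<bar> \<le> C E \<and>
    t ^ n * rank_one_gap n (?K E) v (1 / t)
      = t * poly (P E) t * ((\<Sum>k<?m. t ^ k * mom k E) + t ^ ?m * e)"
    by (intro eventually_ball_finite ballI C) simp
  have P0: "poly (P E) 0 = 1" for E
    unfolding P_def by (rule rev_det_low[of n "?K E"]) simp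
  have Plim: "((\<lambda>t. poly (P E) t) \<longlongrightarrow> 1) (at_right 0)" for E
    using tendsto_poly[OF tendsto_ident_at, of "P E" "0" "{0<..}"] P0 by simp
  have ev2: "\<forall>\<^sub>F t in at_right 0. \<forall>E\<in>?I. poly (P E) t > 0 \<and> poly (P E) t < 2"
    by (intro eventually_ball_finite ballI eventually_conj order_tendstoD[OF Plim]) simp_all
  have ev3: "\<forall>\<^sub>F t in at_right 0. \<forall>b\<in>R. t * b < 1 / 2"
  proof (intro eventually_ball_finite R(1) ballI)
    fix b :: real
    have "((\<lambda>t. t * b) \<longlongrightarrow> 0 * b) (at_right 0)" by (intro tendsto_intros)
    then show "\<forall>\<^sub>F t in at_right 0. t * b < 1 / 2" by (rule order_tendstoD(2)) simp
  qed
  define C' where "C' = (\<Sum>b\<in>R. w b * (2 * \<bar>b\<bar> ^ ?m))"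
  define g where "g E = [:M 0 - mom 0 E, M 1 - mom 1 E, M 2 - mom 2 E, M 3 - mom 3 E, M 4 - mom 4 E:]" for E
  \<comment> \<open>Collects all terms through t^4 of both expansions. What is left over is of order
    t^5, so coefficients 0 to 4 of \<open>Q\<close> vanish.\<close>
  define Q where "Q = (\<Sum>E\<in>?I. P E * g E)"
  have g: "poly (g E) t = (\<Sum>k<?m. t ^ k * M k) - (\<Sum>k<?m. t ^ k * mom k E)" for E t
    by (simp add: g_def eval_nat_numeral algebra_simps)
  have "\<forall>\<^sub>F t in at_right 0. \<bar>poly Q t\<bar> \<le> (\<Sum>E\<in>?I. 2 * (C E + C')) * t ^ ?m"
    using ev1 ev2 ev3 eventually_at_right_less
  proof eventually_elim
    case (elim t)
    note t = \<open>0 < t\<close>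
    define \<sigma> where "\<sigma> = (\<Sum>b\<in>R. w b * (b ^ ?m / (1 - t * b)))"
    from bchoice[OF elim(1)] obtain e where e: "\<And>E. E \<in> ?I \<Longrightarrow> \<bar>e E\<bar> \<le> C E"
      "\<And>E. E \<in> ?I \<Longrightarrow> t ^ n * rank_one_gap n (?K E) v (1 / t)
      = t * poly (P E) t * ((\<Sum>k<?m. t ^ k * mom k E) + t ^ ?m * e E)" by (elim exE) blast
    have pP: "t ^ n * poly p (1 / t) = (\<Sum>E\<in>?I. poly (P E) t) / 2 ^ n"
    proof -
      have "t ^ n * det_fn n (\<lambda>i j. diag_fn (1 / t) i j - ?K E i j) = poly (P E) t" for E
        unfolding det_fn_scale[symmetric] poly_rev_det P_def
        by (rule det_fn_cong) (use t in \<open>auto simp: diag_fn_def algebra_simps\<close>)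
      then show ?thesis unfolding p_def poly_cut_poly by (simp add: sum_distrib_left)
    qed
    have "(\<Sum>E\<in>?I. poly (P E) t) > 0" using elim(2) by (intro sum_pos) auto
    then have p0: "poly p (1 / t) \<noteq> 0" using pP t by auto
    have "w b / (1 / t - b) = t * (w b * ((\<Sum>k<?m. t ^ k * b ^ k) + t ^ ?m * (b ^ ?m / (1 - t * b))))" if "b \<in> R" for b
    proof -
      have "t * b \<noteq> 1" using elim(3) that by force
      note geometric_split[OF this, of ?m]
      moreover have "w b / (1 / t - b) = t * (w b * (1 / (1 - t * b)))" using t by (simp add: field_simps)
      ultimately show ?thesis by (simp only:)
    qed
    then have "(\<Sum>b\<in>R. w b / (1 / t - b)) =
      (\<Sum>b\<in>R. t * (w b * ((\<Sum>k<?m. t ^ k * b ^ k) + t ^ ?m * (b ^ ?m / (1 - t * b)))))" by simp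
    also have "\<dots> = t * ((\<Sum>k<?m. t ^ k * M k) + t ^ ?m * \<sigma>)"
      unfolding M_def \<sigma>_def sum_distrib_left
      by (subst sum.swap) (simp add: algebra_simps sum.distrib sum_distrib_left)
    finally have "poly q (1 / t) = poly p (1 / t) * (t * ((\<Sum>k<?m. t ^ k * M k) + t ^ ?m * \<sigma>))"
      using pq[OF p0] by simp
    then have rhs: "t ^ n * poly q (1 / t) = (\<Sum>E\<in>?I. poly (P E) t) / 2 ^ n * (t * ((\<Sum>k<?m. t ^ k * M k) + t ^ ?m * \<sigma>))"
      unfolding pP[symmetric] by (simp only: mult.assoc)
    have "t ^ n * poly q (1 / t) = (\<Sum>E\<in>?I. t * poly (P E) t * ((\<Sum>k<?m. t ^ k * mom k E) + t ^ ?m * e E)) / 2 ^ n"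
    proof -
      have "t ^ n * poly q (1 / t) = (\<Sum>E\<in>?I. t ^ n * rank_one_gap n (?K E) v (1 / t)) / 2 ^ n"
        unfolding q_def p_def poly_diff poly_cut_poly rank_one_gap_def sum_distrib_left[symmetric] sum_subtractf
        by (simp add: diff_divide_distrib right_diff_distrib)
      also have "(\<Sum>E\<in>?I. t ^ n * rank_one_gap n (?K E) v (1 / t))
        = (\<Sum>E\<in>?I. t * poly (P E) t * ((\<Sum>k<?m. t ^ k * mom k E) + t ^ ?m * e E))"
        by (rule sum.cong[OF refl e(2)])
      finally show ?thesis .
    qed
    with rhs have "t * (\<Sum>E\<in>?I. poly (P E) t * ((\<Sum>k<?m. t ^ k * mom k E) + t ^ ?m * e E)) =
      t * (\<Sum>E\<in>?I. poly (P E) t * ((\<Sum>k<?m. t ^ k * M k) + t ^ ?m * \<sigma>))"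
      by (simp add: sum_distrib_left sum_distrib_right mult_ac)
    then have "(\<Sum>E\<in>?I. poly (P E) t * ((\<Sum>k<?m. t ^ k * mom k E) + t ^ ?m * e E)) =
      (\<Sum>E\<in>?I. poly (P E) t * ((\<Sum>k<?m. t ^ k * M k) + t ^ ?m * \<sigma>))"
      using t by simp
    then have "0 = (\<Sum>E\<in>?I. poly (P E) t * ((\<Sum>k<?m. t ^ k * M k) + t ^ ?m * \<sigma>) -
      poly (P E) t * ((\<Sum>k<?m. t ^ k * mom k E) + t ^ ?m * e E))"
      by (simp add: sum_subtractf)
    also have "\<dots> = (\<Sum>E\<in>?I. poly (P E * g E) t - t ^ ?m * (poly (P E) t * (e E - \<sigma>)))"
      by (rule sum.cong) (simp_all add: g algebra_simps)
    finally have Q: "poly Q t = t ^ ?m * (\<Sum>E\<in>?I. poly (P E) t * (e E - \<sigma>))"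
      by (simp add: Q_def poly_sum sum_subtractf sum_distrib_left)
    have \<sigma>: "\<bar>\<sigma>\<bar> \<le> C'"
      unfolding \<sigma>_def C'_def
    proof (rule order.trans[OF sum_abs], rule sum_mono)
      fix b assume b: "b \<in> R"
      then have tb: "1 - t * b \<ge> 1 / 2" using elim(3) by fastforce
      have "\<bar>b ^ ?m / (1 - t * b)\<bar> = \<bar>b\<bar> ^ ?m / (1 - t * b)" using tb by (simp add: power_abs)
      also have "\<dots> \<le> \<bar>b\<bar> ^ ?m / (1 / 2)" using tb by (intro divide_left_mono) auto
      also have "\<dots> = 2 * \<bar>b\<bar> ^ ?m" by simp
      finally have "w b * \<bar>b ^ ?m / (1 - t * b)\<bar> \<le> w b * (2 * \<bar>b\<bar> ^ ?m)"
        using R(2)[OF b] by (intro mult_left_mono) auto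
      moreover have "\<bar>w b\<bar> = w b" using R(2)[OF b] by simp
      ultimately show "\<bar>w b * (b ^ ?m / (1 - t * b))\<bar> \<le> w b * (2 * \<bar>b\<bar> ^ ?m)"
        by (simp only: abs_mult)
    qed
    have "\<bar>\<Sum>E\<in>?I. poly (P E) t * (e E - \<sigma>)\<bar> \<le> (\<Sum>E\<in>?I. 2 * (C E + C'))"
    proof (rule order.trans[OF sum_abs], rule sum_mono)
      fix E assume E: "E \<in> ?I"
      have A: "\<bar>e E - \<sigma>\<bar> \<le> C E + C'" using e(1)[OF E] \<sigma> by linarith
      have B: "\<bar>poly (P E) t\<bar> \<le> 2" using bspec[OF elim(2) E] by linarith
      show "\<bar>poly (P E) t * (e E - \<sigma>)\<bar> \<le> 2 * (C E + C')"
        unfolding abs_mult by (rule mult_mono[OF B A]) simp_all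
    qed
    note bound = this
    have tm: "t ^ ?m \<ge> 0" using t by simp
    have "\<bar>poly Q t\<bar> = t ^ ?m * \<bar>\<Sum>E\<in>?I. poly (P E) t * (e E - \<sigma>)\<bar>"
      unfolding Q abs_mult abs_of_nonneg[OF tm] ..
    also have "\<dots> \<le> t ^ ?m * (\<Sum>E\<in>?I. 2 * (C E + C'))" by (rule mult_left_mono[OF bound tm])
    finally show ?case by (simp only: mult.commute)
  qed
  note coeff0 = coeff_0_of_poly_bigo[OF this]
  have "\<exists>r. P E = pCons 1 (pCons 0 (pCons (cut_delta n a E) (pCons 0 r)))" for E
    unfolding P_def by (rule rev_det_cut_expand[of n a E]) blast
  then obtain r where r: "\<And>E. P E = pCons 1 (pCons 0 (pCons (cut_delta n a E) (pCons 0 (r E))))" by metis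
  have mom0: "mom 0 E = 1" for E using v by (simp add: mom_def)
  have cQ: "coeff Q k = (\<Sum>E\<in>?I. coeff (P E * g E) k)" for k
    by (simp add: Q_def coeff_sum)
  have "coeff Q 0 = 2 ^ n * (M 0 - 1)"
    unfolding cQ by (simp add: r g_def mom0 card_Pow)
  with coeff0[of 0] have M0: "M 0 = 1" by simp
  have c1: "coeff (P E * g E) 1 = M 1 - mom 1 E" for E
    by (simp add: r g_def mom0 M0)
  have c2: "coeff (P E * g E) 2 = M 2 - mom 2 E" for E
    by (simp add: r g_def mom0 M0 numeral_2_eq_2)
  have c3: "coeff (P E * g E) 3 = M 3 - mom 3 E + cut_delta n a E * (M 1 - mom 1 E)" for E
    by (simp add: r g_def mom0 M0 numeral_3_eq_3)
  \<comment> \<open>The unknown t^4 coefficient of \<open>P E\<close> meets only M 0 - mom 0 E,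
    which is 0.\<close>
  have c4: "coeff (P E * g E) 4 = M 4 - mom 4 E + cut_delta n a E * (M 2 - mom 2 E)" for E
    by (simp add: r g_def mom0 M0 eval_nat_numeral)
  show ?thesis
  proof (rule that[of R w M])
    show "finite R" "M = (\<lambda>k. \<Sum>b\<in>R. w b * b ^ k)" "M 0 = 1" using R M_def M0 by auto
    show "poly (cut_charpoly n a) b = 0" "w b \<ge> 0" if "b \<in> R" for b
      using R(2)[OF that] by (auto simp: p_def)
    have z: "(\<Sum>E\<in>?I. coeff (P E * g E) k) = 0" if "k < 5" for k
      using coeff0[OF that] unfolding cQ .
    show "(\<Sum>E\<in>?I. M 1 - mom 1 E) = 0" using z[of 1] unfolding c1 by simp
    show "(\<Sum>E\<in>?I. M 2 - mom 2 E) = 0" using z[of 2] unfolding c2 by simp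
    show "(\<Sum>E\<in>?I. M 3 - mom 3 E + cut_delta n a E * (M 1 - mom 1 E)) = 0"
      using z[of 3] unfolding c3 by simp
    show "(\<Sum>E\<in>?I. M 4 - mom 4 E + cut_delta n a E * (M 2 - mom 2 E)) = 0"
      using z[of 4] unfolding c4 by simp
  qed
qed

section \<open>Averages of products of two and four signs\<close>

lemma sum_sg_2:
  assumes "i < n" "j < n"
  shows "(\<Sum>E\<in>Pow {..<n}. sg E i * sg E j) = (if i = j then 2 ^ n else (0::real))"
  using sum_sg_characters[of "{..<n}" "{i}" "{j}", where ?'a = real] assms by simp

text \<open>Of the three pairings of four signs, \<open>k \<noteq> l\<close> rules out one and
  prevents the other two from coinciding.\<close>

lemma sum_sg_4:
  assumes ij: "k < n" "l < n" "i < n" "j < n" and kl: "k \<noteq> l"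
  shows "(\<Sum>E\<in>Pow {..<n}. sg E k * sg E l * (sg E i * sg E j)) =
    2 ^ n * ((if i = k \<and> j = l then 1 else 0) + (if i = l \<and> j = k then 1 else (0::real)))"
proof (cases "i = j")
  case True
  then show ?thesis using sum_sg_2[of k n l] ij kl by auto
next
  case False
  then have "(\<Sum>E\<in>Pow {..<n}. sg E k * sg E l * (sg E i * sg E j)) = (if {k, l} = {i, j} then 2 ^ n else (0::real))"
    using sum_sg_characters[of "{..<n}" "{k, l}" "{i, j}", where ?'a = real] ij kl by simp
  then show ?thesis using False kl by (auto simp: doubleton_eq_iff)
qed

lemma sum_sg_bilinear:
  fixes f g :: "nat \<Rightarrow> real"
  shows "(\<Sum>E\<in>Pow {..<n}. (\<Sum>j<n. f j * sg E j) * (\<Sum>k<n. g k * sg E k)) = 2 ^ n * (\<Sum>j<n. f j * g j)"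
proof -
  have "(\<Sum>E\<in>Pow {..<n}. (\<Sum>j<n. f j * sg E j) * (\<Sum>k<n. g k * sg E k)) =
    (\<Sum>E\<in>Pow {..<n}. \<Sum>j<n. \<Sum>k<n. f j * g k * (sg E j * sg E k))"
    by (simp add: sum_product mult_ac)
  also have "\<dots> = (\<Sum>j<n. \<Sum>E\<in>Pow {..<n}. \<Sum>k<n. f j * g k * (sg E j * sg E k))" by (rule sum.swap)
  also have "\<dots> = (\<Sum>j<n. \<Sum>k<n. \<Sum>E\<in>Pow {..<n}. f j * g k * (sg E j * sg E k))"
    by (rule sum.cong[OF refl], rule sum.swap)
  also have "\<dots> = (\<Sum>j<n. \<Sum>k<n. if k = j then 2 ^ n * (f j * g j) else 0)"
    by (intro sum.cong refl) (simp add: sum_distrib_left[symmetric] sum_sg_2)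
  also have "\<dots> = 2 ^ n * (\<Sum>j<n. f j * g j)" by (simp add: sum_distrib_left)
  finally show ?thesis .
qed

text \<open>The hypothesis restricts the sum to \<open>k \<noteq> l\<close>. In each application the
  first index pair carries a factor of \<open>a\<close>, which vanishes on the diagonal.\<close>

lemma sum_sg_quartic:
  fixes H :: "nat \<Rightarrow> nat \<Rightarrow> real fmat"
  assumes H: "\<And>k i j. k < n \<Longrightarrow> H k k i j = 0"
  shows "(\<Sum>E\<in>Pow {..<n}. \<Sum>k<n. \<Sum>l<n. \<Sum>i<n. \<Sum>j<n. H k l i j * (sg E k * sg E l * (sg E i * sg E j))) =
    2 ^ n * (\<Sum>k<n. \<Sum>l<n. H k l k l + H k l l k)"
proof -
  have in4: "(\<Sum>E\<in>Pow {..<n}. H k l i j * (sg E k * sg E l * (sg E i * sg E j))) =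
    2 ^ n * ((if j = l then if i = k then H k l k l else 0 else 0) + (if j = k then if i = l then H k l l k else 0 else 0))"
    if "k < n" "l < n" "i < n" "j < n" for k l i j
  proof (cases "k = l")
    case True then show ?thesis using H that by simp
  next
    case False
    show ?thesis unfolding sum_distrib_left[symmetric] sum_sg_4[OF that False] by auto
  qed
  have "(\<Sum>E\<in>Pow {..<n}. \<Sum>k<n. \<Sum>l<n. \<Sum>i<n. \<Sum>j<n. H k l i j * (sg E k * sg E l * (sg E i * sg E j))) =
    (\<Sum>k<n. \<Sum>l<n. \<Sum>i<n. \<Sum>j<n. \<Sum>E\<in>Pow {..<n}. H k l i j * (sg E k * sg E l * (sg E i * sg E j)))"
    by (simp only: sum.swap[of _ _ "Pow {..<n}"])
  also have "\<dots> = (\<Sum>k<n. \<Sum>l<n. \<Sum>i<n. \<Sum>j<n.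
    2 ^ n * ((if j = l then if i = k then H k l k l else 0 else 0) + (if j = k then if i = l then H k l l k else 0 else 0)))"
    by (intro sum.cong refl) (simp add: in4)
  also have "\<dots> = 2 ^ n * (\<Sum>k<n. \<Sum>l<n. H k l k l + H k l l k)"
    unfolding sum_distrib_left[symmetric]
    by (intro arg_cong2[of _ _ _ _ "(*)"] sum.cong refl) (simp add: sum.distrib)
  finally show ?thesis .
qed

lemma double_sum_product:
  fixes f :: "real fmat"
  shows "(\<Sum>k<n. \<Sum>l<n. f k l) * (\<Sum>i<n. \<Sum>j<n. g i j) = (\<Sum>k<n. \<Sum>l<n. \<Sum>i<n. \<Sum>j<n. f k l * g i j)"
  by (simp only: sum_distrib_right) (simp only: sum_distrib_left)

text \<open>\<open>cube\<close> encodes entries in {-1, 0, 1} in the form in which a_kl^3 appears in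
  the averages. Maximality of \<open>lam\<close> is not part of the locale; it enters through the
  hypothesis \<open>top\<close> further on.\<close>

locale signed_regular =
  fixes n :: nat and a :: "real fmat" and d :: real and v :: "nat \<Rightarrow> real" and lam :: real
  assumes sym: "\<And>i j. i < n \<Longrightarrow> j < n \<Longrightarrow> a i j = a j i"
    and diag: "\<And>i. i < n \<Longrightarrow> a i i = 0"
    and cube: "\<And>i j. i < n \<Longrightarrow> j < n \<Longrightarrow> a i j * a i j * a i j = a i j"
    and regular: "\<And>i. i < n \<Longrightarrow> (\<Sum>j<n. a i j * a i j) = d"
    and unit: "(\<Sum>i<n. v i * v i) = 1"
    and eigen: "\<And>i. i < n \<Longrightarrow> (\<Sum>j<n. a i j * v j) = lam * v i"
begin

text \<open>With \<open>D = diag(sg E)\<close>, below \<open>y = D A D v\<close>, \<open>z = D A\<^sup>2 D v\<close>, and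
  \<open>K1\<close>, \<open>K2\<close> are the first two powers of \<open>A - D A D\<close> applied to \<open>v\<close>.\<close>

definition sq :: "real fmat" where "sq i j = (\<Sum>k<n. a i k * a k j)"

text \<open>The average of the diagonal of A^3 with weights v_j^2; \<open>N4\<close> is the same for
  A^4, by symmetry of A^2.\<close>

definition T :: real where "T = (\<Sum>i<n. \<Sum>j<n. a i j * sq i j * (v j * v j))"

definition N4 :: real where "N4 = (\<Sum>i<n. \<Sum>j<n. sq i j * sq i j * (v j * v j))"

text \<open>The form of the entrywise product of A, A and A^2 at v, which arises from the crossed
  pairing of four signs.\<close>

definition tau :: real where "tau = (\<Sum>i<n. \<Sum>j<n. a i j * a i j * sq i j * (v i * v j))"

definition aw :: "nat set \<Rightarrow> nat \<Rightarrow> real" where "aw E i = (\<Sum>j<n. a i j * v j * sg E j)"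

definition sqw :: "nat set \<Rightarrow> nat \<Rightarrow> real" where "sqw E i = (\<Sum>j<n. sq i j * v j * sg E j)"

definition y :: "nat set \<Rightarrow> nat \<Rightarrow> real" where "y E i = sg E i * aw E i"

definition dot :: "(nat \<Rightarrow> real) \<Rightarrow> (nat \<Rightarrow> real) \<Rightarrow> real" where "dot x z = (\<Sum>i<n. x i * z i)"

definition app :: "(nat \<Rightarrow> real) \<Rightarrow> nat \<Rightarrow> real" where "app x i = (\<Sum>j<n. a i j * x j)"

abbreviation z :: "nat set \<Rightarrow> nat \<Rightarrow> real" where "z E \<equiv> \<lambda>i. sg E i * sqw E i"

lemma sq_sym: "i < n \<Longrightarrow> j < n \<Longrightarrow> sq i j = sq j i"
  unfolding sq_def by (rule sum.cong) (auto simp: sym mult.commute)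

lemma sq_diag: "i < n \<Longrightarrow> sq i i = d"
  unfolding sq_def regular[symmetric] by (rule sum.cong) (auto simp: sym)

lemma mult_y_y:
  "c * (y E k * y E l) = (\<Sum>i<n. \<Sum>j<n. c * a k i * a l j * (v i * v j) * (sg E k * sg E l * (sg E i * sg E j)))"
proof -
  have "c * (y E k * y E l) = c * sg E k * sg E l * (aw E k * aw E l)" by (simp add: y_def mult_ac)
  also have "\<dots> = (\<Sum>i<n. \<Sum>j<n. c * sg E k * sg E l * (a k i * v i * sg E i * (a l j * v j * sg E j)))"
    by (simp only: aw_def sum_product) (simp only: sum_distrib_left)
  finally show ?thesis by (simp add: mult_ac)
qed

lemma mult_y_z:
  "c * (y E l * z E k) = (\<Sum>i<n. \<Sum>j<n. c * a l i * sq k j * (v i * v j) * (sg E k * sg E l * (sg E i * sg E j)))"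
proof -
  have "c * (y E l * z E k) = c * sg E k * sg E l * (aw E l * sqw E k)" by (simp add: y_def mult_ac)
  also have "\<dots> = (\<Sum>i<n. \<Sum>j<n. c * sg E k * sg E l * (a l i * v i * sg E i * (sq k j * v j * sg E j)))"
    by (simp only: aw_def sqw_def sum_product) (simp only: sum_distrib_left)
  finally show ?thesis by (simp add: mult_ac)
qed

lemma quad_v: "(\<Sum>i<n. \<Sum>j<n. a i j * (v i * v j)) = lam"
proof -
  have "(\<Sum>i<n. \<Sum>j<n. a i j * (v i * v j)) = (\<Sum>i<n. v i * (\<Sum>j<n. a i j * v j))"
    by (simp add: sum_distrib_left mult_ac)
  also have "\<dots> = (\<Sum>i<n. lam * (v i * v i))" by (rule sum.cong) (auto simp: eigen)
  also have "\<dots> = lam" using unit by (simp flip: sum_distrib_left)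
  finally show ?thesis .
qed

lemma avg_v_y: "(\<Sum>E\<in>Pow {..<n}. dot v (y E)) = 0"
proof -
  \<comment> \<open>The factor \<open>v i * sg E i\<close> is written as a linear form in all signs
    so that \<open>sum_sg_bilinear\<close> applies.\<close>
  have "dot v (y E) = (\<Sum>i<n. (\<Sum>j<n. (if j = i then v i else 0) * sg E j) * (\<Sum>j<n. a i j * v j * sg E j))" for E
    unfolding dot_def y_def aw_def by (rule sum.cong) (auto simp: if_distrib[of "\<lambda>x. x * _"] cong: if_cong)
  then have "(\<Sum>E\<in>Pow {..<n}. dot v (y E)) =
    (\<Sum>i<n. \<Sum>E\<in>Pow {..<n}. (\<Sum>j<n. (if j = i then v i else 0) * sg E j) * (\<Sum>j<n. a i j * v j * sg E j))"
    by (simp only:) (rule sum.swap)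
  also have "\<dots> = (\<Sum>i<n. 0)"
    unfolding sum_sg_bilinear by (rule sum.cong) (auto simp: if_distrib[of "\<lambda>x. x * _"] diag cong: if_cong)
  finally show ?thesis by simp
qed

lemma dot_y_y: "dot (y E) (y E) = (\<Sum>i<n. aw E i * aw E i)"
  unfolding dot_def y_def by (rule sum.cong) (auto simp: sg_def)

lemma avg_y_y: "(\<Sum>E\<in>Pow {..<n}. dot (y E) (y E)) = 2 ^ n * d"
proof -
  have "(\<Sum>E\<in>Pow {..<n}. dot (y E) (y E)) = (\<Sum>i<n. \<Sum>E\<in>Pow {..<n}. aw E i * aw E i)"
    unfolding dot_y_y by (rule sum.swap)
  also have "\<dots> = 2 ^ n * (\<Sum>i<n. \<Sum>j<n. a i j * v j * (a i j * v j))"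
    unfolding aw_def sum_sg_bilinear by (simp add: sum_distrib_left)
  also have "(\<Sum>i<n. \<Sum>j<n. a i j * v j * (a i j * v j)) = (\<Sum>j<n. \<Sum>i<n. a i j * v j * (a i j * v j))"
    by (rule sum.swap)
  also have "\<dots> = (\<Sum>j<n. (\<Sum>i<n. a j i * a j i) * (v j * v j))"
    unfolding sum_distrib_right by (intro sum.cong refl) (auto simp: sym[of _ "_"] mult_ac)
  also have "\<dots> = d" using unit by (simp add: regular flip: sum_distrib_left)
  finally show ?thesis .
qed

lemma avg_y_z: "(\<Sum>E\<in>Pow {..<n}. dot (y E) (z E)) = 2 ^ n * T"
proof -
  have "dot (y E) (z E) = (\<Sum>i<n. aw E i * sqw E i)" for E
    unfolding dot_def y_def by (rule sum.cong) (auto simp: sg_def)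
  then have "(\<Sum>E\<in>Pow {..<n}. dot (y E) (z E)) = (\<Sum>i<n. \<Sum>E\<in>Pow {..<n}. aw E i * sqw E i)"
    by (simp only:) (rule sum.swap)
  also have "\<dots> = 2 ^ n * (\<Sum>i<n. \<Sum>j<n. a i j * v j * (sq i j * v j))"
    unfolding aw_def sqw_def sum_sg_bilinear by (simp add: sum_distrib_left)
  finally show ?thesis by (simp add: T_def mult_ac)
qed

lemma avg_z_z: "(\<Sum>E\<in>Pow {..<n}. dot (z E) (z E)) = 2 ^ n * N4"
proof -
  have "dot (z E) (z E) = (\<Sum>i<n. sqw E i * sqw E i)" for E
    unfolding dot_def by (rule sum.cong) (auto simp: sg_def)
  then have "(\<Sum>E\<in>Pow {..<n}. dot (z E) (z E)) = (\<Sum>i<n. \<Sum>E\<in>Pow {..<n}. sqw E i * sqw E i)"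
    by (simp only:) (rule sum.swap)
  also have "\<dots> = 2 ^ n * (\<Sum>i<n. \<Sum>j<n. sq i j * v j * (sq i j * v j))"
    unfolding sqw_def sum_sg_bilinear by (simp add: sum_distrib_left)
  finally show ?thesis by (simp add: N4_def mult_ac)
qed

text \<open>One pairing carries a_kk and vanishes; the other yields a_kl^3 = a_kl, so the average is
  again v^T A v.\<close>

lemma avg_y_app_y: "(\<Sum>E\<in>Pow {..<n}. dot (y E) (app (y E))) = 2 ^ n * lam"
proof -
  let ?H = "\<lambda>k l i j. a k l * a k i * a l j * (v i * v j)"
  have "dot (y E) (app (y E)) =
    (\<Sum>k<n. \<Sum>l<n. \<Sum>i<n. \<Sum>j<n. ?H k l i j * (sg E k * sg E l * (sg E i * sg E j)))" for E
  proof -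
    have "dot (y E) (app (y E)) = (\<Sum>k<n. \<Sum>l<n. a k l * (y E k * y E l))"
      unfolding dot_def app_def by (simp add: sum_distrib_left mult_ac)
    then show ?thesis unfolding mult_y_y .
  qed
  then have "(\<Sum>E\<in>Pow {..<n}. dot (y E) (app (y E))) = 2 ^ n * (\<Sum>k<n. \<Sum>l<n. ?H k l k l + ?H k l l k)"
    by (simp only:) (rule sum_sg_quartic, simp add: diag)
  also have "(\<Sum>k<n. \<Sum>l<n. ?H k l k l + ?H k l l k) = (\<Sum>k<n. \<Sum>l<n. a k l * (v k * v l))"
  proof (intro sum.cong refl)
    fix k l assume "k \<in> {..<n}" "l \<in> {..<n}"
    then show "?H k l k l + ?H k l l k = a k l * (v k * v l)"
      using cube[of k l] sym[of l k] by (simp add: diag mult.commute)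
  qed
  finally show ?thesis by (simp only: quad_v)
qed

text \<open>The indices are ordered so that the first pair is joined by \<open>a k i\<close>, as
  \<open>sum_sg_quartic\<close> requires. The two pairings give d^2 and \<open>tau\<close>.\<close>

lemma avg_app_y_app_y: "(\<Sum>E\<in>Pow {..<n}. dot (app (y E)) (app (y E))) = 2 ^ n * (d\<^sup>2 + tau)"
proof -
  let ?H = "\<lambda>k i l j. sq k l * a k i * a l j * (v i * v j)"
  have "dot (app (y E)) (app (y E)) =
    (\<Sum>k<n. \<Sum>i<n. \<Sum>l<n. \<Sum>j<n. ?H k i l j * (sg E k * sg E i * (sg E l * sg E j)))" for E
  proof -
    have "dot (app (y E)) (app (y E)) = (\<Sum>m<n. \<Sum>k<n. \<Sum>l<n. a m k * y E k * (a m l * y E l))"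
      unfolding dot_def app_def by (simp add: sum_product)
    also have "\<dots> = (\<Sum>k<n. \<Sum>m<n. \<Sum>l<n. a m k * y E k * (a m l * y E l))" by (rule sum.swap)
    also have "\<dots> = (\<Sum>k<n. \<Sum>l<n. \<Sum>m<n. a m k * y E k * (a m l * y E l))"
      by (rule sum.cong[OF refl], rule sum.swap)
    also have "\<dots> = (\<Sum>k<n. \<Sum>l<n. sq k l * (y E k * y E l))"
      unfolding sq_def sum_distrib_right by (intro sum.cong refl) (auto simp: sym mult_ac)
    also have "\<dots> = (\<Sum>k<n. \<Sum>l<n. \<Sum>i<n. \<Sum>j<n. ?H k i l j * (sg E k * sg E i * (sg E l * sg E j)))"
      unfolding mult_y_y by (simp add: mult_ac)
    also have "\<dots> = (\<Sum>k<n. \<Sum>i<n. \<Sum>l<n. \<Sum>j<n. ?H k i l j * (sg E k * sg E i * (sg E l * sg E j)))"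
      by (rule sum.cong[OF refl], rule sum.swap)
    finally show ?thesis .
  qed
  then have "(\<Sum>E\<in>Pow {..<n}. dot (app (y E)) (app (y E))) = 2 ^ n * (\<Sum>k<n. \<Sum>i<n. ?H k i k i + ?H k i i k)"
    by (simp only:) (rule sum_sg_quartic, simp add: diag)
  also have "(\<Sum>k<n. \<Sum>i<n. ?H k i k i + ?H k i i k) =
    (\<Sum>k<n. \<Sum>i<n. d * (a k i * a k i * (v i * v i))) + (\<Sum>k<n. \<Sum>i<n. a k i * a k i * sq k i * (v k * v i))"
    unfolding sum.distrib[symmetric]
  proof (intro sum.cong refl)
    fix k i assume "k \<in> {..<n}" "i \<in> {..<n}"
    then show "?H k i k i + ?H k i i k = d * (a k i * a k i * (v i * v i)) + a k i * a k i * sq k i * (v k * v i)"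
      using sym[of i k] by (simp add: sq_diag mult_ac)
  qed
  also have "(\<Sum>k<n. \<Sum>i<n. d * (a k i * a k i * (v i * v i))) = (\<Sum>i<n. \<Sum>k<n. d * (a k i * a k i * (v i * v i)))"
    by (rule sum.swap)
  also have "\<dots> = (\<Sum>i<n. d * (\<Sum>k<n. a i k * a i k) * (v i * v i))"
    unfolding sum_distrib_left sum_distrib_right by (intro sum.cong refl) (auto simp: sym mult_ac)
  also have "\<dots> = (\<Sum>i<n. d * d * (v i * v i))" by (rule sum.cong) (auto simp: regular)
  also have "\<dots> = d\<^sup>2" using unit by (simp add: power2_eq_square flip: sum_distrib_left)
  finally show ?thesis by (simp add: tau_def)
qed

lemma avg_app_y_z: "(\<Sum>E\<in>Pow {..<n}. dot (app (y E)) (z E)) = 2 ^ n * tau"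
proof -
  let ?H = "\<lambda>k l i j. a k l * a l i * sq k j * (v i * v j)"
  have "dot (app (y E)) (z E) =
    (\<Sum>k<n. \<Sum>l<n. \<Sum>i<n. \<Sum>j<n. ?H k l i j * (sg E k * sg E l * (sg E i * sg E j)))" for E
  proof -
    have "dot (app (y E)) (z E) = (\<Sum>k<n. \<Sum>l<n. a k l * (y E l * z E k))"
      unfolding dot_def app_def by (simp add: sum_distrib_left sum_distrib_right mult_ac)
    then show ?thesis unfolding mult_y_z .
  qed
  then have "(\<Sum>E\<in>Pow {..<n}. dot (app (y E)) (z E)) = 2 ^ n * (\<Sum>k<n. \<Sum>l<n. ?H k l k l + ?H k l l k)"
    by (simp only:) (rule sum_sg_quartic, simp add: diag)
  also have "(\<Sum>k<n. \<Sum>l<n. ?H k l k l + ?H k l l k) = tau"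
    unfolding tau_def
  proof (intro sum.cong refl)
    fix k l assume "k \<in> {..<n}" "l \<in> {..<n}"
    then show "?H k l k l + ?H k l l k = a k l * a k l * sq k l * (v k * v l)"
      using sym[of l k] by (simp add: diag)
  qed
  finally show ?thesis .
qed

text \<open>The part of \<open>cut_delta\<close> that depends on the signs; the rest is the constant
  -n d (\<open>cut_delta_eq\<close>).\<close>

definition Z :: "nat set \<Rightarrow> real" where
  "Z E = (\<Sum>k<n. \<Sum>l<n. a k l * a k l * (sg E k * sg E l))"

lemma avg_Z_v_y: "(\<Sum>E\<in>Pow {..<n}. Z E * dot v (y E)) = 2 ^ n * (2 * lam)"
proof -
  let ?H = "\<lambda>k l i j. a k l * a k l * a i j * (v i * v j)"
  have "dot v (y E) = (\<Sum>i<n. \<Sum>j<n. a i j * (v i * v j) * (sg E i * sg E j))" for E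
    unfolding dot_def y_def aw_def by (simp add: sum_distrib_left mult_ac)
  then have "Z E * dot v (y E) =
    (\<Sum>k<n. \<Sum>l<n. \<Sum>i<n. \<Sum>j<n. ?H k l i j * (sg E k * sg E l * (sg E i * sg E j)))" for E
    unfolding Z_def by (simp only: double_sum_product) (simp add: mult_ac)
  then have "(\<Sum>E\<in>Pow {..<n}. Z E * dot v (y E)) = 2 ^ n * (\<Sum>k<n. \<Sum>l<n. ?H k l k l + ?H k l l k)"
    by (simp only:) (rule sum_sg_quartic, simp add: diag)
  also have "(\<Sum>k<n. \<Sum>l<n. ?H k l k l + ?H k l l k) = (\<Sum>k<n. \<Sum>l<n. 2 * (a k l * (v k * v l)))"
  proof (intro sum.cong refl)
    fix k l assume "k \<in> {..<n}" "l \<in> {..<n}"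
    then show "?H k l k l + ?H k l l k = 2 * (a k l * (v k * v l))"
      using cube[of k l] sym[of l k] by (simp add: mult_ac)
  qed
  also have "\<dots> = 2 * lam" by (simp add: quad_v flip: sum_distrib_left)
  finally show ?thesis .
qed

lemma avg_Z_y_y: "(\<Sum>E\<in>Pow {..<n}. Z E * dot (y E) (y E)) = 2 ^ n * (2 * tau)"
proof -
  let ?H = "\<lambda>k l i j. a k l * a k l * sq i j * (v i * v j)"
  have yy: "dot (y E) (y E) = (\<Sum>i<n. \<Sum>j<n. sq i j * (v i * v j) * (sg E i * sg E j))" for E
  proof -
    have "dot (y E) (y E) = (\<Sum>m<n. \<Sum>i<n. \<Sum>j<n. a m i * v i * sg E i * (a m j * v j * sg E j))"
      unfolding dot_y_y aw_def by (simp add: sum_product)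
    also have "\<dots> = (\<Sum>i<n. \<Sum>m<n. \<Sum>j<n. a m i * v i * sg E i * (a m j * v j * sg E j))" by (rule sum.swap)
    also have "\<dots> = (\<Sum>i<n. \<Sum>j<n. \<Sum>m<n. a m i * v i * sg E i * (a m j * v j * sg E j))"
      by (rule sum.cong[OF refl], rule sum.swap)
    also have "\<dots> = (\<Sum>i<n. \<Sum>j<n. sq i j * (v i * v j) * (sg E i * sg E j))"
      unfolding sq_def sum_distrib_right by (intro sum.cong refl) (auto simp: sym mult_ac)
    finally show ?thesis .
  qed
  have "Z E * dot (y E) (y E) =
    (\<Sum>k<n. \<Sum>l<n. \<Sum>i<n. \<Sum>j<n. ?H k l i j * (sg E k * sg E l * (sg E i * sg E j)))" for E
    unfolding Z_def yy by (simp only: double_sum_product) (simp add: mult_ac)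
  then have "(\<Sum>E\<in>Pow {..<n}. Z E * dot (y E) (y E)) = 2 ^ n * (\<Sum>k<n. \<Sum>l<n. ?H k l k l + ?H k l l k)"
    by (simp only:) (rule sum_sg_quartic, simp add: diag)
  also have "(\<Sum>k<n. \<Sum>l<n. ?H k l k l + ?H k l l k) = (\<Sum>k<n. \<Sum>l<n. 2 * (a k l * a k l * sq k l * (v k * v l)))"
  proof (intro sum.cong refl)
    fix k l assume "k \<in> {..<n}" "l \<in> {..<n}"
    then show "?H k l k l + ?H k l l k = 2 * (a k l * a k l * sq k l * (v k * v l))"
      using sq_sym[of l k] by (simp add: mult_ac)
  qed
  also have "\<dots> = 2 * tau" by (simp add: tau_def flip: sum_distrib_left)
  finally show ?thesis .
qed

end

section \<open>The first four moments in closed form\<close>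

context signed_regular
begin

lemma aw_app: "i < n \<Longrightarrow> (\<Sum>j<n. a i j * aw E j) = sqw E i"
proof -
  have "(\<Sum>j<n. a i j * aw E j) = (\<Sum>j<n. \<Sum>k<n. a i j * a j k * v k * sg E k)"
    unfolding aw_def sum_distrib_left by (simp add: mult_ac)
  also have "\<dots> = (\<Sum>k<n. \<Sum>j<n. a i j * a j k * v k * sg E k)" by (rule sum.swap)
  also have "\<dots> = sqw E i" unfolding sqw_def sq_def sum_distrib_right by simp
  finally show ?thesis .
qed

lemma cut_v:
  assumes "i < n"
  shows "(\<Sum>j<n. cut_fn a E i j * v j) = lam * v i - y E i"
proof -
  have "(\<Sum>j<n. cut_fn a E i j * v j) = (\<Sum>j<n. a i j * v j) - sg E i * (\<Sum>j<n. a i j * v j * sg E j)"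
    unfolding sum_distrib_left sum_subtractf[symmetric]
    by (rule sum.cong) (auto simp: cut_fn_def algebra_simps)
  then show ?thesis using eigen[OF assms] by (simp add: y_def aw_def)
qed

lemma cut_y:
  assumes "i < n"
  shows "(\<Sum>j<n. cut_fn a E i j * y E j) = app (y E) i - z E i"
proof -
  have "(\<Sum>j<n. cut_fn a E i j * y E j) = (\<Sum>j<n. a i j * y E j) - sg E i * (\<Sum>j<n. a i j * aw E j)"
    unfolding sum_distrib_left sum_subtractf[symmetric]
    by (rule sum.cong) (auto simp: cut_fn_def y_def algebra_simps)
  then show ?thesis using aw_app[OF assms] by (simp add: app_def)
qed

abbreviation K1 :: "nat set \<Rightarrow> nat \<Rightarrow> real" where "K1 E \<equiv> \<lambda>i. lam * v i - y E i"

abbreviation K2 :: "nat set \<Rightarrow> nat \<Rightarrow> real" where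
  "K2 E \<equiv> \<lambda>i. lam\<^sup>2 * v i - lam * y E i - app (y E) i + z E i"

lemma cut_K1:
  assumes "i < n"
  shows "(\<Sum>j<n. cut_fn a E i j * K1 E j) = K2 E i"
proof -
  have "(\<Sum>j<n. cut_fn a E i j * K1 E j) =
    lam * (\<Sum>j<n. cut_fn a E i j * v j) - (\<Sum>j<n. cut_fn a E i j * y E j)"
    by (simp add: sum_distrib_left sum_subtractf algebra_simps)
  then show ?thesis unfolding cut_v[OF assms] cut_y[OF assms]
    by (simp add: algebra_simps power2_eq_square)
qed

lemma cut_adjoint:
  "dot x (\<lambda>i. \<Sum>j<n. cut_fn a E i j * u j) = dot (\<lambda>i. \<Sum>j<n. cut_fn a E i j * x j) u"
proof -
  have "dot x (\<lambda>i. \<Sum>j<n. cut_fn a E i j * u j) = (\<Sum>i<n. \<Sum>j<n. x i * (cut_fn a E i j * u j))"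
    by (simp add: dot_def sum_distrib_left)
  also have "\<dots> = (\<Sum>j<n. \<Sum>i<n. x i * (cut_fn a E i j * u j))" by (rule sum.swap)
  also have "\<dots> = (\<Sum>j<n. \<Sum>i<n. cut_fn a E j i * x i * u j)"
    by (intro sum.cong refl) (auto simp: cut_fn_sym[OF sym] mult_ac)
  finally show ?thesis by (simp add: dot_def sum_distrib_right)
qed

lemma dot_cong: "(\<And>i. i < n \<Longrightarrow> x i = x' i) \<Longrightarrow> (\<And>i. i < n \<Longrightarrow> u i = u' i) \<Longrightarrow> dot x u = dot x' u'"
  unfolding dot_def by (rule sum.cong) auto

definition mom :: "nat \<Rightarrow> nat set \<Rightarrow> real" where
  "mom k E = (\<Sum>i<n. v i * mat_pow_vec n (cut_fn a E) v k i)"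

text \<open>The cut matrix is symmetric, so v^T K^4 v = |K^2 v|^2 and no power beyond K^2 has to be
  expanded.\<close>

lemma mom_dots:
  "mom 1 E = dot v (K1 E)" "mom 2 E = dot (K1 E) (K1 E)"
  "mom 3 E = dot (K1 E) (K2 E)" "mom 4 E = dot (K2 E) (K2 E)"
proof -
  let ?p = "mat_pow_vec n (cut_fn a E) v"
  have p1: "?p 1 i = K1 E i" if "i < n" for i using cut_v[OF that] by simp
  have p2: "?p 2 i = K2 E i" if "i < n" for i
  proof -
    have "?p 2 i = (\<Sum>j<n. cut_fn a E i j * ?p 1 j)" by (simp add: numeral_2_eq_2)
    also have "\<dots> = (\<Sum>j<n. cut_fn a E i j * K1 E j)" by (rule sum.cong) (auto simp only: p1 lessThan_iff)
    finally show ?thesis using cut_K1[OF that] by simp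
  qed
  have Suc: "dot x (?p (Suc k)) = dot (\<lambda>i. \<Sum>j<n. cut_fn a E i j * x j) (?p k)" for x k
    using cut_adjoint[of x E "?p k"] by simp
  have mom: "mom k E = dot v (?p k)" for k by (simp add: mom_def dot_def)
  have S1: "dot v (?p (Suc k)) = dot (K1 E) (?p k)" for k
    unfolding Suc by (rule dot_cong) (auto simp: cut_v)
  have S2: "dot (K1 E) (?p (Suc k)) = dot (K2 E) (?p k)" for k
    unfolding Suc by (rule dot_cong) (use cut_K1 in auto)
  show "mom 1 E = dot v (K1 E)" unfolding mom by (rule dot_cong) (use p1 in auto)
  have "mom 2 E = dot (K1 E) (?p 1)" unfolding mom using S1[of 1] by (simp add: numeral_2_eq_2)
  also have "\<dots> = dot (K1 E) (K1 E)" by (rule dot_cong) (use p1 in auto)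
  finally show "mom 2 E = dot (K1 E) (K1 E)" .
  have "mom 3 E = dot (K1 E) (?p 2)" unfolding mom using S1[of 2] by (simp add: eval_nat_numeral)
  also have "\<dots> = dot (K1 E) (K2 E)" by (rule dot_cong) (use p2 in auto)
  finally show "mom 3 E = dot (K1 E) (K2 E)" .
  have "mom 4 E = dot (K2 E) (?p 2)"
    unfolding mom using S1[of 3] S2[of 2] by (simp add: eval_nat_numeral)
  also have "\<dots> = dot (K2 E) (K2 E)" by (rule dot_cong) (use p2 in auto)
  finally show "mom 4 E = dot (K2 E) (K2 E)" .
qed

lemma dot_linear:
  "dot (\<lambda>i. x i + x' i) u = dot x u + dot x' u" "dot (\<lambda>i. x i - x' i) u = dot x u - dot x' u"
  "dot (\<lambda>i. c * x i) u = c * dot x u"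
  "dot u (\<lambda>i. x i + x' i) = dot u x + dot u x'" "dot u (\<lambda>i. x i - x' i) = dot u x - dot u x'"
  "dot u (\<lambda>i. c * x i) = c * dot u x"
  by (simp_all add: dot_def algebra_simps sum.distrib sum_subtractf sum_distrib_left)

lemma dot_commute: "dot x u = dot u x"
  by (simp add: dot_def mult.commute)

lemma dot_v_v: "dot v v = 1"
  using unit by (simp add: dot_def)

lemma dot_v_app: "dot v (app x) = lam * dot v x"
proof -
  have "dot v (app x) = (\<Sum>i<n. \<Sum>j<n. v i * (a i j * x j))" by (simp add: dot_def app_def sum_distrib_left)
  also have "\<dots> = (\<Sum>j<n. \<Sum>i<n. v i * (a i j * x j))" by (rule sum.swap)
  also have "\<dots> = (\<Sum>j<n. (\<Sum>i<n. a j i * v i) * x j)"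
    unfolding sum_distrib_right by (intro sum.cong refl) (auto simp: sym mult_ac)
  also have "\<dots> = (\<Sum>j<n. lam * (v j * x j))" by (rule sum.cong) (auto simp: eigen)
  finally show ?thesis by (simp add: dot_def sum_distrib_left)
qed

text \<open>v^T D A^2 D v = |A D v|^2, and the signs in \<open>y\<close> do not affect its
  norm.\<close>

lemma dot_v_z: "dot v (z E) = dot (y E) (y E)"
proof -
  have "dot v (z E) = (\<Sum>i<n. \<Sum>j<n. v i * sg E i * (a i j * aw E j))"
    unfolding dot_def by (rule sum.cong) (auto simp flip: aw_app simp: sum_distrib_left mult_ac)
  also have "\<dots> = (\<Sum>j<n. \<Sum>i<n. v i * sg E i * (a i j * aw E j))" by (rule sum.swap)
  also have "\<dots> = (\<Sum>j<n. aw E j * aw E j)"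
  proof (rule sum.cong[OF refl])
    fix j assume "j \<in> {..<n}"
    then show "(\<Sum>i<n. v i * sg E i * (a i j * aw E j)) = aw E j * aw E j"
      unfolding aw_def[of E j] sum_distrib_right by (intro sum.cong refl) (auto simp: sym mult_ac aw_def)
  qed
  finally show ?thesis by (simp add: dot_y_y)
qed

lemma mom_expand:
  "mom 1 E = lam - dot v (y E)"
  "mom 2 E = lam\<^sup>2 - 2 * lam * dot v (y E) + dot (y E) (y E)"
  "mom 3 E = lam ^ 3 - 3 * lam\<^sup>2 * dot v (y E) + 2 * lam * dot (y E) (y E)
    + dot (y E) (app (y E)) - dot (y E) (z E)"
  "mom 4 E = lam ^ 4 - 4 * lam ^ 3 * dot v (y E) + 3 * lam\<^sup>2 * dot (y E) (y E)
    + dot (app (y E)) (app (y E)) + dot (z E) (z E) + 2 * lam * dot (y E) (app (y E))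
    - 2 * lam * dot (y E) (z E) - 2 * dot (app (y E)) (z E)"
proof -
  note c = dot_commute[of "y E" v] dot_commute[of "app (y E)" v] dot_commute[of "z E" v]
    dot_commute[of "app (y E)" "y E"] dot_commute[of "z E" "y E"] dot_commute[of "z E" "app (y E)"]
  note e = mom_dots dot_linear c dot_v_v dot_v_app dot_v_z
  show "mom 1 E = lam - dot v (y E)"
    by (simp only: e)
  show "mom 2 E = lam\<^sup>2 - 2 * lam * dot v (y E) + dot (y E) (y E)"
    by (simp only: e) (simp add: algebra_simps power2_eq_square)
  show "mom 3 E = lam ^ 3 - 3 * lam\<^sup>2 * dot v (y E) + 2 * lam * dot (y E) (y E)
    + dot (y E) (app (y E)) - dot (y E) (z E)"
    by (simp only: e) (simp add: algebra_simps power2_eq_square power3_eq_cube)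
  show "mom 4 E = lam ^ 4 - 4 * lam ^ 3 * dot v (y E) + 3 * lam\<^sup>2 * dot (y E) (y E)
    + dot (app (y E)) (app (y E)) + dot (z E) (z E) + 2 * lam * dot (y E) (app (y E))
    - 2 * lam * dot (y E) (z E) - 2 * dot (app (y E)) (z E)"
    by (simp only: e) (simp add: algebra_simps power2_eq_square power3_eq_cube power4_eq_xxxx)
qed

lemma cut_delta_eq: "cut_delta n a E = Z E - real n * d"
proof -
  have "cut_fn a E i j * cut_fn a E j i = 2 * (a i j * a i j) - 2 * (a i j * a i j * (sg E i * sg E j))"
    if "i < n" "j < n" for i j
    using sym[OF that] by (auto simp: cut_fn_def sg_def)
  then have "(\<Sum>i<n. \<Sum>j<n. cut_fn a E i j * cut_fn a E j i) =
    (\<Sum>i<n. \<Sum>j<n. 2 * (a i j * a i j) - 2 * (a i j * a i j * (sg E i * sg E j)))"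
    by (intro sum.cong refl) auto
  also have "\<dots> = 2 * (\<Sum>i<n. \<Sum>j<n. a i j * a i j) - 2 * Z E"
    unfolding Z_def by (simp add: sum_subtractf sum_distrib_left)
  also have "(\<Sum>i<n. \<Sum>j<n. a i j * a i j) = real n * d" by (simp add: regular)
  finally show ?thesis by (simp add: cut_delta_def)
qed

lemma sum_Z: "(\<Sum>E\<in>Pow {..<n}. Z E) = 0"
proof -
  have "(\<Sum>E\<in>Pow {..<n}. Z E) = (\<Sum>k<n. \<Sum>l<n. \<Sum>E\<in>Pow {..<n}. a k l * a k l * (sg E k * sg E l))"
    unfolding Z_def by (simp only: sum.swap[of _ _ "Pow {..<n}"])
  also have "\<dots> = (\<Sum>k<n. \<Sum>l<n. 0)"
    unfolding sum_distrib_left[symmetric] by (intro sum.cong refl) (auto simp: sum_sg_2 diag)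
  finally show ?thesis by simp
qed

text \<open>The plain averages of \<open>mom 3\<close> and \<open>mom 4\<close> contain + lam, + 2
  lam^2 and - tau; the covariance with \<open>cut_delta\<close> reverses exactly these three
  signs.\<close>

lemma spectral_measure:
  assumes n: "n > 0"
  obtains R w and M :: "nat \<Rightarrow> real" where "finite R" "\<And>b. b \<in> R \<Longrightarrow> poly (cut_charpoly n a) b = 0"
    "\<And>b. b \<in> R \<Longrightarrow> w b \<ge> 0" "M = (\<lambda>k. \<Sum>b\<in>R. w b * b ^ k)"
    "M 0 = 1" "M 1 = lam" "M 2 = lam\<^sup>2 + d" "M 3 = lam ^ 3 + 2 * lam * d - lam - T"
    "M 4 = lam ^ 4 + 3 * lam\<^sup>2 * d - 2 * lam\<^sup>2 + d\<^sup>2 + N4 + tau - 2 * lam * T"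
proof (rule cut_moments[where n = n and a = a and v = v, OF sym n unit, folded mom_def])
  let ?I = "Pow {..<n}"
  fix R w and M :: "nat \<Rightarrow> real"
  assume R: "finite R" "\<And>b. b \<in> R \<Longrightarrow> poly (cut_charpoly n a) b = 0"
    "\<And>b. b \<in> R \<Longrightarrow> w b \<ge> 0" "M = (\<lambda>k. \<Sum>b\<in>R. w b * b ^ k)" "M 0 = 1"
    and m: "(\<Sum>E\<in>?I. M 1 - mom 1 E) = 0" "(\<Sum>E\<in>?I. M 2 - mom 2 E) = 0"
    "(\<Sum>E\<in>?I. M 3 - mom 3 E + cut_delta n a E * (M 1 - mom 1 E)) = 0"
    "(\<Sum>E\<in>?I. M 4 - mom 4 E + cut_delta n a E * (M 2 - mom 2 E)) = 0"
  note avg = avg_v_y avg_y_y avg_y_z avg_z_z avg_y_app_y avg_app_y_app_y avg_app_y_z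
  have N: "(2::real) ^ n \<noteq> 0" by simp
  note lin = sum.distrib sum_subtractf sum_distrib_left[symmetric] card_Pow
  have "(\<Sum>E\<in>?I. M 1 - mom 1 E) = 2 ^ n * (M 1 - lam)"
    unfolding mom_expand by (simp add: lin avg) (simp add: algebra_simps)
  with m(1) have M1: "M 1 = lam" by simp
  have "(\<Sum>E\<in>?I. M 2 - mom 2 E) = 2 ^ n * (M 2 - (lam\<^sup>2 + d))"
    unfolding mom_expand by (simp add: lin avg) (simp add: algebra_simps)
  with m(2) have M2: "M 2 = lam\<^sup>2 + d" by simp
  have Z1: "(\<Sum>E\<in>?I. cut_delta n a E * (M 1 - mom 1 E)) = 2 ^ n * (2 * lam)"
  proof -
    have "cut_delta n a E * (M 1 - mom 1 E) = Z E * dot v (y E) - real n * d * dot v (y E)" for E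
      unfolding cut_delta_eq mom_expand M1 by (simp add: algebra_simps)
    then show ?thesis by (simp add: lin avg avg_Z_v_y)
  qed
  have Z2: "(\<Sum>E\<in>?I. cut_delta n a E * (M 2 - mom 2 E)) = 2 ^ n * (4 * lam\<^sup>2 - 2 * tau)"
  proof -
    have "cut_delta n a E * (M 2 - mom 2 E) = d * Z E + 2 * lam * (Z E * dot v (y E)) - Z E * dot (y E) (y E)
      - real n * d * (d + 2 * lam * dot v (y E) - dot (y E) (y E))" for E
      unfolding cut_delta_eq mom_expand M2 by (simp add: algebra_simps)
    then show ?thesis
      by (simp add: lin avg avg_Z_v_y avg_Z_y_y sum_Z) (simp add: algebra_simps power2_eq_square)
  qed
  have s3: "(\<Sum>E\<in>?I. M 3 - mom 3 E) = 2 ^ n * (M 3 - (lam ^ 3 + 2 * lam * d + lam - T))"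
    unfolding mom_expand by (simp add: lin avg) (simp add: algebra_simps)
  have s4: "(\<Sum>E\<in>?I. M 4 - mom 4 E) =
    2 ^ n * (M 4 - (lam ^ 4 + 3 * lam\<^sup>2 * d + 2 * lam\<^sup>2 + d\<^sup>2 + N4 - tau - 2 * lam * T))"
    unfolding mom_expand by (simp add: lin avg) (simp add: algebra_simps power2_eq_square)
  have "2 ^ n * (M 3 - (lam ^ 3 + 2 * lam * d + lam - T) + 2 * lam) = 0"
    using m(3) unfolding sum.distrib s3 Z1 by (simp only: distrib_left)
  then have "M 3 - (lam ^ 3 + 2 * lam * d + lam - T) + 2 * lam = 0" using N by simp
  then have M3: "M 3 = lam ^ 3 + 2 * lam * d - lam - T" by simp
  have "2 ^ n * (M 4 - (lam ^ 4 + 3 * lam\<^sup>2 * d + 2 * lam\<^sup>2 + d\<^sup>2 + N4 - tau - 2 * lam * T) + (4 * lam\<^sup>2 - 2 * tau)) = 0"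
    using m(4) unfolding sum.distrib s4 Z2 by (simp only: distrib_left)
  then have "M 4 - (lam ^ 4 + 3 * lam\<^sup>2 * d + 2 * lam\<^sup>2 + d\<^sup>2 + N4 - tau - 2 * lam * T) + (4 * lam\<^sup>2 - 2 * tau) = 0"
    using N by simp
  then have M4: "M 4 = lam ^ 4 + 3 * lam\<^sup>2 * d - 2 * lam\<^sup>2 + d\<^sup>2 + N4 + tau - 2 * lam * T" by simp
  show thesis by (rule that[OF R M1 M2 M3 M4])
qed

end

section \<open>The eigenvalue bound\<close>

lemma quadratic_nonneg_discriminant:
  fixes p q r :: real
  assumes p: "p \<ge> 0" and nn: "\<And>x. x\<^sup>2 * p + 2 * x * q + r \<ge> 0"
  shows "q\<^sup>2 \<le> p * r"
proof (cases "p = 0")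
  case False
  then have "p > 0" using p by simp
  have "(- (q / p))\<^sup>2 * p + 2 * (- (q / p)) * q + r = r - q\<^sup>2 / p"
    using False by (simp add: field_simps power2_eq_square)
  with nn[of "- (q / p)"] have "q\<^sup>2 / p \<le> r" by simp
  with \<open>p > 0\<close> show ?thesis by (simp add: field_simps)
next
  case True
  have "q = 0"
  proof (rule ccontr)
    assume "q \<noteq> 0"
    then have "2 * (- (r + 1) / (2 * q)) * q = - (r + 1)" by simp
    with nn[of "- (r + 1) / (2 * q)"] True show False by simp
  qed
  with True show ?thesis by simp
qed

context signed_regular
begin

text \<open>The integral of (Y - b^2)(x + c (b - lam))^2 is a nonnegative quadratic form in (x, c).
  The first claim is its x^2 coefficient, the second its discriminant; centring at the mean
  \<open>lam\<close> simplifies the coefficients.\<close>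

lemma moment_inequalities:
  assumes n: "n > 0" and roots: "\<And>b. poly (cut_charpoly n a) b = 0 \<Longrightarrow> b\<^sup>2 \<le> Y"
  shows "lam\<^sup>2 + d \<le> Y"
    "(lam * d - lam - T)\<^sup>2 \<le> (Y - lam\<^sup>2 - d) * (Y * d - d\<^sup>2 - tau - N4)"
proof -
  obtain R w and M :: "nat \<Rightarrow> real" where R: "finite R" "\<And>b. b \<in> R \<Longrightarrow> poly (cut_charpoly n a) b = 0"
    "\<And>b. b \<in> R \<Longrightarrow> w b \<ge> 0" and M: "M = (\<lambda>k. \<Sum>b\<in>R. w b * b ^ k)"
    and m: "M 0 = 1" "M 1 = lam" "M 2 = lam\<^sup>2 + d" "M 3 = lam ^ 3 + 2 * lam * d - lam - T"
    "M 4 = lam ^ 4 + 3 * lam\<^sup>2 * d - 2 * lam\<^sup>2 + d\<^sup>2 + N4 + tau - 2 * lam * T"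
    by (rule spectral_measure[OF n]) (rule that)
  have nn: "0 \<le> (\<Sum>b\<in>R. w b * ((Y - b\<^sup>2) * (x + c * (b - lam))\<^sup>2))" for x c
    using R roots by (intro sum_nonneg mult_nonneg_nonneg) auto
  have expand: "(\<Sum>b\<in>R. w b * ((Y - b\<^sup>2) * (x + c * (b - lam))\<^sup>2)) =
    x\<^sup>2 * (Y * M 0 - M 2) + 2 * x * c * (Y * M 1 - M 3 - lam * (Y * M 0 - M 2)) +
    c\<^sup>2 * (Y * M 2 - M 4 - 2 * lam * (Y * M 1 - M 3) + lam\<^sup>2 * (Y * M 0 - M 2))" for x c
    unfolding M sum_distrib_left sum_subtractf[symmetric] sum.distrib[symmetric]
    by (rule sum.cong) (auto simp: algebra_simps power2_eq_square power3_eq_cube power4_eq_xxxx)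
  have eq: "(\<Sum>b\<in>R. w b * ((Y - b\<^sup>2) * (x + c * (b - lam))\<^sup>2)) =
    x\<^sup>2 * (Y - lam\<^sup>2 - d) + 2 * x * c * (- (lam * d - lam - T)) + c\<^sup>2 * (Y * d - d\<^sup>2 - tau - N4)" for x c
    unfolding expand m by (simp add: algebra_simps power2_eq_square power3_eq_cube power4_eq_xxxx)
  have P: "Y - lam\<^sup>2 - d \<ge> 0" using nn[of 1 0] unfolding eq by simp
  then show "lam\<^sup>2 + d \<le> Y" by simp
  have "(- (lam * d - lam - T))\<^sup>2 \<le> (Y - lam\<^sup>2 - d) * (Y * d - d\<^sup>2 - tau - N4)"
    using nn[of _ 1] unfolding eq by (intro quadratic_nonneg_discriminant P) simp
  then show "(lam * d - lam - T)\<^sup>2 \<le> (Y - lam\<^sup>2 - d) * (Y * d - d\<^sup>2 - tau - N4)"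
    by (simp only: power2_minus)
qed

text \<open>For each \<open>j\<close>, test the Rayleigh bound on column j of A plus a multiple of
  the unit vector at j; this bounds (A^3)_jj, and averaging with weights v_j^2 gives
  \<open>T\<close>.\<close>

lemma T_le:
  assumes lam: "lam > 0"
    and top: "\<And>x. (\<Sum>i<n. \<Sum>j<n. x i * a i j * x j) \<le> lam * (\<Sum>i<n. x i * x i)"
  shows "T \<le> lam * d - d\<^sup>2 / lam"
proof -
  \<comment> \<open>The multiple s that minimizes lam (d + s^2) - 2 s d.\<close>
  let ?s = "d / lam"
  have "(\<Sum>i<n. a i j * sq i j) \<le> lam * d - d\<^sup>2 / lam" if j: "j < n" for j
  proof -
    define x where "x i = a i j + (if i = j then ?s else 0)" for i
    have xx: "(\<Sum>i<n. x i * x i) = d + ?s\<^sup>2"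
    proof -
      have "(\<Sum>i<n. x i * x i) = (\<Sum>i<n. a j i * a j i + (if i = j then ?s\<^sup>2 else 0))"
        by (rule sum.cong) (use j in \<open>auto simp: x_def diag sym[of j] power2_eq_square\<close>)
      then show ?thesis using j by (simp add: sum.distrib regular)
    qed
    have inner: "(\<Sum>l<n. a i l * x l) = sq i j + a i j * ?s" if "i < n" for i
    proof -
      have "(\<Sum>l<n. a i l * x l) = (\<Sum>l<n. a i l * a l j + (if l = j then a i j * ?s else 0))"
        by (rule sum.cong) (auto simp: x_def algebra_simps)
      then show ?thesis using j by (simp add: sum.distrib sq_def)
    qed
    have "(\<Sum>i<n. \<Sum>l<n. x i * a i l * x l) = (\<Sum>i<n. x i * (sq i j + a i j * ?s))"
    proof (rule sum.cong[OF refl])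
      fix i assume "i \<in> {..<n}"
      then show "(\<Sum>l<n. x i * a i l * x l) = x i * (sq i j + a i j * ?s)"
        using inner[of i] by (simp add: mult.assoc flip: sum_distrib_left)
    qed
    also have "\<dots> = (\<Sum>i<n. a i j * sq i j + ?s * (a j i * a j i) + (if i = j then ?s * d else 0))"
      by (rule sum.cong) (use j in \<open>auto simp: x_def sq_diag diag sym[of j] algebra_simps\<close>)
    also have "\<dots> = (\<Sum>i<n. a i j * sq i j) + 2 * ?s * d"
      unfolding sum.distrib sum_distrib_left[symmetric] regular[OF j] using j by simp
    finally have "(\<Sum>i<n. a i j * sq i j) + 2 * ?s * d \<le> lam * (d + ?s\<^sup>2)"
      using top[of x] xx by simp
    moreover have "lam * (d + ?s\<^sup>2) - 2 * ?s * d = lam * d - d\<^sup>2 / lam"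
      using lam by (simp add: field_simps power2_eq_square)
    ultimately show ?thesis by linarith
  qed
  then have "(\<Sum>j<n. (\<Sum>i<n. a i j * sq i j) * (v j * v j)) \<le> (\<Sum>j<n. (lam * d - d\<^sup>2 / lam) * (v j * v j))"
    by (intro sum_mono mult_right_mono) auto
  also have "\<dots> = lam * d - d\<^sup>2 / lam" using unit by (simp flip: sum_distrib_left)
  also have "(\<Sum>j<n. (\<Sum>i<n. a i j * sq i j) * (v j * v j)) = T"
    unfolding T_def sum_distrib_right by (rule sum.swap)
  finally show ?thesis .
qed

text \<open>Cauchy-Schwarz for the array \<open>?c\<close> against a_ij^2 v_j: the squared norm of
  the latter is d and the inner product is T + lam/2. The squared norm of \<open>?c\<close> is at
  most N4 - d^2 + tau + d/4.\<close>

lemma N4_tau_ge: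
  assumes d: "d > 0"
  shows "d\<^sup>2 - d / 4 + (T + lam / 2)\<^sup>2 / d \<le> N4 + tau"
proof -
  define s where "s = (T + lam / 2) / d" \<comment> \<open>the least-squares multiplier in Cauchy-Schwarz\<close>
  \<comment> \<open>The summand with 1/2 completes the square: the cross term is exactly
    \<open>tau\<close>, at a cost of d/4.\<close>
  let ?c = "\<lambda>i j. a i j * sq i j * v j + a i j * v i / 2"
  have a2: "a i j * a i j \<le> 1" if "i < n" "j < n" for i j
  proof (cases "a i j = 0")
    case False
    have "a i j * (a i j * a i j - 1) = 0" using cube[OF that] by (simp add: algebra_simps)
    with False show ?thesis by simp
  qed simp
  have dd: "(\<Sum>i<n. \<Sum>j<n. a i j * a i j * (v i * v i)) = d"
  proof -
    have "(\<Sum>i<n. \<Sum>j<n. a i j * a i j * (v i * v i)) = (\<Sum>i<n. d * (v i * v i))"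
      by (rule sum.cong) (auto simp: regular simp flip: sum_distrib_right)
    then show ?thesis using unit by (simp flip: sum_distrib_left)
  qed
  have dd': "(\<Sum>i<n. \<Sum>j<n. a i j * a i j * (v j * v j)) = d"
  proof -
    have "(\<Sum>i<n. \<Sum>j<n. a i j * a i j * (v j * v j)) = (\<Sum>j<n. \<Sum>i<n. a i j * a i j * (v j * v j))"
      by (rule sum.swap)
    also have "\<dots> = (\<Sum>j<n. \<Sum>i<n. a j i * a j i * (v j * v j))"
      by (intro sum.cong refl) (auto simp: sym)
    finally show ?thesis using dd by simp
  qed
  have "0 \<le> (\<Sum>i<n. \<Sum>j<n. (?c i j - s * (a i j * a i j * v j))\<^sup>2)"
    by (intro sum_nonneg) auto
  also have "\<dots> \<le> (\<Sum>i<n. \<Sum>j<n. (sq i j * sq i j * (v j * v j) - (if i = j then d\<^sup>2 * (v j * v j) else 0))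
      + a i j * a i j * sq i j * (v i * v j) + 1 / 4 * (a i j * a i j * (v i * v i))
      - 2 * s * (a i j * sq i j * (v j * v j)) - s * (a i j * (v i * v j)) + s\<^sup>2 * (a i j * a i j * (v j * v j)))"
  proof (intro sum_mono)
    fix i j assume "i \<in> {..<n}" "j \<in> {..<n}"
    then have ij: "i < n" "j < n" by auto
    let ?a = "a i j" and ?q = "sq i j"
    have c: "?a * ?a * ?a = ?a" by (rule cube[OF ij])
    \<comment> \<open>On the diagonal \<open>a\<close> vanishes while \<open>sq i i = d\<close>;
      discarding these entries gains the term d^2.\<close>
    have "?a * ?a * (?q * ?q * (v j * v j)) \<le> ?q * ?q * (v j * v j) - (if i = j then d\<^sup>2 * (v j * v j) else 0)"
    proof (cases "i = j")
      case True then show ?thesis using ij by (simp add: diag sq_diag power2_eq_square)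
    next
      case False
      have "?a * ?a * (?q * ?q * (v j * v j)) \<le> 1 * (?q * ?q * (v j * v j))"
        by (rule mult_right_mono[OF a2[OF ij]]) simp
      with False show ?thesis by simp
    qed
    moreover have "(?c i j - s * (?a * ?a * v j))\<^sup>2 = ?a * ?a * (?q * ?q * (v j * v j))
      + ?a * ?a * ?q * (v i * v j) + 1 / 4 * (?a * ?a * (v i * v i))
      - 2 * s * ((?a * ?a * ?a) * ?q * (v j * v j)) - s * ((?a * ?a * ?a) * (v i * v j)) + s\<^sup>2 * ((?a * ?a * ?a) * ?a * (v j * v j))"
      by (simp add: power2_eq_square field_simps)
    ultimately show "(?c i j - s * (?a * ?a * v j))\<^sup>2 \<le>
      (?q * ?q * (v j * v j) - (if i = j then d\<^sup>2 * (v j * v j) else 0))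
      + ?a * ?a * ?q * (v i * v j) + 1 / 4 * (?a * ?a * (v i * v i))
      - 2 * s * (?a * ?q * (v j * v j)) - s * (?a * (v i * v j)) + s\<^sup>2 * (?a * ?a * (v j * v j))"
      unfolding c by linarith
  qed
  also have "\<dots> = N4 - d\<^sup>2 + tau + 1 / 4 * d - 2 * s * T - s * lam + s\<^sup>2 * d"
  proof -
    have "(\<Sum>i<n. \<Sum>j<n. if i = j then d\<^sup>2 * (v j * v j) else 0) = d\<^sup>2"
      using unit by (simp flip: sum_distrib_left)
    then show ?thesis
      unfolding sum.distrib sum_subtractf sum_distrib_left[symmetric] dd dd' quad_v
      by (simp add: N4_def tau_def T_def)
  qed
  finally have "d\<^sup>2 - d / 4 + (2 * s * (T + lam / 2) - s\<^sup>2 * d) \<le> N4 + tau" by (simp add: algebra_simps)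
  moreover have "2 * s * (T + lam / 2) - s\<^sup>2 * d = (T + lam / 2)\<^sup>2 / d"
    using d by (simp add: s_def field_simps power2_eq_square)
  ultimately show ?thesis by simp
qed

end

text \<open>In terms of \<open>q = \<lambda>d - \<lambda> - T\<close> the inequality only gets worse as \<open>q\<close> grows, so it is reduced
  to the least admissible value \<open>q0 = d\<^sup>2 / \<lambda> - \<lambda>\<close>; what remains is a polynomial inequality in
  \<open>d\<close> and \<open>L = \<lambda>\<^sup>2\<close>, sharp to leading order at \<open>L\<^sup>2 - 7(d - 1)L + (d - 1)\<^sup>2 = 0\<close>.\<close>

lemma numeric_contradiction:
  fixes d lam T S :: real
  assumes d8: "d \<ge> 8" and lam: "lam > 0" and P: "lam\<^sup>2 + d \<le> 8 * (d - 1)"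
    and ineq: "(lam * d - lam - T)\<^sup>2 \<le> (8 * (d - 1) - lam\<^sup>2 - d) * (8 * (d - 1) * d - d\<^sup>2 - S)"
    and S: "d\<^sup>2 - d / 4 + (T + lam / 2)\<^sup>2 / d \<le> S"
    and T: "T \<le> lam * d - d\<^sup>2 / lam"
    and L: "(d - 1)\<^sup>2 \<ge> lam\<^sup>2 * (7 * (d - 1) - lam\<^sup>2)"
  shows False
proof -
  define L where "L = lam\<^sup>2"
  define P where "P = 7 * d - 8 - L"
  define q where "q = lam * d - lam - T"
  define q0 where "q0 = d\<^sup>2 / lam - lam"
  \<comment> \<open>Chosen so that B - q = T + lam/2. \<open>C\<close> is what remains of 8(d - 1)d
    - d^2 - S after inserting the lower bound for \<open>S\<close> without its square, namely 8(d -
    1)d - 2 d^2 + d/4.\<close>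
  define B where "B = lam * d - lam / 2"
  define C where "C = 6 * d\<^sup>2 - 31 / 4 * d"
  \<comment> \<open>The coefficient of L left in the bracket \<open>?br\<close> once (d + 1/2)^2 L
    (7(d - 1) - L) is split off, the part controlled by hypothesis \<open>L\<close>.\<close>
  define G where "G = d ^ 3 - 27 / 4 * d\<^sup>2 + 21 / 4 * d + 7 / 4"
  have L0: "L > 0" using lam by (simp add: L_def)
  have Pn: "P \<ge> 0" using P by (simp add: P_def L_def)
  have Lup: "L \<le> 7 * d - 8" using Pn by (simp add: P_def)
  have dd: "8 * d \<le> d\<^sup>2" using d8 by (simp add: power2_eq_square)
  have W: "d\<^sup>2 - L > 0" using Lup dd d8 by linarith
  have q0l: "lam * q0 = d\<^sup>2 - L" using lam by (simp add: q0_def L_def field_simps power2_eq_square)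
  have q0: "q0 > 0" using q0l W lam by (metis zero_less_mult_pos)
  have qq0: "q0 \<le> q" using T by (simp add: q0_def q_def)
  have PL: "P * L \<le> (d - 1)\<^sup>2 - L" using L by (simp add: P_def L_def[symmetric] algebra_simps)
  have xL: "0 \<le> (d - 1)\<^sup>2 - L" using PL Pn L0 by (smt (verit) mult_nonneg_nonneg)
  have i: "d * q\<^sup>2 + P * (B - q)\<^sup>2 \<le> P * (C * d)"
  proof -
    have "8 * (d - 1) * d - d\<^sup>2 - S \<le> C - (B - q)\<^sup>2 / d"
      using S by (simp add: C_def B_def q_def algebra_simps power2_eq_square)
    from mult_left_mono[OF this Pn] ineq have "q\<^sup>2 \<le> P * (C - (B - q)\<^sup>2 / d)"
      by (simp add: q_def P_def L_def algebra_simps)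
    from mult_left_mono[OF this, of d] d8 have "d * q\<^sup>2 \<le> d * (P * (C - (B - q)\<^sup>2 / d))" by simp
    also have "\<dots> = P * (C * d) - P * (B - q)\<^sup>2" using d8 by (simp add: field_simps)
    finally show ?thesis by simp
  qed
  \<comment> \<open>Half the derivative of d q^2 + P (B - q)^2 is nonnegative at q0; by convexity
    the expression increases from there on.\<close>
  have slope: "B * P \<le> q0 * (d + P)"
  proof -
    have "lam * (B * P) = (d - 1 / 2) * (P * L)" by (simp add: B_def L_def algebra_simps power2_eq_square)
    also have "\<dots> \<le> (d - 1 / 2) * ((d - 1)\<^sup>2 - L)" using d8 by (intro mult_left_mono PL) auto
    also have "\<dots> \<le> d * (d\<^sup>2 - L)" using xL d8 by (intro mult_mono) (auto simp: power2_eq_square algebra_simps)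
    also have "\<dots> \<le> (d\<^sup>2 - L) * (d + P)" using mult_nonneg_nonneg[OF less_imp_le[OF W] Pn] by (simp add: algebra_simps)
    also have "\<dots> = lam * (q0 * (d + P))" by (simp add: q0l[symmetric])
    finally show ?thesis using lam by simp
  qed
  have "d * q0\<^sup>2 + P * (B - q0)\<^sup>2 \<le> d * q\<^sup>2 + P * (B - q)\<^sup>2"
  proof -
    have "d * q\<^sup>2 + P * (B - q)\<^sup>2 - (d * q0\<^sup>2 + P * (B - q0)\<^sup>2) =
      (q - q0) * ((q - q0) * (d + P) + 2 * (q0 * (d + P) - B * P))"
      by (simp add: algebra_simps power2_eq_square)
    moreover have "\<dots> \<ge> 0"
      using qq0 slope Pn d8 by (intro mult_nonneg_nonneg add_nonneg_nonneg) auto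
    ultimately show ?thesis by linarith
  qed
  with i have "d * q0\<^sup>2 + P * (B - q0)\<^sup>2 \<le> P * (C * d)" by linarith
  \<comment> \<open>Multiplying by L = lam^2 removes lam, since lam q0 = d^2 - L and lam B is a
    multiple of L.\<close>
  from mult_left_mono[OF this, of L] L0
  have "L * (d * q0\<^sup>2 + P * (B - q0)\<^sup>2) \<le> L * (P * (C * d))" by simp
  moreover have "L * (d * q0\<^sup>2 + P * (B - q0)\<^sup>2) = d * (lam * q0)\<^sup>2 + P * (lam * B - lam * q0)\<^sup>2"
    by (simp add: L_def algebra_simps power2_eq_square)
  moreover have "lam * B - lam * q0 = L * (d + 1 / 2) - d\<^sup>2"
    unfolding q0l by (simp add: B_def L_def algebra_simps power2_eq_square)
  ultimately have ii: "d * (d\<^sup>2 - L)\<^sup>2 \<le> P * (C * d * L - (L * (d + 1 / 2) - d\<^sup>2)\<^sup>2)"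
    unfolding q0l by (simp add: algebra_simps)
  let ?br = "C * d * L - (L * (d + 1 / 2) - d\<^sup>2)\<^sup>2"
  have lhs: "d * (d\<^sup>2 - L)\<^sup>2 > 0" using W d8 by simp
  have br0: "?br \<ge> 0" using ii lhs Pn by (smt (verit) mult_nonneg_nonpos)
  have brG: "?br \<le> L * G"
  proof -
    have "(d + 1 / 2)\<^sup>2 * (L * (7 * (d - 1) - L)) \<le> (d + 1 / 2)\<^sup>2 * (d - 1)\<^sup>2"
      using L unfolding L_def[symmetric] by (intro mult_left_mono) auto
    moreover have "?br = L * G + ((d + 1 / 2)\<^sup>2 * (L * (7 * (d - 1) - L)) - (d + 1 / 2)\<^sup>2 * (d - 1)\<^sup>2)
      + ((d + 1 / 2)\<^sup>2 * (d - 1)\<^sup>2 - d ^ 4)"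
      by (simp add: C_def G_def field_simps power2_eq_square power3_eq_cube power4_eq_xxxx)
    moreover have "(d + 1 / 2)\<^sup>2 * (d - 1)\<^sup>2 \<le> d ^ 4"
    proof -
      have "(d + 1 / 2) * (d - 1) \<le> d\<^sup>2" using d8 by (simp add: algebra_simps power2_eq_square)
      moreover have "0 \<le> (d + 1 / 2) * (d - 1)" using d8 by simp
      ultimately have "((d + 1 / 2) * (d - 1))\<^sup>2 \<le> (d\<^sup>2)\<^sup>2" by (intro power_mono)
      then show ?thesis by (simp add: power_mult_distrib)
    qed
    ultimately show ?thesis by linarith
  qed
  have "L * (d * (d\<^sup>2 - L)\<^sup>2) \<le> L * (P * ?br)" using ii L0 by (intro mult_left_mono) auto
  also have "\<dots> = (P * L) * ?br" by simp
  also have "\<dots> \<le> ((d - 1)\<^sup>2 - L) * ?br" by (intro mult_right_mono PL br0)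
  also have "\<dots> \<le> ((d - 1)\<^sup>2 - L) * (L * G)" by (intro mult_left_mono brG xL)
  finally have "L * (d * (d\<^sup>2 - L)\<^sup>2) \<le> L * (((d - 1)\<^sup>2 - L) * G)" by (simp add: mult_ac)
  then have iii: "d * (d\<^sup>2 - L)\<^sup>2 \<le> ((d - 1)\<^sup>2 - L) * G" using L0 by simp
  \<comment> \<open>In terms of e = d - 8 the polynomials to be shown positive have only positive
    coefficients.\<close>
  define e where "e = d - 8"
  have e: "d = e + 8" "e \<ge> 0" using d8 by (simp_all add: e_def)
  have Gpos: "G > 0"
  proof -
    have "G = e ^ 3 + 69 / 4 * e\<^sup>2 + 357 / 4 * e + 495 / 4"
      by (simp add: G_def e(1) field_simps power2_eq_square power3_eq_cube)
    then show ?thesis using e(2) by (simp add: add_nonneg_pos)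
  qed
  \<comment> \<open>The value of d(d^2 - L) - G at the extreme L = 7 d - 8. It can be negative for
    large d and is then offset by the term (2 d - 1) G, which comes from (d - 1)^2 - L = (d^2 - L) -
    (2 d - 1).\<close>
  define k where "k = - (1 / 4) * d\<^sup>2 + 11 / 4 * d - 7 / 4"
  have "k \<le> d * (d\<^sup>2 - L) - G"
  proof -
    have "d * L \<le> d * (7 * d - 8)" using Lup d8 by (intro mult_left_mono) auto
    then show ?thesis by (simp add: k_def G_def algebra_simps power2_eq_square power3_eq_cube)
  qed
  then have "(d\<^sup>2 - L) * k \<le> (d\<^sup>2 - L) * (d * (d\<^sup>2 - L) - G)" using W by (intro mult_left_mono) auto
  moreover have "(d\<^sup>2 - L) * k + (2 * d - 1) * G > 0"
  proof (cases "k \<ge> 0")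
    case True
    then show ?thesis using W Gpos d8 by (intro add_nonneg_pos mult_nonneg_nonneg mult_pos_pos) auto
  next
    case False
    then have "d\<^sup>2 * k \<le> (d\<^sup>2 - L) * k" using L0 by (intro mult_right_mono_neg) auto
    moreover have "d\<^sup>2 * k + (2 * d - 1) * G > 0"
    proof -
      have "d\<^sup>2 * k + (2 * d - 1) * G =
        7 / 4 * e ^ 4 + 177 / 4 * e ^ 3 + 811 / 2 * e\<^sup>2 + 6297 / 4 * e + 8513 / 4"
        by (simp add: k_def G_def e(1) field_simps power2_eq_square power3_eq_cube power4_eq_xxxx)
      then show ?thesis using e(2) by (simp add: add_nonneg_pos)
    qed
    ultimately show ?thesis by linarith
  qed
  moreover have "(d\<^sup>2 - L) * (d * (d\<^sup>2 - L) - G) + (2 * d - 1) * G = d * (d\<^sup>2 - L)\<^sup>2 - ((d - 1)\<^sup>2 - L) * G"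
    by (simp add: algebra_simps power2_eq_square)
  ultimately show False using iii by linarith
qed

text \<open>g and 7 - g are the two roots of X^2 - 7 X + 1; the bound 1/6 is what the case of degree
  at most 7 requires.\<close>

lemma golden_identities:
  defines "g \<equiv> ((3 + sqrt 5) / 2)\<^sup>2"
  shows "g\<^sup>2 = 7 * g - 1" "g > 6.8" "7 - g \<le> 1 / 6"
proof -
  have s5: "sqrt 5 * sqrt 5 = 5" by simp
  have g: "g = (7 + 3 * sqrt 5) / 2"
    unfolding g_def by (simp add: power2_eq_square field_simps s5)
  show "g\<^sup>2 = 7 * g - 1"
    unfolding g by (simp add: power2_eq_square field_simps s5)
  have "sqrt 5 \<ge> 2.234" by (rule real_le_rsqrt) (simp add: power2_eq_square)
  then show "g > 6.8" "7 - g \<le> 1 / 6" unfolding g by simp_all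
qed

context signed_regular
begin

lemma eigenvalue_bound:
  fixes D :: nat
  assumes n: "n > 0" and D: "d = real D" "D \<ge> 2"
    and roots: "\<And>b. poly (cut_charpoly n a) b = 0 \<Longrightarrow> b\<^sup>2 \<le> 8 * (d - 1)"
    and top: "\<And>x. (\<Sum>i<n. \<Sum>j<n. x i * a i j * x j) \<le> lam * (\<Sum>i<n. x i * x i)"
  shows "lam \<le> (3 + sqrt 5) / 2 * sqrt (d - 1)"
proof (rule ccontr)
  assume "\<not> ?thesis"
  then have big: "(3 + sqrt 5) / 2 * sqrt (d - 1) < lam" by simp
  define g where "g = ((3 + sqrt 5) / 2)\<^sup>2"
  note g = golden_identities[folded g_def]
  have d2: "d \<ge> 2" using D by simp
  have "0 \<le> (3 + sqrt 5) / 2 * sqrt (d - 1)" using d2 by simp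
  with big have lam: "lam > 0" and sqlt: "((3 + sqrt 5) / 2 * sqrt (d - 1))\<^sup>2 < lam\<^sup>2"
    by (auto simp: power_strict_mono)
  have "((3 + sqrt 5) / 2 * sqrt (d - 1))\<^sup>2 = g * (d - 1)"
    unfolding power_mult_distrib g_def using d2 by simp
  with sqlt have gL: "g * (d - 1) < lam\<^sup>2" by simp
  have P: "lam\<^sup>2 + d \<le> 8 * (d - 1)"
    by (rule moment_inequalities(1)[OF n roots])
  have ineq: "(lam * d - lam - T)\<^sup>2 \<le> (8 * (d - 1) - lam\<^sup>2 - d) * (8 * (d - 1) * d - d\<^sup>2 - tau - N4)"
    by (rule moment_inequalities(2)[OF n roots])
  show False
  proof (cases "D \<ge> 8")
    case False
    \<comment> \<open>The second moment suffices here because (7 - g)(d - 1) is at most 1.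
      Integrality of the degree closes the gap between 7 and 8.\<close>
    then have "D \<le> 7" by simp
    then have d6: "1 / 6 * (d - 1) \<le> 1" using D(1) by simp
    have "lam\<^sup>2 \<le> 7 * (d - 1) - 1" using P by simp
    with gL have "g * (d - 1) < 7 * (d - 1) - 1" by (rule less_le_trans)
    then have "1 < (7 - g) * (d - 1)" by (simp add: algebra_simps)
    also have "(7 - g) * (d - 1) \<le> 1 / 6 * (d - 1)" using g(3) d2 by (intro mult_right_mono) auto
    also note d6
    finally show False by simp
  next
    \<comment> \<open>lam^2 exceeds g (d - 1), the larger root of X^2 - 7(d - 1) X + (d - 1)^2, so
      this quadratic is nonnegative at lam^2.\<close>
    case True
    then have d8: "d \<ge> 8" using D(1) by simp
    have "(lam\<^sup>2 - g * (d - 1)) * (lam\<^sup>2 - (7 - g) * (d - 1)) \<ge> 0"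
    proof -
      have "(7 - g) * (d - 1) \<le> g * (d - 1)" using g(2) d2 by (intro mult_right_mono) auto
      then show ?thesis using gL by (intro mult_nonneg_nonneg) auto
    qed
    also have "(lam\<^sup>2 - g * (d - 1)) * (lam\<^sup>2 - (7 - g) * (d - 1)) =
      (lam\<^sup>2)\<^sup>2 - 7 * (d - 1) * lam\<^sup>2 + (7 * g - g\<^sup>2) * (d - 1)\<^sup>2"
      by (simp add: algebra_simps power2_eq_square)
    also have "7 * g - g\<^sup>2 = 1" using g(1) by simp
    finally have L: "(d - 1)\<^sup>2 \<ge> lam\<^sup>2 * (7 * (d - 1) - lam\<^sup>2)"
      by (simp add: algebra_simps power2_eq_square)
    have "(lam * d - lam - T)\<^sup>2 \<le> (8 * (d - 1) - lam\<^sup>2 - d) * (8 * (d - 1) * d - d\<^sup>2 - (N4 + tau))"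
      using ineq by (simp add: algebra_simps)
    from numeric_contradiction[OF d8 lam P this _ T_le[OF lam top] L] N4_tau_ge d2
    show False by simp
  qed
qed

end

section \<open>The upper bound on the constant\<close>

text \<open>A maximizer of the quadratic form on the unit sphere is an eigenvector. Vectors are
  functions on \<open>nat\<close> with the product topology, so the argument is uniform in
  n.\<close>

lemma rayleigh_max:
  fixes a :: "real fmat"
  assumes n: "n > 0" and sym: "\<And>i j. i < n \<Longrightarrow> j < n \<Longrightarrow> a i j = a j i"
  obtains lam v where "(\<Sum>i<n. v i * v i) = 1"
    "\<And>i. i < n \<Longrightarrow> (\<Sum>j<n. a i j * v j) = lam * v i"
    "\<And>x. (\<Sum>i<n. \<Sum>j<n. x i * a i j * x j) \<le> lam * (\<Sum>i<n. x i * x i)"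
proof -
  define Q where "Q x = (\<Sum>i<n. \<Sum>j<n. x i * a i j * x j)" for x :: "nat \<Rightarrow> real"
  define N where "N x = (\<Sum>i<n. x i * x i)" for x :: "nat \<Rightarrow> real"
  \<comment> \<open>Pinning the coordinates from n on to 0 makes the box compact by Tychonoff; it
    contains every unit vector padded in this way.\<close>
  define B where "B = (\<Pi>\<^sub>E i\<in>UNIV. if i < n then {-1..1} else {0::real})"
  have "compactin (product_topology (\<lambda>i::nat. euclidean :: real topology) UNIV) B"
    unfolding B_def compactin_PiE by auto
  then have "compact B" by (simp add: euclidean_product_topology)
  moreover have cN: "continuous_on UNIV N" and cQ: "continuous_on UNIV Q"
    unfolding N_def Q_def by (intro continuous_intros continuous_on_product_coordinates)+
  then have "closed {x. N x = 1}" by (intro closed_Collect_eq) auto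
  ultimately have comp: "compact (B \<inter> {x. N x = 1})" by (rule compact_Int_closed)
  have "(\<lambda>i. if i = 0 then 1 else 0) \<in> B \<inter> {x. N x = 1}"
    using n by (auto simp: B_def N_def if_distrib[of "\<lambda>x. x * _"] cong: if_cong)
  then have "B \<inter> {x. N x = 1} \<noteq> {}" by blast
  from continuous_attains_sup[OF comp this continuous_on_subset[OF cQ]]
  obtain v where v: "v \<in> B" "N v = 1" and max: "\<And>x. x \<in> B \<Longrightarrow> N x = 1 \<Longrightarrow> Q x \<le> Q v"
    by auto
  have top: "Q x \<le> Q v * N x" for x
  proof (cases "N x = 0")
    case True
    then have "x i = 0" if "i < n" for i
      using that by (auto simp: N_def sum_nonneg_eq_0_iff)
    then have "Q x = 0" unfolding Q_def by (intro sum.neutral ballI) auto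
    with True show ?thesis by simp
  next
    case False
    moreover have "N x \<ge> 0" unfolding N_def by (rule sum_nonneg) simp
    ultimately have pos: "N x > 0" by simp
    define s where "s = sqrt (N x)"
    have s: "s > 0" "s * s = N x" using pos by (auto simp: s_def)
    define x' where "x' i = (if i < n then x i / s else 0)" for i
    have N': "N x' = 1"
    proof -
      have "N x' = (\<Sum>i<n. x i * x i / N x)" unfolding N_def[of x'] s(2)[symmetric]
        by (rule sum.cong) (auto simp: x'_def)
      then show ?thesis using False by (simp add: N_def flip: sum_divide_distrib)
    qed
    have "x' \<in> B"
    proof -
      have "\<bar>x' i\<bar> \<le> 1" if "i < n" for i
      proof -
        have "x' i * x' i \<le> N x'" unfolding N_def using that by (intro member_le_sum) auto
        then show ?thesis using N' abs_square_le_1[of "x' i"] by (simp add: power2_eq_square)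
      qed
      then have "x' i \<in> (if i < n then {-1..1} else {0})" for i
        by (cases "i < n") (force simp: abs_le_iff, simp add: x'_def)
      then show ?thesis unfolding B_def by blast
    qed
    from max[OF this N'] have "Q x' \<le> Q v" .
    moreover have "Q x' = Q x / N x"
      unfolding Q_def sum_divide_distrib s(2)[symmetric]
      by (intro sum.cong refl) (auto simp: x'_def)
    ultimately show ?thesis using pos by (simp add: field_simps)
  qed
  have eig: "(\<Sum>j<n. a k j * v j) = Q v * v k" if k: "k < n" for k
  proof -
    let ?e = "\<lambda>t i. v i + (if i = k then t else 0)"
    have Ne: "N (?e t) = 1 + 2 * t * v k + t\<^sup>2" for t
    proof -
      have "N (?e t) = (\<Sum>i<n. v i * v i + (if i = k then 2 * t * v k + t\<^sup>2 else 0))"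
        unfolding N_def by (rule sum.cong) (auto simp: algebra_simps power2_eq_square)
      then show ?thesis using v(2) k by (simp add: sum.distrib N_def)
    qed
    have Qe: "Q (?e t) = Q v + 2 * t * (\<Sum>j<n. a k j * v j) + t\<^sup>2 * a k k" for t
    proof -
      have "Q (?e t) = (\<Sum>i<n. \<Sum>j<n. v i * a i j * v j + (if j = k then t * (v i * a i k) else 0)
        + (if i = k then t * (a k j * v j) else 0) + (if j = k then if i = k then t\<^sup>2 * a k k else 0 else 0))"
        unfolding Q_def by (intro sum.cong refl) (auto simp: algebra_simps power2_eq_square)
      also have "\<dots> = (\<Sum>i<n. (\<Sum>j<n. v i * a i j * v j) + t * (v i * a i k)
          + (if i = k then (\<Sum>j<n. t * (a k j * v j)) else 0) + (if i = k then t\<^sup>2 * a k k else 0))"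
        by (rule sum.cong[OF refl]) (use k in \<open>simp add: sum.distrib\<close>)
      also have "\<dots> = Q v + (\<Sum>i<n. t * (v i * a i k)) + (\<Sum>i<n. if i = k then (\<Sum>j<n. t * (a k j * v j)) else 0) + t\<^sup>2 * a k k"
        using k by (simp add: sum.distrib Q_def)
      also have "(\<Sum>i<n. t * (v i * a i k)) = t * (\<Sum>j<n. a k j * v j)"
        unfolding sum_distrib_left by (rule sum.cong) (auto simp: sym[OF _ k] mult_ac)
      also have "(\<Sum>i<n. if i = k then (\<Sum>j<n. t * (a k j * v j)) else 0) = t * (\<Sum>j<n. a k j * v j)"
        using k by (simp add: sum_distrib_left)
      finally show ?thesis by simp
    qed
    have akk: "Q v - a k k \<ge> 0"
    proof -
      have "Q (\<lambda>i. if i = k then 1 else 0) = (\<Sum>i<n. \<Sum>j<n. if j = k then if i = k then a k k else 0 else 0)"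
        unfolding Q_def by (intro sum.cong refl) auto
      moreover have "N (\<lambda>i. if i = k then 1 else 0) = (\<Sum>i<n. if i = k then 1 else 0)"
        unfolding N_def by (intro sum.cong refl) auto
      ultimately show ?thesis using top[of "\<lambda>i. if i = k then 1 else 0"] k by simp
    qed
    have "t\<^sup>2 * (Q v - a k k) + 2 * t * (Q v * v k - (\<Sum>j<n. a k j * v j)) + 0 \<ge> 0" for t
      using top[of "?e t"] unfolding Ne Qe by (simp add: algebra_simps)
    \<comment> \<open>First variation in the direction of the k-th unit vector: the constant term is
      0, so the linear one must vanish.\<close>
    from quadratic_nonneg_discriminant[OF akk this]
    have "(Q v * v k - (\<Sum>j<n. a k j * v j))\<^sup>2 \<le> 0" by simp
    then show ?thesis by simp
  qed
  show ?thesis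
    by (rule that[of v "Q v"]) (use v(2) eig top in \<open>auto simp: N_def Q_def\<close>)
qed

lemma rho_attained:
  fixes a :: "real fmat"
  assumes n: "n > 0"
  obtains z U where "rho (fn_mat n a) = cmod z" "\<exists>i<n. U i \<noteq> 0"
    "\<And>i. i < n \<Longrightarrow> (\<Sum>j<n. of_real (a i j) * U j) = z * U i"
proof -
  let ?A = "map_mat complex_of_real (fn_mat n a)"
  have A: "?A \<in> carrier_mat n n" by simp
  from spectral_radius_mem_max(1)[OF A n] obtain z where z: "z \<in> spectrum ?A"
    and \<rho>: "rho (fn_mat n a) = cmod z" by (auto simp: rho_def)
  from z obtain u where u: "u \<in> carrier_vec n" "u \<noteq> 0\<^sub>v n" "?A *\<^sub>v u = z \<cdot>\<^sub>v u"
    by (auto simp: spectrum_def eigenvalue_def eigenvector_def)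
  have "(\<Sum>j<n. of_real (a i j) * u $ j) = z * u $ i" if "i < n" for i
  proof -
    have "(?A *\<^sub>v u) $ i = (z \<cdot>\<^sub>v u) $ i" using u(3) by simp
    then show ?thesis using that u(1) by (simp add: scalar_prod_def atLeast0LessThan)
  qed
  with \<rho> vec_nonzeroD[OF u(1,2)] show ?thesis by (rule that[where U = "vec_index u"])
qed

text \<open>For a complex eigenvector the form splits into those of its real and imaginary parts,
  the mixed terms cancelling by symmetry; both real bounds then apply.\<close>

lemma rho_le:
  fixes a :: "real fmat"
  assumes n: "n > 0" and sym: "\<And>i j. i < n \<Longrightarrow> j < n \<Longrightarrow> a i j = a j i"
    and le: "\<And>x. (\<Sum>i<n. \<Sum>j<n. x i * a i j * x j) \<le> C * (\<Sum>i<n. x i * x i)"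
    and ge: "\<And>x. - (\<Sum>i<n. \<Sum>j<n. x i * a i j * x j) \<le> C * (\<Sum>i<n. x i * x i)"
  shows "rho (fn_mat n a) \<le> C"
proof -
  obtain z U where \<rho>: "rho (fn_mat n a) = cmod z" and nz: "\<exists>i<n. U i \<noteq> 0"
    and eq: "\<And>i. i < n \<Longrightarrow> (\<Sum>j<n. of_real (a i j) * U j) = z * U i"
    by (rule rho_attained[OF n]) (rule that)
  define S where "S = (\<Sum>i<n. (cmod (U i))\<^sup>2)"
  have S: "S > 0"
  proof -
    from nz obtain i where "i < n" "U i \<noteq> 0" by blast
    then show ?thesis unfolding S_def by (intro sum_pos2[of _ i]) auto
  qed
  let ?q = "\<lambda>x. \<Sum>i<n. \<Sum>j<n. x i * a i j * x j :: real"
  define p q where "p i = Re (U i)" and "q i = Im (U i)" for i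
  have zS: "z * of_real S = (\<Sum>i<n. \<Sum>j<n. cnj (U i) * of_real (a i j) * U j)"
  proof -
    have "(\<Sum>i<n. \<Sum>j<n. cnj (U i) * of_real (a i j) * U j) = (\<Sum>i<n. cnj (U i) * (z * U i))"
      by (rule sum.cong) (auto simp: mult.assoc simp flip: eq sum_distrib_left)
    also have "\<dots> = (\<Sum>i<n. z * of_real ((cmod (U i))\<^sup>2))"
      by (rule sum.cong) (simp_all add: complex_norm_square mult_ac del: of_real_power)
    finally show ?thesis by (simp add: S_def sum_distrib_left)
  qed
  have Q: "(\<Sum>i<n. \<Sum>j<n. cnj (U i) * of_real (a i j) * U j) = of_real (?q p + ?q q)"
  proof (rule complex_eqI)
    show "Re (\<Sum>i<n. \<Sum>j<n. cnj (U i) * of_real (a i j) * U j) = Re (of_real (?q p + ?q q))"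
    proof -
      have "Re (cnj (U i) * of_real (a i j) * U j) = p i * a i j * p j + q i * a i j * q j" for i j
        by (simp add: p_def q_def)
      then show ?thesis by (simp only: Re_sum sum.distrib Re_complex_of_real)
    qed
    have "Im (\<Sum>i<n. \<Sum>j<n. cnj (U i) * of_real (a i j) * U j) =
      (\<Sum>i<n. \<Sum>j<n. p i * a i j * q j) - (\<Sum>i<n. \<Sum>j<n. q i * a i j * p j)"
    proof -
      have "Im (cnj (U i) * of_real (a i j) * U j) = p i * a i j * q j - q i * a i j * p j" for i j
        by (simp add: p_def q_def)
      then show ?thesis by (simp only: Im_sum sum_subtractf)
    qed
    also have "(\<Sum>i<n. \<Sum>j<n. q i * a i j * p j) = (\<Sum>j<n. \<Sum>i<n. q i * a i j * p j)" by (rule sum.swap)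
    also have "\<dots> = (\<Sum>j<n. \<Sum>i<n. p j * a j i * q i)"
      by (intro sum.cong refl) (auto simp: sym mult_ac)
    finally show "Im (\<Sum>i<n. \<Sum>j<n. cnj (U i) * of_real (a i j) * U j) = Im (of_real (?q p + ?q q))" by simp
  qed
  have Sq: "S = (\<Sum>i<n. p i * p i) + (\<Sum>i<n. q i * q i)"
    unfolding S_def sum.distrib[symmetric] by (rule sum.cong) (auto simp: cmod_power2 p_def q_def simp flip: power2_eq_square)
  have "\<bar>?q p + ?q q\<bar> \<le> C * S"
    using le[of p] le[of q] ge[of p] ge[of q] unfolding Sq distrib_left abs_le_iff by linarith
  moreover have "cmod z * S = \<bar>?q p + ?q q\<bar>"
  proof -
    have "cmod (z * of_real S) = cmod (of_real (?q p + ?q q))" using zS Q by simp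
    then show ?thesis using S by (simp only: norm_mult norm_of_real abs_of_pos)
  qed
  ultimately have "cmod z * S \<le> C * S" by simp
  then have "cmod z \<le> C" using S by (rule mult_right_le_imp_le)
  then show ?thesis unfolding \<rho> .
qed

lemma poly_cut_poly_mixed:
  "poly (cut_charpoly n a) u =
    2 ^ n * poly (mixed_det_poly n [fn_mat n a, - fn_mat n a]) (u / 2)"
  using sum_det_cut_fn[of n u a "\<lambda>_ _. 0"]
  by (simp add: poly_cut_poly poly_mixed_det_poly)

lemma det_fn_cut_uminus:
  fixes a :: "real fmat"
  shows "det_fn n (\<lambda>i j. diag_fn u i j + cut_fn a E i j) = det_fn n (\<lambda>i j. diag_fn u i j - cut_fn a E i j)"
proof -
  have "det_fn n (\<lambda>i j. diag_fn u i j + cut_fn a E i j) =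
    det_fn n (\<lambda>i j. sg E i * sg E j * (diag_fn u i j - cut_fn a E i j))"
    by (rule det_fn_cong) (auto simp: sg_def cut_fn_def diag_fn_def)
  then show ?thesis by (simp only: det_fn_sg_conj)
qed

text \<open>A and -A share the root bound, so the estimate for the largest eigenvalue also covers
  the smallest.\<close>

lemma cut_poly_uminus_fn: "cut_charpoly n (\<lambda>i j. - a i j) = cut_charpoly n a"
proof (rule poly_ext)
  fix u
  have "cut_fn (\<lambda>i j. - a i j) E i j = - cut_fn a E i j" for E i j by (simp add: cut_fn_def)
  then show "poly (cut_charpoly n (\<lambda>i j. - a i j)) u = poly (cut_charpoly n a) u"
    by (simp add: poly_cut_poly det_fn_cut_uminus)
qed

lemma poly_cut_poly_uminus: "poly (cut_charpoly n a) (- u) = (- 1) ^ n * poly (cut_charpoly n a) u"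
proof -
  have "det_fn n (\<lambda>i j. diag_fn (- u) i j - cut_fn a E i j) = (- 1) ^ n * det_fn n (\<lambda>i j. diag_fn u i j - cut_fn a E i j)" for E
  proof -
    have "det_fn n (\<lambda>i j. diag_fn (- u) i j - cut_fn a E i j) = det_fn n (\<lambda>i j. (- 1) * (diag_fn u i j + cut_fn a E i j))"
      by (rule det_fn_cong) (simp add: diag_fn_def)
    then show ?thesis by (simp only: det_fn_scale det_fn_cut_uminus)
  qed
  then show ?thesis by (simp add: poly_cut_poly sum_distrib_left)
qed

text \<open>\<open>max_root\<close> bounds roots from above only; symmetry of the root set supplies
  the other side. The factor 4 comes from the substitution u / 2.\<close>

lemma cut_poly_root_le:
  fixes a :: "real fmat"
  assumes "poly (cut_charpoly n a) b = 0"
  shows "b\<^sup>2 \<le> 4 * (max_root (fn_mat n a))\<^sup>2"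
proof -
  let ?f = "mixed_det_poly n [fn_mat n a, - fn_mat n a]"
  let ?p = "cut_charpoly n a"
  have "?p \<noteq> 0" using monic_cut_poly(2)[of n a "\<lambda>_ _. 0"] by auto
  then obtain u where "poly ?p u \<noteq> 0" using poly_all_0_iff_0 by blast
  then have "?f \<noteq> 0" by (auto simp: poly_cut_poly_mixed)
  then have fin: "finite {x. poly ?f x = 0}" by (rule poly_roots_finite)
  have le: "c / 2 \<le> max_root (fn_mat n a)" if "poly ?p c = 0" for c
    unfolding max_root_def by (rule Max_ge) (use fin that in \<open>auto simp: poly_cut_poly_mixed\<close>)
  have "poly ?p (- b) = 0" using assms by (simp add: poly_cut_poly_uminus)
  from le[OF assms] le[OF this] have "\<bar>b / 2\<bar> \<le> max_root (fn_mat n a)" by (simp add: abs_le_iff)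
  then have "\<bar>b / 2\<bar>\<^sup>2 \<le> (max_root (fn_mat n a))\<^sup>2" by (intro power_mono) auto
  then show ?thesis by (simp add: power_divide)
qed

section \<open>Signed regular graphs as instances of the eigenvalue bound\<close>

definition signed_fn :: "nat set set \<Rightarrow> (nat set \<Rightarrow> real) \<Rightarrow> real fmat" where
  "signed_fn E \<sigma> i j = (if {i, j} \<in> E then \<sigma> {i, j} else 0)"

lemma signed_adj_eq: "signed_adj n E \<sigma> = mat n n (\<lambda>(i, j). signed_fn E \<sigma> i j)"
  by (simp add: signed_adj_def signed_fn_def)

lemma sum_signed_fn_square:
  assumes G: "regular_graph d n E" and \<sigma>: "\<sigma> \<in> signings E" and i: "i < n"
  shows "(\<Sum>j<n. signed_fn E \<sigma> i j * signed_fn E \<sigma> i j) = real d"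
proof -
  have E: "E \<subseteq> complete_edges n" using G by (simp add: regular_graph_def is_graph_def)
  have "bij_betw (\<lambda>j. {i, j}) {j\<in>{..<n}. {i, j} \<in> E} {e\<in>E. i \<in> e}"
  proof (rule bij_betw_imageI)
    show "inj_on (\<lambda>j. {i, j}) {j\<in>{..<n}. {i, j} \<in> E}" by (auto intro!: inj_onI simp: doubleton_eq_iff)
    show "(\<lambda>j. {i, j}) ` {j\<in>{..<n}. {i, j} \<in> E} = {e\<in>E. i \<in> e}"
    proof (intro equalityI subsetI)
      fix e assume e: "e \<in> {e\<in>E. i \<in> e}"
      with E have "e \<subseteq> {..<n}" "card e = 2" by (auto simp: complete_edges_def)
      then obtain x y where "e = {x, y}" by (auto simp: card_2_iff)
      with e \<open>e \<subseteq> {..<n}\<close> show "e \<in> (\<lambda>j. {i, j}) ` {j\<in>{..<n}. {i, j} \<in> E}"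
        by (auto simp: insert_commute)
    qed auto
  qed
  then have "card {j\<in>{..<n}. {i, j} \<in> E} = card {e\<in>E. i \<in> e}" by (rule bij_betw_same_card)
  also have "\<dots> = d" using G i by (simp add: regular_graph_def)
  finally have card: "card {j\<in>{..<n}. {i, j} \<in> E} = d" .
  have "signed_fn E \<sigma> i j * signed_fn E \<sigma> i j = (if {i, j} \<in> E then 1 else 0)" for j
    using \<sigma> by (auto simp: signed_fn_def signings_def PiE_iff)
  then have "(\<Sum>j<n. signed_fn E \<sigma> i j * signed_fn E \<sigma> i j) = (\<Sum>j<n. if {i, j} \<in> E then 1 else 0)" by simp
  also have "\<dots> = real (card {j\<in>{..<n}. {i, j} \<in> E})" by (simp add: sum.If_cases Int_def)
  finally show ?thesis using card by simp
qed

lemma signed_fn_basic: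
  assumes E: "E \<subseteq> complete_edges n" and \<sigma>: "\<sigma> \<in> signings E"
  shows "signed_fn E \<sigma> i j = signed_fn E \<sigma> j i" "signed_fn E \<sigma> i i = 0"
    "signed_fn E \<sigma> i j * signed_fn E \<sigma> i j * signed_fn E \<sigma> i j = signed_fn E \<sigma> i j"
proof -
  show "signed_fn E \<sigma> i j = signed_fn E \<sigma> j i" by (simp add: signed_fn_def insert_commute)
  show "signed_fn E \<sigma> i i = 0" using E by (auto simp: signed_fn_def complete_edges_def)
  show "signed_fn E \<sigma> i j * signed_fn E \<sigma> i j * signed_fn E \<sigma> i j = signed_fn E \<sigma> i j"
    using \<sigma> by (auto simp: signed_fn_def signings_def PiE_iff)
qed

lemma rho_admissible_le:
  assumes G: "regular_graph d n E" and d: "d \<ge> 2" and adm: "\<sigma> \<in> admissible_signings d n E"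
  shows "rho (signed_adj n E \<sigma>) \<le> (3 + sqrt 5) / 2 * sqrt (real d - 1)"
proof -
  let ?a = "signed_fn E \<sigma>" and ?C = "(3 + sqrt 5) / 2 * sqrt (real d - 1)"
  have n: "n > 0" and E: "E \<subseteq> complete_edges n" using G by (auto simp: regular_graph_def is_graph_def)
  have \<sigma>: "\<sigma> \<in> signings E" and mr: "(max_root (fn_mat n ?a))\<^sup>2 \<le> 2 * (real d - 1)"
    using adm by (auto simp: admissible_signings_def signed_adj_eq)
  note basic = signed_fn_basic[OF E \<sigma>]
  have roots: "b\<^sup>2 \<le> 8 * (real d - 1)" if "poly (cut_charpoly n ?a) b = 0" for b
    using cut_poly_root_le[OF that] mr by linarith
  \<comment> \<open>The scalar \<open>s\<close> selects A or -A, giving both ends of the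
    spectrum.\<close>
  have bound: "(\<Sum>i<n. \<Sum>j<n. x i * (s * ?a i j) * x j) \<le> ?C * (\<Sum>i<n. x i * x i)" if s: "s = 1 \<or> s = -1" for x s
  proof -
    let ?b = "\<lambda>i j. s * ?a i j"
    have ss: "s * s = 1" using s by auto
    have sym: "?b i j = ?b j i" for i j using basic(1) by simp
    obtain lam v where v: "(\<Sum>i<n. v i * v i) = 1"
      "\<And>i. i < n \<Longrightarrow> (\<Sum>j<n. ?b i j * v j) = lam * v i"
      and top: "\<And>x. (\<Sum>i<n. \<Sum>j<n. x i * ?b i j * x j) \<le> lam * (\<Sum>i<n. x i * x i)"
      by (rule rayleigh_max[OF n sym]) (rule that)
    have "signed_regular n ?b (real d) v lam"
    proof
      show "?b i j = ?b j i" for i j by (rule sym)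
      show "?b i i = 0" for i using basic(2) by simp
      show "?b i j * ?b i j * ?b i j = ?b i j" for i j
      proof -
        have "?b i j * ?b i j * ?b i j = (s * s) * s * (?a i j * ?a i j * ?a i j)" by (simp only: mult_ac)
        then show ?thesis by (simp add: ss basic(3))
      qed
      show "(\<Sum>j<n. ?b i j * ?b i j) = real d" if "i < n" for i
      proof -
        have "?b i j * ?b i j = (s * s) * (?a i j * ?a i j)" for j by (simp only: mult_ac)
        then have "(\<Sum>j<n. ?b i j * ?b i j) = (\<Sum>j<n. ?a i j * ?a i j)" by (simp only: ss mult_1)
        also have "\<dots> = real d" by (rule sum_signed_fn_square[OF G \<sigma> that])
        finally show ?thesis .
      qed
    qed (use v in auto)
    moreover have "cut_charpoly n ?b = cut_charpoly n ?a"
      using s cut_poly_uminus_fn[of n ?a] by auto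
    ultimately have "lam \<le> ?C"
      by (intro signed_regular.eigenvalue_bound[OF _ n refl d _ top]) (use roots in auto)
    then have "lam * (\<Sum>i<n. x i * x i) \<le> ?C * (\<Sum>i<n. x i * x i)"
      by (intro mult_right_mono sum_nonneg) auto
    with top[of x] show ?thesis by linarith
  qed
  show ?thesis unfolding signed_adj_eq
  proof (rule rho_le[OF n basic(1)])
    fix x :: "nat \<Rightarrow> real"
    show "(\<Sum>i<n. \<Sum>j<n. x i * ?a i j * x j) \<le> ?C * (\<Sum>i<n. x i * x i)"
      using bound[of 1 x] by simp
    show "- (\<Sum>i<n. \<Sum>j<n. x i * ?a i j * x j) \<le> ?C * (\<Sum>i<n. x i * x i)"
      using bound[of "-1" x] by (simp add: sum_negf)
  qed
qed

lemma C_mix_le: "C_mix \<le> ereal ((3 + sqrt 5) / 2)"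
  unfolding C_mix_def
proof (intro SUP_least, clarify, intro SUP_least)
  fix d n :: nat and E \<sigma>
  assume d: "2 \<le> d" and "regular_graph d n E" "\<sigma> \<in> admissible_signings d n E"
  then have "rho (signed_adj n E \<sigma>) \<le> (3 + sqrt 5) / 2 * sqrt (real d - 1)" by (intro rho_admissible_le)
  moreover have "sqrt (real d - 1) > 0" using d by simp
  ultimately show "ereal (rho (signed_adj n E \<sigma>) / sqrt (real d - 1)) \<le> ereal ((3 + sqrt 5) / 2)"
    by (simp add: divide_le_eq)
qed

section \<open>The signing of the complete graph on eight vertices\<close>

lemma det_fn_0: "det_fn 0 M = 1"
  by (simp add: det_fn_def)

lemma det_fn_Suc:
  "det_fn (Suc n) M = (\<Sum>j<Suc n. (- 1) ^ j * M 0 j * det_fn n (\<lambda>i k. M (Suc i) (if k < j then k else Suc k)))"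
proof -
  let ?A = "mat (Suc n) (Suc n) (\<lambda>(i, j). M i j)"
  have "det ?A = (\<Sum>j<Suc n. ?A $$ (0, j) * cofactor ?A 0 j)"
    by (rule laplace_expansion_row) auto
  also have "\<dots> = (\<Sum>j<Suc n. (- 1) ^ j * M 0 j * det_fn n (\<lambda>i k. M (Suc i) (if k < j then k else Suc k)))"
  proof (rule sum.cong[OF refl])
    fix j assume j: "j \<in> {..<Suc n}"
    have "mat_delete ?A 0 j = mat n n (\<lambda>(i, k). M (Suc i) (if k < j then k else Suc k))"
      by (rule eq_matI) (auto simp: mat_delete_def)
    with j show "?A $$ (0, j) * cofactor ?A 0 j = (- 1) ^ j * M 0 j * det_fn n (\<lambda>i k. M (Suc i) (if k < j then k else Suc k))"
      by (simp add: cofactor_def det_fn_def)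
  qed
  finally show ?thesis by (simp add: det_fn_def)
qed

text \<open>Sylvester's identity in scaled form: P Q and Q P have the same characteristic polynomial
  up to powers of y. It avoids expanding an 8 by 8 determinant.\<close>

lemma det_fn_low_rank:
  fixes P Q :: "'a::field fmat"
  assumes y: "y \<noteq> 0"
  shows "y ^ m * det_fn n (\<lambda>i j. diag_fn y i j - (\<Sum>l<m. P i l * Q l j)) =
    y ^ n * det_fn m (\<lambda>l k. diag_fn y l k - (\<Sum>i<n. Q l i * P i k))"
proof -
  let ?P = "mat n m (\<lambda>(i, l). P i l / y)" and ?Q = "mat m n (\<lambda>(l, j). Q l j)"
  have "det (1\<^sub>m n - ?P * ?Q) = det (1\<^sub>m m - ?Q * ?P)" by (rule det_one_minus_mult_commute) auto
  moreover have "1\<^sub>m n - ?P * ?Q = mat n n (\<lambda>(i, j). diag_fn 1 i j - (\<Sum>l<m. P i l * Q l j) / y)"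
    by (rule eq_matI) (auto simp: scalar_prod_def atLeast0LessThan diag_fn_def sum_divide_distrib)
  moreover have "1\<^sub>m m - ?Q * ?P = mat m m (\<lambda>(l, k). diag_fn 1 l k - (\<Sum>i<n. Q l i * P i k) / y)"
    by (rule eq_matI) (auto simp: scalar_prod_def atLeast0LessThan diag_fn_def sum_divide_distrib)
  ultimately have "det_fn n (\<lambda>i j. diag_fn 1 i j - (\<Sum>l<m. P i l * Q l j) / y) =
    det_fn m (\<lambda>l k. diag_fn 1 l k - (\<Sum>i<n. Q l i * P i k) / y)" by (simp add: det_fn_def)
  moreover have "det_fn n (\<lambda>i j. diag_fn y i j - (\<Sum>l<m. P i l * Q l j)) =
    y ^ n * det_fn n (\<lambda>i j. diag_fn 1 i j - (\<Sum>l<m. P i l * Q l j) / y)"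
    unfolding det_fn_scale[symmetric] by (rule det_fn_cong) (use y in \<open>auto simp: diag_fn_def algebra_simps\<close>)
  moreover have "det_fn m (\<lambda>l k. diag_fn y l k - (\<Sum>i<n. Q l i * P i k)) =
    y ^ m * det_fn m (\<lambda>l k. diag_fn 1 l k - (\<Sum>i<n. Q l i * P i k) / y)"
    unfolding det_fn_scale[symmetric] by (rule det_fn_cong) (use y in \<open>auto simp: diag_fn_def algebra_simps\<close>)
  ultimately show ?thesis by (simp add: mult_ac)
qed

lemma regular_complete: "n \<ge> 1 \<Longrightarrow> regular_graph (n - 1) n (complete_edges n)"
proof -
  assume n: "n \<ge> 1"
  have "card {e \<in> complete_edges n. v \<in> e} = n - 1" if v: "v < n" for v
  proof -
    have "bij_betw (\<lambda>j. {v, j}) ({..<n} - {v}) {e \<in> complete_edges n. v \<in> e}"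
    proof (rule bij_betw_imageI)
      show "inj_on (\<lambda>j. {v, j}) ({..<n} - {v})" by (auto intro!: inj_onI simp: doubleton_eq_iff)
      show "(\<lambda>j. {v, j}) ` ({..<n} - {v}) = {e \<in> complete_edges n. v \<in> e}"
      proof (intro equalityI subsetI)
        fix e assume e: "e \<in> {e \<in> complete_edges n. v \<in> e}"
        then have "e \<subseteq> {..<n}" "card e = 2" by (auto simp: complete_edges_def)
        then obtain x y where "e = {x, y}" "x \<noteq> y" by (auto simp: card_2_iff)
        with e \<open>e \<subseteq> {..<n}\<close> show "e \<in> (\<lambda>j. {v, j}) ` ({..<n} - {v})"
          by (auto simp: insert_commute)
      qed (use v in \<open>auto simp: complete_edges_def\<close>)
    qed
    then show ?thesis using v by (simp flip: bij_betw_same_card)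
  qed
  with n show ?thesis by (auto simp: regular_graph_def is_graph_def)
qed

definition sign8 :: "nat set \<Rightarrow> real" where
  "sign8 = restrict (\<lambda>e. if e = {0, 1} \<or> e = {0, 2} then - 1 else 1) (complete_edges 8)"

abbreviation a8 :: "real fmat" where
  "a8 \<equiv> signed_fn (complete_edges 8) sign8"

lemma sign8_signing: "sign8 \<in> signings (complete_edges 8)"
  by (auto simp: sign8_def signings_def)

definition ind0 :: "nat \<Rightarrow> 'a::zero_neq_one" where "ind0 i = (if i = 0 then 1 else 0)"

definition ind12 :: "nat \<Rightarrow> 'a::zero_neq_one" where "ind12 i = (if i = 1 \<or> i = 2 then 1 else 0)"

text \<open>The all-ones matrix minus the identity, with the two negated edges as a rank two
  correction.\<close>

lemma signed_fn8:
  assumes "i < 8" "j < 8"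
  shows "a8 i j =
    1 - diag_fn 1 i j - 2 * (ind0 i * ind12 j + ind12 i * ind0 j)"
proof -
  have "{i, j} \<in> complete_edges 8 \<longleftrightarrow> i \<noteq> j"
    using assms by (auto simp: complete_edges_def card_2_iff)
  then show ?thesis
    by (auto simp: signed_fn_def sign8_def diag_fn_def ind0_def ind12_def doubleton_eq_iff)
qed

lemma sum8: "(\<Sum>i<(8::nat). f i) = f 0 + f 1 + f 2 + f 3 + f 4 + f 5 + f 6 + (f 7 :: 'a::comm_monoid_add)"
  by (simp add: eval_nat_numeral)

text \<open>Twice the indicator of those among the vertices 1 and 2 that the cut \<open>E\<close>
  separates from 0; it carries the negated edges that survive in the cut matrix.\<close>

definition om :: "nat set \<Rightarrow> nat \<Rightarrow> real" where "om E i = ind12 i * (1 - sg E 0 * sg E i)"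

lemma cut_fn8:
  assumes "i < 8" "j < 8"
  shows "cut_fn a8 E i j =
    1 - sg E i * sg E j - 2 * (ind0 i * om E j) - 2 * (om E i * ind0 j)"
proof -
  consider "i = j" | "i \<noteq> j" "i = 0" | "i \<noteq> j" "j = 0" | "i \<noteq> j" "i \<noteq> 0" "j \<noteq> 0" by blast
  then show ?thesis unfolding cut_fn_def signed_fn8[OF assms]
    by cases (simp_all add: om_def diag_fn_def ind0_def ind12_def algebra_simps)
qed

text \<open>The cut matrices have rank at most 4, so the determinant reduces to a \<open>4 \<times> 4\<close> one.\<close>

lemma det_cut8:
  assumes y: "y \<noteq> 0"
  defines "s E \<equiv> \<Sum>i<8. sg E i" and "k E \<equiv> 2 - sg E 0 * sg E 1 - sg E 0 * (sg E 2 :: real)"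
  shows "det_fn 8 (\<lambda>i j. diag_fn y i j - cut_fn a8 E i j) =
    y ^ 8 - (64 - (s E)\<^sup>2) * y ^ 6 + 8 * k E * (6 + sg E 0 * s E) * (8 - sg E 0 * s E - k E) * y ^ 4"
proof -
  define P where "P i l = [1, sg E i, ind0 i, om E i] ! l" for i l
  define Q where "Q l j = [1, - sg E j, - 2 * om E j, - 2 * ind0 j] ! l" for l j
  \<comment> \<open>The 4 by 4 product Q P. Its entries use sum om = k, sum om^2 = 2 k (as om takes
    the values 0 and 2) and sum sg om = - sg_0 k.\<close>
  define R where "R = [[8, s E, 1, k E], [- s E, - 8, - sg E 0, sg E 0 * k E],
    [- 2 * k E, 2 * (sg E 0 * k E), 0, - 4 * k E], [- 2, - 2 * sg E 0, - 2, 0]]"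
  have four: "l = 0 \<or> l = 1 \<or> l = 2 \<or> l = 3" if "l < 4" for l :: nat using that by auto
  have PQ: "cut_fn a8 E i j = (\<Sum>l<4. P i l * Q l j)" if "i < 8" "j < 8" for i j
    unfolding cut_fn8[OF that] by (simp add: P_def Q_def eval_nat_numeral)
  have QP: "(\<Sum>i<8. Q l i * P i m) = R ! l ! m" if "l < 4" "m < 4" for l m
    using four[OF that(1)] four[OF that(2)]
    by (elim disjE)
       (simp_all add: P_def Q_def R_def sum8 om_def ind0_def ind12_def s_def k_def eval_nat_numeral algebra_simps)
  have "y ^ 4 * det_fn 8 (\<lambda>i j. diag_fn y i j - cut_fn a8 E i j) =
    y ^ 4 * det_fn 8 (\<lambda>i j. diag_fn y i j - (\<Sum>l<4. P i l * Q l j))"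
    by (intro arg_cong2[of _ _ _ _ "(*)"] refl det_fn_cong) (simp only: PQ)
  also have "\<dots> = y ^ 8 * det_fn 4 (\<lambda>l m. diag_fn y l m - (\<Sum>i<8. Q l i * P i m))"
    by (rule det_fn_low_rank[OF y])
  also have "\<dots> = y ^ 8 * det_fn 4 (\<lambda>l m. diag_fn y l m - R ! l ! m)"
    by (intro arg_cong2[of _ _ _ _ "(*)"] refl det_fn_cong) (simp only: QP)
  also have "det_fn 4 (\<lambda>l m. diag_fn y l m - R ! l ! m) =
    y ^ 4 - (64 - (s E)\<^sup>2) * y\<^sup>2 + 8 * k E * (6 + sg E 0 * s E) * (8 - sg E 0 * s E - k E)"
    unfolding R_def
    by (simp add: eval_nat_numeral det_fn_Suc det_fn_0 diag_fn_def) (simp add: algebra_simps)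
  finally have "y ^ 4 * det_fn 8 (\<lambda>i j. diag_fn y i j - cut_fn a8 E i j) =
    y ^ 4 * (y ^ 8 - (64 - (s E)\<^sup>2) * y ^ 6 + 8 * k E * (6 + sg E 0 * s E) * (8 - sg E 0 * s E - k E) * y ^ 4)"
    by (simp add: algebra_simps eval_nat_numeral)
  then show ?thesis using y by simp
qed

lemma sum_Pow_insert:
  assumes "finite A" "x \<notin> A"
  shows "(\<Sum>E\<in>Pow (insert x A). f E) = (\<Sum>E\<in>Pow A. f E + f (insert x E))"
proof -
  have "(\<Sum>E\<in>Pow (insert x A). f E) = (\<Sum>E\<in>Pow A. f E) + (\<Sum>E\<in>insert x ` Pow A. f E)"
    unfolding Pow_insert by (rule sum.union_disjoint) (use assms in auto)
  also have "(\<Sum>E\<in>insert x ` Pow A. f E) = (\<Sum>E\<in>Pow A. f (insert x E))"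
    by (subst sum.reindex) (use assms in \<open>auto intro!: inj_onI simp: o_def\<close>)
  finally show ?thesis by (simp add: sum.distrib)
qed

text \<open>Averages out the sign of vertex \<open>m\<close>: its linear contribution cancels, and
  its square adds one copy of \<open>C\<close>.\<close>

lemma sum_sg_step:
  fixes A B C :: "nat set \<Rightarrow> real"
  assumes inv: "\<And>E. A (insert m E) = A E" "\<And>E. B (insert m E) = B E" "\<And>E. C (insert m E) = C E"
  shows "(\<Sum>E\<in>Pow {..<Suc m}. A E + B E * (\<Sum>i<Suc m. sg E i) + C E * (\<Sum>i<Suc m. sg E i)\<^sup>2) =
    2 * (\<Sum>E\<in>Pow {..<m}. (A E + C E) + B E * (\<Sum>i<m. sg E i) + C E * (\<Sum>i<m. sg E i)\<^sup>2)"
proof -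
  have "(\<Sum>i<m. sg (insert m E) i) = (\<Sum>i<m. sg E i :: real)" for E
    by (rule sum.cong) (auto simp: sg_def)
  moreover have "sg (insert m E) m = (- 1 :: real)" for E by (simp add: sg_def)
  moreover have "sg E m = (1 :: real)" if "E \<in> Pow {..<m}" for E using that by (auto simp: sg_def)
  ultimately show ?thesis
    unfolding lessThan_Suc[of m] by (subst sum_Pow_insert)
      (auto simp: inv sum_distrib_left algebra_simps power2_eq_square intro!: sum.cong)
qed

text \<open>The signs at 3, ..., 7 enter only through the total sum. Averaging out these five gives
  the factor 2^5 = 32 and the summand 5 C.\<close>

lemma sum_sg_quadratic8:
  fixes A B C :: "nat set \<Rightarrow> real"
  assumes inv: "\<And>m E. m \<ge> 3 \<Longrightarrow> A (insert m E) = A E" "\<And>m E. m \<ge> 3 \<Longrightarrow> B (insert m E) = B E"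
    "\<And>m E. m \<ge> 3 \<Longrightarrow> C (insert m E) = C E"
  shows "(\<Sum>E\<in>Pow {..<8}. A E + B E * (\<Sum>i<8. sg E i) + C E * (\<Sum>i<8. sg E i)\<^sup>2) =
    32 * (\<Sum>E\<in>Pow {..<3}. (A E + 5 * C E) + B E * (\<Sum>i<3. sg E i) + C E * (\<Sum>i<3. sg E i)\<^sup>2)"
proof -
  have step: "(\<Sum>E\<in>Pow {..<Suc m}. (A E + c * C E) + B E * (\<Sum>i<Suc m. sg E i) + C E * (\<Sum>i<Suc m. sg E i)\<^sup>2) =
    2 * (\<Sum>E\<in>Pow {..<m}. (A E + (c + 1) * C E) + B E * (\<Sum>i<m. sg E i) + C E * (\<Sum>i<m. sg E i)\<^sup>2)"
    if "m \<ge> 3" for m c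
    using sum_sg_step[of "\<lambda>E. A E + c * C E" m B C] inv[OF that] by (simp add: distrib_right add.assoc)
  show ?thesis
    using step[of 7 0] step[of 6 1] step[of 5 2] step[of 4 3] step[of 3 4] by simp
qed

text \<open>These are 256 times 56 and 256 times 400. The summands are quadratic in
  \<open>s E\<close>, with coefficients depending only on the signs at 0, 1, 2.\<close>

lemma sign_sums8:
  fixes s k :: "nat set \<Rightarrow> real"
  defines "s E \<equiv> \<Sum>i<8. sg E i" and "k E \<equiv> 2 - sg E 0 * sg E 1 - sg E 0 * (sg E 2 :: real)"
  shows "(\<Sum>E\<in>Pow {..<8}. 64 - (s E)\<^sup>2) = 14336"
    "(\<Sum>E\<in>Pow {..<8}. 8 * k E * (6 + sg E 0 * s E) * (8 - sg E 0 * s E - k E)) = 102400"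
proof -
  have I: "{..<3} = {2, 1, 0::nat}" by auto
  have inv: "sg (insert m E) i = (sg E i :: real)" if "m \<ge> 3" "i < 3" for m i E
    using that by (auto simp: sg_def)
  have kinv: "k (insert m E) = k E" "sg (insert m E) 0 = (sg E 0 :: real)" if "m \<ge> 3" for m E
    using inv[OF that] by (simp_all add: k_def)
  show "(\<Sum>E\<in>Pow {..<8}. 64 - (s E)\<^sup>2) = 14336"
    using sum_sg_quadratic8[of "\<lambda>_. 64" "\<lambda>_. 0" "\<lambda>_. - 1"]
    by (simp add: s_def I) (simp add: sum_Pow_insert sg_def card_Pow)
  have e2: "sg E 0 * (sg E 0 * x) = (x::real)" for E x by simp
  have "8 * k E * (6 + sg E 0 * s E) * (8 - sg E 0 * s E - k E) =
    8 * k E * (48 - 6 * k E) + 8 * k E * (2 - k E) * sg E 0 * s E + - 8 * k E * (s E)\<^sup>2" for E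
  proof -
    have "8 * k E * (6 + sg E 0 * s E) * (8 - sg E 0 * s E - k E) =
      8 * k E * (48 - 6 * k E) + 8 * k E * (2 - k E) * sg E 0 * s E - 8 * k E * (sg E 0 * sg E 0) * (s E)\<^sup>2"
      by (simp only: algebra_simps power2_eq_square)
    then show ?thesis by simp
  qed
  then have "(\<Sum>E\<in>Pow {..<8}. 8 * k E * (6 + sg E 0 * s E) * (8 - sg E 0 * s E - k E)) =
    (\<Sum>E\<in>Pow {..<8}. 8 * k E * (48 - 6 * k E) + 8 * k E * (2 - k E) * sg E 0 * s E + - 8 * k E * (s E)\<^sup>2)"
    by simp
  also have "\<dots> = 32 * (\<Sum>E\<in>Pow {..<3}. (8 * k E * (48 - 6 * k E) + 5 * (- 8 * k E)) +
      8 * k E * (2 - k E) * sg E 0 * (\<Sum>i<3. sg E i) + - 8 * k E * (\<Sum>i<3. sg E i)\<^sup>2)"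
    unfolding s_def by (rule sum_sg_quadratic8) (simp_all only: kinv)
  also have "\<dots> = 102400"
    unfolding I by (simp add: sum_Pow_insert sg_def k_def)
  finally show "(\<Sum>E\<in>Pow {..<8}. 8 * k E * (6 + sg E 0 * s E) * (8 - sg E 0 * s E - k E)) = 102400" .
qed

lemma cut_poly8:
  assumes y: "y \<noteq> 0"
  shows "poly (cut_charpoly 8 a8) y = y ^ 8 - 56 * y ^ 6 + 400 * y ^ 4"
proof -
  let ?s = "\<lambda>E. \<Sum>i<8. sg E i :: real" and ?k = "\<lambda>E. 2 - sg E 0 * sg E 1 - sg E 0 * (sg E 2 :: real)"
  have "poly (cut_charpoly 8 a8) y =
    (\<Sum>E\<in>Pow {..<8}. y ^ 8 - (64 - (?s E)\<^sup>2) * y ^ 6 + 8 * ?k E * (6 + sg E 0 * ?s E) * (8 - sg E 0 * ?s E - ?k E) * y ^ 4) / 2 ^ 8"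
    unfolding poly_cut_poly by (simp only: diff_zero det_cut8[OF y])
  also have "(\<Sum>E\<in>Pow {..<8}. y ^ 8 - (64 - (?s E)\<^sup>2) * y ^ 6 + 8 * ?k E * (6 + sg E 0 * ?s E) * (8 - sg E 0 * ?s E - ?k E) * y ^ 4) =
    256 * y ^ 8 - (\<Sum>E\<in>Pow {..<8}. 64 - (?s E)\<^sup>2) * y ^ 6
      + (\<Sum>E\<in>Pow {..<8}. 8 * ?k E * (6 + sg E 0 * ?s E) * (8 - sg E 0 * ?s E - ?k E)) * y ^ 4"
  proof -
    have c: "(\<Sum>E\<in>Pow {..<8::nat}. y ^ 8) = 256 * y ^ 8" by (simp add: card_Pow)
    show ?thesis unfolding sum_distrib_right sum.distrib sum_subtractf[of "\<lambda>_. y ^ 8"] c ..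
  qed
  finally show ?thesis unfolding sign_sums8 by simp
qed

section \<open>Largest root and spectral radius of the example\<close>

abbreviation A8 :: "real mat" where
  "A8 \<equiv> signed_adj 8 (complete_edges 8) sign8"

lemma poly_mixed8:
  "poly (mixed_det_poly 8 [A8, - A8]) x = x ^ 4 * ((x\<^sup>2 - 2 * x - 5) * (x\<^sup>2 + 2 * x - 5))"
proof -
  let ?f = "mixed_det_poly 8 [A8, - A8]" and ?g = "[:0, 0, 0, 0, 25, 0, - 14, 0, 1:] :: real poly"
  have g: "poly ?g x = x ^ 4 * ((x\<^sup>2 - 2 * x - 5) * (x\<^sup>2 + 2 * x - 5))" for x
    by (simp add: eval_nat_numeral algebra_simps)
  have "poly ?f x = poly ?g x" if "x \<noteq> 0" for x
  proof -
    have "256 * poly ?f x = (2 * x) ^ 8 - 56 * (2 * x) ^ 6 + 400 * (2 * x) ^ 4"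
      using poly_cut_poly_mixed[of 8 "a8" "2 * x"] cut_poly8[of "2 * x"] that
      by (simp add: signed_adj_eq)
    then show ?thesis unfolding g by (simp add: power_mult_distrib eval_nat_numeral algebra_simps)
  qed
  \<comment> \<open>The determinant formula is available only for nonzero arguments; the extra
    factor X covers x = 0.\<close>
  then have "poly ([:0, 1:] * (?f - ?g)) x = 0" for x by (cases "x = 0") simp_all
  then have "[:0, 1:] * (?f - ?g) = 0" using poly_all_0_iff_0 by blast
  then have "?f = ?g" by (simp del: mult_pCons_left)
  then show ?thesis by (simp only: g)
qed

lemma max_root8: "max_root A8 = 1 + sqrt 6"
proof -
  let ?f = "mixed_det_poly 8 [A8, - A8]"
  have "poly ?f 1 \<noteq> 0" by (simp add: poly_mixed8)
  then have "?f \<noteq> 0" by auto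
  then have fin: "finite {x. poly ?f x = 0}" by (rule poly_roots_finite)
  have s6: "sqrt 6 * sqrt 6 = 6" by simp
  have "Max {x. poly ?f x = 0} = 1 + sqrt 6"
  proof (rule Max_eqI[OF fin])
    have "(1 + sqrt 6)\<^sup>2 - 2 * (1 + sqrt 6) - 5 = 0"
      by (simp add: power2_eq_square algebra_simps s6)
    then show "1 + sqrt 6 \<in> {x. poly ?f x = 0}"
      by (simp only: mem_Collect_eq poly_mixed8 mult_zero_left mult_zero_right)
  next
    fix x assume "x \<in> {x. poly ?f x = 0}"
    then have x: "x ^ 4 * ((x\<^sup>2 - 2 * x - 5) * (x\<^sup>2 + 2 * x - 5)) = 0" by (simp add: poly_mixed8)
    show "x \<le> 1 + sqrt 6"
    proof (rule ccontr)
      assume "\<not> ?thesis"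
      then have gt: "sqrt 6 < x - 1" by simp
      moreover have "0 \<le> sqrt 6" by simp
      ultimately have "(sqrt 6)\<^sup>2 < (x - 1)\<^sup>2" by (intro power_strict_mono) auto
      then have p: "x\<^sup>2 - 2 * x - 5 > 0" by (simp add: power2_eq_square algebra_simps)
      have "x > 0" using gt \<open>0 \<le> sqrt 6\<close> by linarith
      with p have "x\<^sup>2 + 2 * x - 5 > 0" by linarith
      with p \<open>x > 0\<close> x show False by simp
    qed
  qed
  then show ?thesis by (simp add: max_root_def signed_adj_def)
qed

text \<open>Eigenvalue equations of A + 1 for the partition {0}, {1, 2}, {3, ..., 7}, with w = z +
  1, a = u_0, b = u_1 = u_2 and s the sum of all entries. Multiplying by w^2 - 8 eliminates a and b
  without division.\<close>

lemma quotient_relations: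
  fixes a b s w :: complex
  assumes a: "w * a = s - 4 * b" and b: "w * b = s - 2 * a" and s: "w * s = w * (a + 2 * b) + 5 * s"
  shows "(w * w * w - 8 * (w * w) + 40) * s = 0" "s = 0 \<Longrightarrow> a = - 2 * b \<Longrightarrow> b = 0"
proof -
  have "(w * w - 8) * a = w * (w * a) - 8 * a" by (simp add: algebra_simps)
  also have "\<dots> = w * s - 4 * (w * b) - 8 * a" unfolding a by (simp add: algebra_simps)
  also have "\<dots> = (w - 4) * s" unfolding b by (simp add: algebra_simps)
  finally have a8: "(w * w - 8) * a = (w - 4) * s" .
  have "(w * w - 8) * b = w * (w * b) - 8 * b" by (simp add: algebra_simps)
  also have "\<dots> = w * s - 2 * (w * a) - 8 * b" unfolding b by (simp add: algebra_simps)
  also have "\<dots> = (w - 2) * s" unfolding a by (simp add: algebra_simps)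
  finally have b8: "(w * w - 8) * b = (w - 2) * s" .
  have "(w * w - 8) * (w * s) = w * ((w * w - 8) * a + 2 * ((w * w - 8) * b)) + 5 * ((w * w - 8) * s)"
    unfolding s by (simp add: algebra_simps)
  also have "\<dots> = w * ((w - 4) * s + 2 * ((w - 2) * s)) + 5 * ((w * w - 8) * s)" unfolding a8 b8 ..
  finally show "(w * w * w - 8 * (w * w) + 40) * s = 0" by (simp add: algebra_simps)
  assume "s = 0" "a = - 2 * b"
  with a b have "w * b * 2 = 4 * b" "w * b = 4 * b" by simp_all
  then show "b = 0" by simp
qed

text \<open>For w nonzero, an eigenvector is constant on the classes of the quotient and s is
  nonzero, so w solves the cubic, which is (z + 3)(z^2 - 8 z + 11) in z. The case w = 0 gives z =
  -1.\<close>

lemma eigen8: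
  fixes u :: "nat \<Rightarrow> complex"
  assumes eq: "\<And>i. i < 8 \<Longrightarrow> (\<Sum>j<8. of_real (a8 i j) * u j) = z * u i"
    and nz: "\<exists>i<8. u i \<noteq> 0"
  shows "cmod z \<le> 4 + sqrt 5"
proof -
  define s where "s = (\<Sum>i<8. u i)"
  define w where "w = z + 1"
  have row: "w * u i = s - 2 * ind0 i * (u 1 + u 2) - 2 * ind12 i * u 0" if "i < 8" for i
  proof -
    have "(\<Sum>j<8. of_real (a8 i j) * u j) =
      (\<Sum>j<8. u j - (if j = i then u i else 0) - 2 * ind0 i * (ind12 j * u j) - 2 * ind12 i * (ind0 j * u j))"
      by (rule sum.cong) (use that in \<open>auto simp: signed_fn8 diag_fn_def ind0_def ind12_def\<close>)
    also have "\<dots> = s - u i - 2 * ind0 i * (\<Sum>j<8. ind12 j * u j) - 2 * ind12 i * (\<Sum>j<8. ind0 j * u j)"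
      using that by (simp add: sum_subtractf sum_distrib_left s_def)
    also have "(\<Sum>j<8. ind12 j * u j) = u 1 + u 2" by (simp add: sum8 ind12_def)
    also have "(\<Sum>j<8. ind0 j * u j) = u 0" by (simp add: sum8 ind0_def)
    finally show ?thesis using eq[OF that] by (simp add: w_def algebra_simps)
  qed
  have r0: "w * u 0 = s - 2 * (u 1 + u 2)" using row[of 0] by (simp add: ind0_def ind12_def)
  have r1: "w * u 1 = s - 2 * u 0" "w * u 2 = s - 2 * u 0" using row[of 1] row[of 2] by (simp_all add: ind0_def ind12_def)
  have r3: "w * u 3 = s" "w * u 4 = s" "w * u 5 = s" "w * u 6 = s" "w * u 7 = s"
    using row[of 3] row[of 4] row[of 5] row[of 6] row[of 7] by (simp_all add: ind0_def ind12_def)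
  have s: "s = u 0 + u 1 + u 2 + u 3 + u 4 + u 5 + u 6 + u 7" by (simp add: s_def sum8)
  have "z = - 1 \<or> z = - 3 \<or> z\<^sup>2 - 8 * z + 11 = 0"
  proof (cases "w = 0")
    case True then show ?thesis by (simp add: w_def eq_neg_iff_add_eq_0)
  next
    case False
    from r1 False have u2: "u 2 = u 1" by (metis mult_left_cancel)
    have "w * s = w * (u 0 + 2 * u 1) + (w * u 3 + w * u 4 + w * u 5 + w * u 6 + w * u 7)"
      by (subst s) (simp add: u2 algebra_simps)
    then have ws: "w * s = w * (u 0 + 2 * u 1) + 5 * s" unfolding r3 by simp
    have a: "w * u 0 = s - 4 * u 1" using r0 unfolding u2 by simp
    note quot = quotient_relations[OF a r1(1) ws]
    note cubic = quot(1)
    have "s \<noteq> 0"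
    proof
      assume s0: "s = 0"
      then have u3: "u 3 = 0" "u 4 = 0" "u 5 = 0" "u 6 = 0" "u 7 = 0" using r3 False by auto
      have u01: "u 0 = - 2 * u 1" using s s0 unfolding u2 u3 by (simp add: eq_neg_iff_add_eq_0 add.commute)
      have "u 1 = 0" by (rule quot(2)[OF s0 u01])
      with u01 u2 u3 have u0: "u 0 = 0" "u 1 = 0" "u 2 = 0" by auto
      have "u i = 0" if "i < 8" for i
      proof -
        have "i \<in> {0, 1, 2, 3, 4, 5, 6, 7}" using that by auto
        then show ?thesis using u0 u3 by blast
      qed
      with nz show False by blast
    qed
    with cubic have "w * w * w - 8 * (w * w) + 40 = 0" by simp
    moreover have "w * w * w - 8 * (w * w) + 40 = (z + 3) * (z\<^sup>2 - 8 * z + 11)"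
      by (simp add: w_def power2_eq_square algebra_simps)
    ultimately have "(z + 3) * (z\<^sup>2 - 8 * z + 11) = 0" by simp
    then show ?thesis by (auto simp: eq_neg_iff_add_eq_0)
  qed
  then show ?thesis
  proof (elim disjE)
    assume q: "z\<^sup>2 - 8 * z + 11 = 0"
    have "of_real (sqrt 5) * of_real (sqrt 5) = (of_real (sqrt 5 * sqrt 5) :: complex)" by (rule of_real_mult[symmetric])
    then have s5: "of_real (sqrt 5) * of_real (sqrt 5) = (5::complex)" by simp
    have "(z - (4 + t)) * (z - (4 - t)) = z\<^sup>2 - 8 * z + 16 - t * t" for t
      by (simp add: power2_eq_square algebra_simps)
    from this[of "of_real (sqrt 5)"] have "(z - (4 + of_real (sqrt 5))) * (z - (4 - of_real (sqrt 5))) = 0"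
      using q unfolding s5 by (simp add: add.commute)
    then have "z = of_real (4 + sqrt 5) \<or> z = of_real (4 - sqrt 5)" by auto
    moreover have "sqrt 5 \<ge> 0" "sqrt 5 \<le> 3" by (simp_all add: real_le_lsqrt)
    ultimately show ?thesis by (auto simp only: norm_of_real)
  qed auto
qed

lemma rho8: "rho A8 = 4 + sqrt 5"
proof -
  let ?a = "a8"
  let ?A = "map_mat complex_of_real A8"
  have A: "?A \<in> carrier_mat 8 8" by (simp add: signed_adj_def)
  have mv: "(?A *\<^sub>v u) $ i = (\<Sum>j<8. of_real (?a i j) * u $ j)" if "i < 8" "u \<in> carrier_vec 8" for u i
    using that by (simp add: signed_adj_eq scalar_prod_def atLeast0LessThan)
  obtain z U where "rho (fn_mat 8 a8) = cmod z" and U: "\<exists>i<8. U i \<noteq> 0"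
    "\<And>i. i < 8 \<Longrightarrow> (\<Sum>j<8. of_real (a8 i j) * U j) = z * U i"
    by (rule rho_attained[of 8 a8]) (simp, rule that)
  with eigen8[OF U(2,1)] have "rho A8 \<le> 4 + sqrt 5" by (simp only: signed_adj_eq)
  moreover have "4 + sqrt 5 \<le> rho A8"
  proof -
    \<comment> \<open>The quotient relations at w = 5 + sqrt 5, normalized by s = w^2 - 8: the three
      class values are w - 4, w - 2 and s / w.\<close>
    define r where "r i = (if i = 0 then 1 + sqrt 5 else if i = 1 \<or> i = 2 then 3 + sqrt 5 else 3 + 7 / 5 * sqrt 5)" for i :: nat
    let ?u = "vec 8 (\<lambda>i. complex_of_real (r i))"
    have s5: "sqrt 5 * sqrt 5 = 5" by simp
    have ar: "(\<Sum>j<8. ?a i j * r j) = (4 + sqrt 5) * r i" if i: "i < 8" for i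
    proof -
      have "(\<Sum>j<8. ?a i j * r j) = (\<Sum>j<8. r j - (if j = i then r i else 0) - 2 * ind0 i * (ind12 j * r j) - 2 * ind12 i * (ind0 j * r j))"
        by (rule sum.cong) (use i in \<open>auto simp: signed_fn8 diag_fn_def ind0_def ind12_def\<close>)
      also have "\<dots> = (\<Sum>j<8. r j) - r i - 2 * ind0 i * (\<Sum>j<8. ind12 j * r j) - 2 * ind12 i * (\<Sum>j<8. ind0 j * r j)"
        using i by (simp add: sum_subtractf sum_distrib_left)
      also have "\<dots> = (4 + sqrt 5) * r i"
        using s5 by (simp add: sum8 r_def ind0_def ind12_def algebra_simps)
      finally show ?thesis .
    qed
    have "?A *\<^sub>v ?u = complex_of_real (4 + sqrt 5) \<cdot>\<^sub>v ?u"
    proof (rule eq_vecI)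
      fix i assume "i < dim_vec (complex_of_real (4 + sqrt 5) \<cdot>\<^sub>v ?u)"
      then have i: "i < 8" by simp
      have "(?A *\<^sub>v ?u) $ i = (\<Sum>j<8. of_real (?a i j * r j))"
        using mv[OF i, of ?u] by simp
      also have "\<dots> = of_real ((4 + sqrt 5) * r i)" by (simp only: ar[OF i] flip: of_real_sum)
      finally show "(?A *\<^sub>v ?u) $ i = (complex_of_real (4 + sqrt 5) \<cdot>\<^sub>v ?u) $ i" using i by simp
    qed (simp add: signed_adj_def)
    moreover have "?u \<noteq> 0\<^sub>v 8"
    proof
      assume "?u = 0\<^sub>v 8"
      then have "?u $ 0 = 0\<^sub>v 8 $ 0" by (rule arg_cong)
      then have "complex_of_real (r 0) = 0" by simp
      then have "r 0 = 0" by (simp only: of_real_eq_0_iff)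
      then have "1 + sqrt 5 = 0" by (simp add: r_def)
      moreover have "sqrt 5 \<ge> 0" by simp
      ultimately show False by linarith
    qed
    moreover have "?u \<in> carrier_vec (dim_row ?A)" by (simp add: signed_adj_def)
    ultimately have "eigenvector ?A ?u (complex_of_real (4 + sqrt 5))"
      unfolding eigenvector_def by (metis carrier_matD(1) A)
    then have "complex_of_real (4 + sqrt 5) \<in> spectrum ?A"
      unfolding spectrum_def eigenvalue_def by blast
    then have "cmod (complex_of_real (4 + sqrt 5)) \<in> norm ` spectrum ?A" by (rule imageI)
    from spectral_radius_mem_max(2)[OF A _ this] show ?thesis
      unfolding rho_def norm_of_real by simp
  qed
  ultimately show ?thesis by simp
qed

theorem theorem1p6:
  shows "regular_graph 7 8 (complete_edges 8) \<and>
    (\<exists>\<sigma> \<in> signings (complete_edges 8).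
      let A = signed_adj 8 (complete_edges 8) \<sigma> in
        (max_root A)\<^sup>2 = 7 + 2 * sqrt 6 \<and>
        7 + 2 * sqrt 6 < (12::real) \<and>
        (12::real) = 2 * (real 7 - 1) \<and>
        rho A = 4 + sqrt 5) \<and>
    ereal ((4 + sqrt 5) / sqrt 6) \<le> C_mix \<and>
    C_mix \<le> ereal ((3 + sqrt 5) / 2)"
proof -
  have reg: "regular_graph 7 8 (complete_edges 8)" using regular_complete[of 8] by simp
  have mr: "(max_root A8)\<^sup>2 = 7 + 2 * sqrt 6"
    unfolding max_root8 by (simp add: power2_eq_square algebra_simps)
  have "sqrt 6 < 5 / 2" by (rule real_less_lsqrt) (simp_all add: power2_eq_square)
  then have less: "7 + 2 * sqrt 6 < 12" by simp
  have "sign8 \<in> admissible_signings 7 8 (complete_edges 8)"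
    unfolding admissible_signings_def using sign8_signing mr less by simp
  then have "ereal (rho A8 / sqrt (real 7 - 1)) \<le>
    (SUP \<sigma> \<in> admissible_signings 7 8 (complete_edges 8). ereal (rho (signed_adj 8 (complete_edges 8) \<sigma>) / sqrt (real 7 - 1)))"
    by (rule SUP_upper)
  also have "\<dots> \<le> C_mix"
  proof -
    have mem: "(7, 8, complete_edges 8) \<in> {(d, n, E). d \<ge> 2 \<and> regular_graph d n E}" using reg by simp
    show ?thesis unfolding C_mix_def by (rule order.trans[OF _ SUP_upper[OF mem]]) simp
  qed
  finally have "ereal (rho A8 / sqrt (real 7 - 1)) \<le> C_mix" .
  moreover have "real 7 - 1 = 6" by simp
  ultimately have lower: "ereal ((4 + sqrt 5) / sqrt 6) \<le> C_mix" by (simp only: rho8)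
  have ex: "\<exists>\<sigma> \<in> signings (complete_edges 8).
      let A = signed_adj 8 (complete_edges 8) \<sigma> in
        (max_root A)\<^sup>2 = 7 + 2 * sqrt 6 \<and>
        7 + 2 * sqrt 6 < (12::real) \<and>
        (12::real) = 2 * (real 7 - 1) \<and>
        rho A = 4 + sqrt 5"
    unfolding Let_def
  proof (intro bexI[of _ sign8] conjI)
    show "(12::real) = 2 * (real 7 - 1)" by simp
  qed (fact mr less rho8 sign8_signing)+
  show ?thesis by (intro conjI reg ex lower C_mix_le)
qed

end
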